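(* For all sufficiently large $n$ the following holds. Let $K\subset\mathbb{R}^n$ be a bounded closed centrally-symmetric convex body and let $k$ be a positive integer. Then $$\chi(\mathbb{R}_{K}^n) \leq (1 + \gamma(K, k))^n\Big[n\ln n+n\ln \ln n+2\ln k+2n\big(1+\ln (2 \gamma(K, k))\big)\Big].$$ In particular, if $K_n\subset\mathbb{R}^n$ is a sequence of such bodies and $k_n$ is a sequence of positive integers such that $k_n\leq n^{cn}$ for some absolute constant $c$, then $$\chi(\mathbb{R}_{K_n}^n) \leq (1 + \gamma(K_n, k_n)+o(1))^n \quad (n\to\infty).$$
   Context: For a bounded closed convex body $K\subset\mathbb{R}^n$ centrally symmetric about the origin, $\mathbb{R}^n_K$ denotes $\mathbb{R}^n$ with the norm whose unit ball is $K$ (i.e. $\|x\|_K=\inf\{t>0: x\in tK\}$), and $\chi(\mathbb{R}^n_K)$ is the chromatic number of this normed space: the smallest number of colors needed to color all points of $\mathbb{R}^n$ so that any two points at $\|\cdot\|_K$-distance exactly $1$ receive different colors. Let $\Omega$ be a lattice in $\mathbb{R}^n$. A multilattice is a set $\Phi=\bigcup_{i=1}^{k}(\Omega+x_i)$ for finitely many vectors $x_1,\dots,x_k$; $q(\Phi)$ denotes the number $k$ of translates of $\Omega$ in $\Phi$. A tiling $\Psi$ of $\mathbb{R}^n$ by convex polytopes is associated with $\Phi$ if there is a bijection $x\mapsto\psi_x$ between the points of $\Phi$ and the polytopes of $\Psi$ such that each $x$ lies in the interior of $\psi_x$. The tiling parameter is $$\gamma(K,\Phi,\Psi)=\inf\{\beta/\alpha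 : \alpha K+x\subset\psi_x\subset\beta K+x \text{ for all } x\in\Phi\},$$ and $\gamma(K,k)=\inf\gamma(K,\Phi,\Psi)$, the infimum over all multilattices $\Phi$ with $q(\Phi)\le k$ and all tilings $\Psi$ associated with them. *)

theory Defs
  imports "HOL-Analysis.Analysis" "HOL-Analysis.Finite_Function_Topology"
begin

text \<open>
  The dimension is quantified inside the statement, so it cannot be a type. The space
  \<open>\<real>\<^sup>n\<close> is the \<open>n\<close>-dimensional subspace of the normed space of finitely supported real
  sequences spanned by the first \<open>n\<close> unit vectors. The norm of the ambient type is the
  sum of the absolute values of the coordinates; on this subspace it induces the usual
  topology and the usual bounded sets.
\<close>

type_synonym rvec = "nat \<Rightarrow>\<^sub>0 real"

definition Rn :: "nat \<Rightarrow> rvec set" where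
  "Rn n = {x. Poly_Mapping.keys x \<subseteq> {..<n}}"

text \<open>Interiors have to be taken relative to \<^term>\<open>Rn n\<close>, which has empty interior in the
  ambient type.\<close>

definition Rn_interior :: "nat \<Rightarrow> rvec set \<Rightarrow> rvec set" where
  "Rn_interior n S = top_of_set (Rn n) interior_of S"

definition symmetric_convex_body :: "nat \<Rightarrow> rvec set \<Rightarrow> bool" where
  "symmetric_convex_body n K \<longleftrightarrow>
     K \<subseteq> Rn n \<and> closed K \<and> bounded K \<and> convex K \<and> Rn_interior n K \<noteq> {} \<and> uminus ` K = K"

definition body_norm :: "rvec set \<Rightarrow> rvec \<Rightarrow> real" where
  "body_norm K x = Inf {t. 0 < t \<and> x \<in> (\<lambda>y. t *\<^sub>R y) ` K}"

definition proper_coloring :: "nat \<Rightarrow> rvec set \<Rightarrow> nat \<Rightarrow> (rvec \<Rightarrow> nat) \<Rightarrow> bool" where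
  "proper_coloring n K m c \<longleftrightarrow>
     c ` Rn n \<subseteq> {..<m} \<and>
     (\<forall>x\<in>Rn n. \<forall>y\<in>Rn n. body_norm K (x - y) = 1 \<longrightarrow> c x \<noteq> c y)"

text \<open>The value is \<open>\<infinity>\<close> if no finite number of colours suffices.\<close>

definition chromatic_number :: "nat \<Rightarrow> rvec set \<Rightarrow> enat" where
  "chromatic_number n K = Inf {enat m | m. \<exists>c. proper_coloring n K m c}"

definition is_lattice :: "nat \<Rightarrow> rvec set \<Rightarrow> bool" where
  "is_lattice n \<Omega> \<longleftrightarrow>
     (\<exists>B. finite B \<and> independent B \<and> span B = Rn n \<and>
          \<Omega> = {(\<Sum>b\<in>B. of_int (z b) *\<^sub>R b) | z :: rvec \<Rightarrow> int. True})"

definition is_multilattice :: "nat \<Rightarrow> rvec set \<Rightarrow> rvec set \<Rightarrow> bool" where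
  "is_multilattice n \<Omega> \<Phi> \<longleftrightarrow>
     is_lattice n \<Omega> \<and>
     (\<exists>X. finite X \<and> X \<noteq> {} \<and> X \<subseteq> Rn n \<and> \<Phi> = (\<Union>x\<in>X. (+) x ` \<Omega>))"

text \<open>The number \<open>q(\<Phi>)\<close> of distinct translates of \<open>\<Omega>\<close> that make up \<open>\<Phi>\<close>.\<close>

definition num_translates :: "rvec set \<Rightarrow> rvec set \<Rightarrow> nat" where
  "num_translates \<Omega> \<Phi> = card ((\<lambda>x. (+) x ` \<Omega>) ` \<Phi>)"

definition is_polytope_tiling :: "nat \<Rightarrow> rvec set set \<Rightarrow> bool" where
  "is_polytope_tiling n \<Psi> \<longleftrightarrow>
     (\<forall>P\<in>\<Psi>. polytope P \<and> Rn_interior n P \<noteq> {}) \<and>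
     \<Union>\<Psi> = Rn n \<and>
     pairwise (\<lambda>P Q. Rn_interior n P \<inter> Rn_interior n Q = {}) \<Psi>"

definition associated_via ::
    "nat \<Rightarrow> rvec set \<Rightarrow> rvec set set \<Rightarrow> (rvec \<Rightarrow> rvec set) \<Rightarrow> bool" where
  "associated_via n \<Phi> \<Psi> \<psi> \<longleftrightarrow> bij_betw \<psi> \<Phi> \<Psi> \<and> (\<forall>x\<in>\<Phi>. x \<in> Rn_interior n (\<psi> x))"

definition associated :: "nat \<Rightarrow> rvec set \<Rightarrow> rvec set set \<Rightarrow> bool" where
  "associated n \<Phi> \<Psi> \<longleftrightarrow> is_polytope_tiling n \<Psi> \<and> (\<exists>\<psi>. associated_via n \<Phi> \<Psi> \<psi>)"

text \<open>The tiles of a tiling have disjoint interiors, so the bijection \<open>\<psi>\<close> below is determined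
  on \<open>\<Phi>\<close> by \<open>\<Phi>\<close> and \<open>\<Psi>\<close>. The infimum is taken in the extended reals: it is \<open>\<infinity>\<close> if no pair
  \<open>\<alpha>, \<beta>\<close> is admissible.\<close>

definition tiling_parameter :: "nat \<Rightarrow> rvec set \<Rightarrow> rvec set \<Rightarrow> rvec set set \<Rightarrow> ereal" where
  "tiling_parameter n K \<Phi> \<Psi> =
     Inf {ereal (\<beta> / \<alpha>) | \<alpha> \<beta> \<psi>.
            0 < \<alpha> \<and> 0 < \<beta> \<and> associated_via n \<Phi> \<Psi> \<psi> \<and>
            (\<forall>x\<in>\<Phi>. (\<lambda>y. \<alpha> *\<^sub>R y + x) ` K \<subseteq> \<psi> x \<and> \<psi> x \<subseteq> (\<lambda>y. \<beta> *\<^sub>R y + x) ` K)}"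

definition min_tiling_parameter :: "nat \<Rightarrow> rvec set \<Rightarrow> nat \<Rightarrow> ereal" where
  "min_tiling_parameter n K k =
     Inf {tiling_parameter n K \<Phi> \<Psi> | \<Omega> \<Phi> \<Psi>.
            is_multilattice n \<Omega> \<Phi> \<and> num_translates \<Omega> \<Phi> \<le> k \<and> associated n \<Phi> \<Psi>}"

text \<open>For a symmetric convex body and \<open>k \<ge> 1\<close> the infimum above is a real number that is at
  least 1 (the integer lattice with its tiling by unit cubes has a finite parameter), so the
  conversion loses nothing.\<close>

definition tiling_gamma :: "nat \<Rightarrow> rvec set \<Rightarrow> nat \<Rightarrow> real" where
  "tiling_gamma n K k = real_of_ereal (min_tiling_parameter n K k)"

end

theory Submission
  imports Defs "HOL-Real_Asymp.Real_Asymp"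
begin

text \<open>
  Shrink every tile of a tiling with ratio \<open>\<gamma>\<close> about its centre by the factor \<open>1 / (1 + \<gamma>)\<close>. After
  rescaling, the union \<open>S\<close> of the shrunk tiles avoids the distance 1 and has density
  \<open>(1 + \<gamma>)\<^sup>-\<^sup>n\<close>, so the task is to cover the space by few translates of such sets.

  The tiles of a multilattice may be arranged non-periodically. The tiling is therefore cut off at a
  large box and repeated periodically; the box has to be so large that a union bound over a net of
  the box would cost \<open>2 n ln n\<close> instead of \<open>n ln n\<close>. The union bound is only used to guarantee
  that no unit ball contains many uncovered net points that are pairwise weakly correlated, where
  the correlation of \<open>p\<close> and \<open>q\<close> is the probability that a random translate of \<open>S\<close> contains both.
  All other uncovered net points are strongly correlated with one of a few points \<open>p\<close>, and then
  random translates of \<open>S\<close> through \<open>p\<close> cover them quickly. Hence polynomially many further colours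
  suffice in each unit ball. Finally the space is covered by \<open>(5 (1 + \<gamma>) / 6)\<^sup>n\<close>, up to a polynomial
  factor, families of cells that lie in unit balls and are more than 1 apart, which come from the
  same tiling at a larger scale; the additional colours are negligible.
\<close>

section \<open>Lebesgue measure on the coordinate space\<close>

text \<open>A linear change of coordinates makes every norm comparable to the coordinates up to the
  factor \<open>3 ^ n\<close>, so one box of side \<open>30 * n ^ 2 * 3 ^ n\<close> serves all
  bodies. This size is affordable because the union bound runs over sets of \<open>t = n ^ 3\<close>
  weakly correlated net points: such a set is hit about \<open>t\<close> times as often as a single
  point, so the number of cells in the box, with logarithm of order \<open>n ^ 2\<close>, adds only
  a constant to the second factor of the bound. What remains is the logarithm of the size of a net
  of one unit ball. With mesh \<open>1 / (2 * \<gamma> * n * ln n)\<close> it is about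
  \<open>n ln n + n ln ln n + n ln (4 \<gamma>)\<close>; a coarser mesh would force the tiles to be
  shrunk further, which at this mesh costs about \<open>n\<close>.

  The constants require a bounded ratio. For \<gamma> \<ge> 8 the bound \<open>9 ^ n\<close> is
  enough; it comes from balls around a separated set. The infimum \<gamma> need not be attained, but
  the chromatic number is fixed and the bound is continuous in the ratio, so it passes from
  admissible ratios to the infimum.\<close>

abbreviation coord :: "rvec \<Rightarrow> nat \<Rightarrow> real" where
  "coord \<equiv> Poly_Mapping.lookup"

abbreviation unit_vec :: "nat \<Rightarrow> rvec" where
  "unit_vec i \<equiv> Poly_Mapping.single i 1"

lemma coord_scaleR [simp]: "coord (r *\<^sub>R x) i = r * coord x i"
  by (simp add: scaleR_poly_mapping_def)

lemma coord_unit_vec: "coord (unit_vec i) j = (if i = j then 1 else 0)"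
  by (simp add: lookup_single when_def)

lemma mem_Rn: "x \<in> Rn n \<longleftrightarrow> (\<forall>i\<ge>n. coord x i = 0)"
  by (auto simp: Rn_def subset_iff in_keys_iff) (meson linorder_not_less)

lemma Rn_eqI: "x \<in> Rn n \<Longrightarrow> y \<in> Rn n \<Longrightarrow> (\<And>i. i < n \<Longrightarrow> coord x i = coord y i) \<Longrightarrow> x = y"
  by (rule poly_mapping_eqI) (metis mem_Rn linorder_not_less)

lemma Rn_zero [simp]: "0 \<in> Rn n"
  by (simp add: mem_Rn)

lemma Rn_add [simp]: "x \<in> Rn n \<Longrightarrow> y \<in> Rn n \<Longrightarrow> x + y \<in> Rn n"
  by (simp add: mem_Rn lookup_add)

lemma Rn_diff [simp]: "x \<in> Rn n \<Longrightarrow> y \<in> Rn n \<Longrightarrow> x - y \<in> Rn n"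
  by (simp add: mem_Rn lookup_minus)

lemma Rn_uminus [simp]: "x \<in> Rn n \<Longrightarrow> - x \<in> Rn n"
  by (simp add: mem_Rn)

lemma Rn_scaleR [simp]: "x \<in> Rn n \<Longrightarrow> r *\<^sub>R x \<in> Rn n"
  by (simp add: mem_Rn)

lemma Rn_sum [intro]: "(\<And>i. i \<in> I \<Longrightarrow> f i \<in> Rn n) \<Longrightarrow> (\<Sum>i\<in>I. f i) \<in> Rn n"
  by (induction I rule: infinite_finite_induct) auto

lemma coord_sum: "coord (\<Sum>i\<in>I. f i) j = (\<Sum>i\<in>I. coord (f i) j)"
  by (induction I rule: infinite_finite_induct) (auto simp: lookup_add)

definition emb :: "nat \<Rightarrow> (nat \<Rightarrow> real) \<Rightarrow> rvec" where
  "emb n f = (\<Sum>i<n. f i *\<^sub>R unit_vec i)"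

lemma coord_emb: "coord (emb n f) j = (if j < n then f j else 0)"
  by (auto simp: emb_def coord_sum coord_unit_vec if_distrib[of "(*) _"] cong: if_cong)

lemma emb_Rn [simp]: "emb n f \<in> Rn n"
  by (simp add: mem_Rn coord_emb)

lemma emb_coord: "x \<in> Rn n \<Longrightarrow> emb n (coord x) = x"
  by (rule Rn_eqI) (auto simp: coord_emb)

lemma norm_rvec: "norm (x::rvec) = (\<Sum>i\<in>Poly_Mapping.keys x. \<bar>coord x i\<bar>)"
  by (simp add: norm_poly_mapping_def dist_poly_mapping_def)

lemma norm_Rn: "x \<in> Rn n \<Longrightarrow> norm x = (\<Sum>i<n. \<bar>coord x i\<bar>)"
  unfolding norm_rvec
  by (rule sum.mono_neutral_left) (auto simp: Rn_def in_keys_iff)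

lemma sum_coord_le_norm: "(\<Sum>i<n. \<bar>coord x i\<bar>) \<le> norm (x::rvec)"
proof -
  have "(\<Sum>i<n. \<bar>coord x i\<bar>) = (\<Sum>i\<in>{..<n} \<inter> Poly_Mapping.keys x. \<bar>coord x i\<bar>)"
    by (rule sum.mono_neutral_right) (auto simp: in_keys_iff)
  also have "\<dots> \<le> norm x"
    unfolding norm_rvec by (rule sum_mono2) auto
  finally show ?thesis .
qed

lemma abs_coord_le_norm: "\<bar>coord x i\<bar> \<le> norm x"
proof -
  have "\<bar>coord x i\<bar> \<le> (\<Sum>j<Suc i. \<bar>coord x j\<bar>)"
    by (rule member_le_sum) auto
  then show ?thesis
    using sum_coord_le_norm order_trans by blast
qed

lemma continuous_on_coord [continuous_intros]: "continuous_on A (\<lambda>x. coord x i)"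
proof -
  have "bounded_linear (\<lambda>x. coord x i)"
    by (rule bounded_linear_intro[where K = 1])
       (auto simp: lookup_add abs_coord_le_norm)
  then show ?thesis
    by (rule linear_continuous_on)
qed

lemma closed_Rn: "closed (Rn n)"
proof -
  have "Rn n = (\<Inter>i\<in>{n..}. {x. coord x i = 0})"
    by (auto simp: mem_Rn)
  moreover have "closed {x. coord x i = 0}" for i
    by (intro closed_Collect_eq continuous_intros)
  ultimately show ?thesis
    by auto
qed

section \<open>Volume and its behaviour under affine maps\<close>

definition coord_lborel :: "nat \<Rightarrow> (nat \<Rightarrow> real) measure" where
  "coord_lborel n = Pi\<^sub>M {..<n} (\<lambda>_. lborel)"

text \<open>Lebesgue measure of \<open>Rn n\<close>, realised as a measure on the ambient type that
  is concentrated on \<open>Rn n\<close>; in this way the dimension can stay a variable.\<close>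

definition vol :: "nat \<Rightarrow> rvec measure" where
  "vol n = distr (coord_lborel n) borel (emb n)"

lemma continuous_on_emb: "continuous_on UNIV (emb n)"
  unfolding emb_def by (intro continuous_intros continuous_on_product_coordinates)

lemma measurable_emb [measurable]: "emb n \<in> measurable (coord_lborel n) borel"
proof -
  \<comment> \<open>The product measure lives on functions that are \<open>undefined\<close> outside
    \<open>{..<n}\<close>, whereas continuity of \<open>emb n\<close> refers to all functions;
    replacing \<open>undefined\<close> by 0 connects the two and does not change
    \<open>emb n\<close>.\<close>
  define g where "g = (\<lambda>f i. if i < n then f i else 0 :: real)"
  have "g \<in> borel_measurable (coord_lborel n)"
    unfolding g_def coord_lborel_def
  proof (rule measurable_coordinatewise_then_product)
    show "(\<lambda>f. if i < n then f i else 0) \<in> borel_measurable (Pi\<^sub>M {..<n} (\<lambda>_. lborel))" for i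
    proof (cases "i < n")
      case True
      then have "(\<lambda>f. f i) \<in> measurable (Pi\<^sub>M {..<n} (\<lambda>_. lborel)) (lborel :: real measure)"
        by (intro measurable_component_singleton) auto
      with True show ?thesis by simp
    qed simp
  qed
  moreover have "emb n \<in> borel_measurable borel"
    by (rule borel_measurable_continuous_onI[OF continuous_on_emb])
  ultimately have "emb n \<circ> g \<in> measurable (coord_lborel n) borel"
    by (rule measurable_comp)
  moreover have "emb n \<circ> g = emb n"
    by (auto simp: emb_def g_def)
  ultimately show ?thesis
    by simp
qed

lemma sets_vol [simp, measurable_cong]: "sets (vol n) = sets borel"
  and space_vol [simp]: "space (vol n) = UNIV"
  by (auto simp: vol_def)

lemma emeasure_lborel_affine:
  assumes "c > 0" "A \<in> sets borel"
  shows "ennreal c * emeasure lborel {x. t + c * x \<in> A} = emeasure lborel (A :: real set)"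
proof -
  have "emeasure lborel A = emeasure (density (distr lborel borel (\<lambda>x. t + c * x)) (\<lambda>_. ennreal \<bar>c\<bar>)) A"
    using assms by (subst lborel_real_affine[of c t]) auto
  also have "\<dots> = ennreal c * emeasure (distr lborel borel (\<lambda>x. t + c * x)) A"
    using assms by (subst emeasure_density_const) auto
  also have "emeasure (distr lborel borel (\<lambda>x. t + c * x)) A = emeasure lborel {x. t + c * x \<in> A}"
    using assms by (subst emeasure_distr) (auto simp: vimage_def)
  finally show ?thesis ..
qed

text \<open>A product measure is determined by its values on boxes, where each of the
  \<open>n\<close> one-dimensional factors contributes one factor \<open>c\<close>.\<close>

lemma coord_lborel_affine:
  assumes "c > 0"
  shows "scale_measure (ennreal (c ^ n))
           (distr (coord_lborel n) (coord_lborel n) (\<lambda>f. \<lambda>i\<in>{..<n}. t i + c * f i)) = coord_lborel n"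
proof -
  interpret product_sigma_finite "\<lambda>_::nat. lborel :: real measure" ..
  have meas: "(\<lambda>f. \<lambda>i\<in>{..<n}. t i + c * f i) \<in> measurable (coord_lborel n) (coord_lborel n)"
    unfolding coord_lborel_def by measurable
  show ?thesis
    unfolding coord_lborel_def
  proof (rule PiM_eqI)
    fix A :: "nat \<Rightarrow> real set" assume A: "\<And>i. i \<in> {..<n} \<Longrightarrow> A i \<in> sets lborel"
    let ?P = "Pi\<^sub>M {..<n} (\<lambda>_. lborel :: real measure)"
    have eq: "(\<lambda>f. \<lambda>i\<in>{..<n}. t i + c * f i) -` Pi\<^sub>E {..<n} A \<inter> space ?P
        = Pi\<^sub>E {..<n} (\<lambda>i. {x. t i + c * x \<in> A i})"
      by (auto simp: space_PiM PiE_def Pi_def)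
    have A': "{x. t i + c * x \<in> A i} \<in> sets lborel" if "i \<in> {..<n}" for i
    proof -
      have "(\<lambda>x. t i + c * x) -` A i \<inter> space lborel \<in> sets lborel"
        by (rule measurable_sets[OF _ A[OF that]]) simp
      then show ?thesis by (simp add: vimage_def)
    qed
    have "emeasure (distr ?P ?P (\<lambda>f. \<lambda>i\<in>{..<n}. t i + c * f i)) (Pi\<^sub>E {..<n} A)
        = (\<Prod>i<n. emeasure lborel {x. t i + c * x \<in> A i})"
      using A meas[unfolded coord_lborel_def]
      by (subst emeasure_distr) (auto simp: eq intro!: emeasure_PiM A')
    then have "emeasure (scale_measure (ennreal (c ^ n))
            (distr ?P ?P (\<lambda>f. \<lambda>i\<in>{..<n}. t i + c * f i))) (Pi\<^sub>E {..<n} A)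
        = ennreal c ^ n * (\<Prod>i<n. emeasure lborel {x. t i + c * x \<in> A i})"
      using assms by (simp add: ennreal_power)
    also have "\<dots> = (\<Prod>i<n. ennreal c * emeasure lborel {x. t i + c * x \<in> A i})"
      by (simp add: prod.distrib)
    also have "\<dots> = (\<Prod>i<n. emeasure lborel (A i))"
      using A assms by (intro prod.cong refl emeasure_lborel_affine) auto
    finally show "emeasure (scale_measure (ennreal (c ^ n))
            (distr ?P ?P (\<lambda>f. \<lambda>i\<in>{..<n}. t i + c * f i))) (Pi\<^sub>E {..<n} A)
        = (\<Prod>i<n. emeasure lborel (A i))" .
  qed auto
qed

lemma borel_affine_preimage [measurable]:
  assumes "S \<in> sets borel"
  shows "{x. t + c *\<^sub>R x \<in> S} \<in> sets (borel :: rvec measure)"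
proof -
  have "(\<lambda>x. t + c *\<^sub>R x) -` S \<inter> space borel \<in> sets (borel :: rvec measure)"
    by (rule measurable_sets[OF _ assms])
       (intro borel_measurable_continuous_onI continuous_intros)
  then show ?thesis by (simp add: vimage_def)
qed

lemma emeasure_vol_affine_preimage:
  assumes "c > 0" "t \<in> Rn n" and S [measurable]: "S \<in> sets borel"
  shows "ennreal (c ^ n) * emeasure (vol n) {x. t + c *\<^sub>R x \<in> S} = emeasure (vol n) S"
proof -
  let ?A = "\<lambda>f. \<lambda>i\<in>{..<n}. coord t i + c * f i"
  have meas: "?A \<in> measurable (coord_lborel n) (coord_lborel n)"
    unfolding coord_lborel_def by measurable
  have emb: "emb n (?A f) = t + c *\<^sub>R emb n f" for f
    using assms by (intro Rn_eqI[of _ n]) (auto simp: coord_emb lookup_add)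
  have pre: "emb n -` S \<inter> space (coord_lborel n) \<in> sets (coord_lborel n)"
    by (rule measurable_sets[OF measurable_emb S])
  have sp: "?A f \<in> space (coord_lborel n)" for f
    by (auto simp: coord_lborel_def space_PiM)
  have "emeasure (vol n) S = emeasure (coord_lborel n) (emb n -` S \<inter> space (coord_lborel n))"
    unfolding vol_def by (rule emeasure_distr[OF measurable_emb S])
  also have "\<dots> = ennreal (c ^ n) * emeasure (distr (coord_lborel n) (coord_lborel n) ?A)
        (emb n -` S \<inter> space (coord_lborel n))"
    by (subst coord_lborel_affine[OF assms(1), of n "coord t", symmetric]) simp
  also have "emeasure (distr (coord_lborel n) (coord_lborel n) ?A) (emb n -` S \<inter> space (coord_lborel n))
      = emeasure (coord_lborel n) (?A -` (emb n -` S \<inter> space (coord_lborel n)) \<inter> space (coord_lborel n))"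
    by (rule emeasure_distr[OF meas pre])
  also have "?A -` (emb n -` S \<inter> space (coord_lborel n)) \<inter> space (coord_lborel n)
      = emb n -` {x. t + c *\<^sub>R x \<in> S} \<inter> space (coord_lborel n)"
    using sp emb by auto
  also have "emeasure (coord_lborel n) \<dots> = emeasure (vol n) {x. t + c *\<^sub>R x \<in> S}"
    unfolding vol_def by (rule emeasure_distr[OF measurable_emb, symmetric]) measurable
  finally show ?thesis ..
qed

lemma affine_image_eq_preimage:
  assumes "c \<noteq> (0::real)"
  shows "(\<lambda>x. t + c *\<^sub>R x) ` S = {y :: 'a :: real_vector. - ((1/c) *\<^sub>R t) + (1/c) *\<^sub>R y \<in> S}"
proof (intro set_eqI iffI)
  fix y assume "y \<in> {y. - ((1/c) *\<^sub>R t) + (1/c) *\<^sub>R y \<in> S}"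
  moreover have "y = t + c *\<^sub>R (- ((1/c) *\<^sub>R t) + (1/c) *\<^sub>R y)"
    using assms by (simp add: algebra_simps)
  ultimately show "y \<in> (\<lambda>x. t + c *\<^sub>R x) ` S"
    by blast
qed (use assms in \<open>auto simp: algebra_simps\<close>)

lemma borel_affine_image:
  assumes "S \<in> sets borel" "c \<noteq> 0"
  shows "(\<lambda>x. t + c *\<^sub>R x) ` S \<in> sets (borel :: rvec measure)"
  unfolding affine_image_eq_preimage[OF assms(2)] by (rule borel_affine_preimage[OF assms(1)])

lemma emeasure_vol_affine_image:
  assumes "c > 0" "t \<in> Rn n" and S [measurable]: "S \<in> sets borel"
  shows "emeasure (vol n) ((\<lambda>x. t + c *\<^sub>R x) ` S) = ennreal (c ^ n) * emeasure (vol n) S"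
proof -
  have "(\<lambda>x. t + c *\<^sub>R x) ` S \<in> sets borel"
    using assms by (intro borel_affine_image) auto
  from emeasure_vol_affine_preimage[OF assms(1,2) this]
  have "emeasure (vol n) ((\<lambda>x. t + c *\<^sub>R x) ` S)
      = ennreal (c ^ n) * emeasure (vol n) {x. t + c *\<^sub>R x \<in> (\<lambda>x. t + c *\<^sub>R x) ` S}" ..
  also have "{x. t + c *\<^sub>R x \<in> (\<lambda>x. t + c *\<^sub>R x) ` S} = S"
    using assms by auto
  finally show ?thesis .
qed

lemma measure_vol_affine_image:
  assumes "c > 0" "t \<in> Rn n" "S \<in> sets borel"
  shows "measure (vol n) ((\<lambda>x. t + c *\<^sub>R x) ` S) = c ^ n * measure (vol n) S"
  using assms by (simp add: measure_def emeasure_vol_affine_image enn2real_mult)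

lemma emeasure_vol_translate:
  assumes "t \<in> Rn n" "S \<in> sets borel"
  shows "emeasure (vol n) {x. t + x \<in> S} = emeasure (vol n) S"
  using emeasure_vol_affine_preimage[of 1 t n S] assms by simp

text \<open>Half-open, so that for \<open>l > 0\<close> the box \<open>hbox n 0 l\<close> contains
  exactly one point of each orbit under \<open>period_lattice n l\<close>.\<close>

definition hbox :: "nat \<Rightarrow> real \<Rightarrow> real \<Rightarrow> rvec set" where
  "hbox n a b = {x \<in> Rn n. \<forall>i<n. a \<le> coord x i \<and> coord x i < b}"

lemma borel_hbox [measurable]: "hbox n a b \<in> sets borel"
proof -
  have "{x. a \<le> coord x i} \<in> sets borel" "{x. coord x i < b} \<in> sets borel" for i
    by (intro borel_closed closed_Collect_le borel_open open_Collect_less continuous_intros)+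
  then have "{x. a \<le> coord x i} \<inter> {x. coord x i < b} \<in> sets borel" for i
    by auto
  moreover have "hbox n a b = Rn n \<inter> (\<Inter>i\<in>{..<n}. {x. a \<le> coord x i} \<inter> {x. coord x i < b})" if "n \<noteq> 0"
    by (auto simp: hbox_def)
  moreover have "hbox n a b = Rn n" if "n = 0"
    using that by (auto simp: hbox_def)
  moreover have "Rn n \<in> sets borel"
    by (simp add: borel_closed closed_Rn)
  ultimately show ?thesis
    by (cases "n = 0") (auto intro!: sets.Int sets.finite_INT)
qed

lemma emeasure_hbox:
  assumes "a \<le> b"
  shows "emeasure (vol n) (hbox n a b) = ennreal ((b - a) ^ n)"
proof -
  interpret product_sigma_finite "\<lambda>_::nat. lborel :: real measure" ..
  have "emeasure (vol n) (hbox n a b)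
      = emeasure (coord_lborel n) (emb n -` hbox n a b \<inter> space (coord_lborel n))"
    unfolding vol_def by (rule emeasure_distr) auto
  also have "emb n -` hbox n a b \<inter> space (coord_lborel n) = Pi\<^sub>E {..<n} (\<lambda>_. {a..<b})"
    by (auto simp: coord_lborel_def space_PiM hbox_def coord_emb PiE_def Pi_def)
  also have "emeasure (coord_lborel n) \<dots> = (\<Prod>i<n. emeasure lborel {a..<b})"
    unfolding coord_lborel_def by (rule emeasure_PiM) auto
  also have "\<dots> = ennreal ((b - a) ^ n)"
    using assms by (simp add: ennreal_power)
  finally show ?thesis .
qed

lemma measure_hbox: "a \<le> b \<Longrightarrow> measure (vol n) (hbox n a b) = (b - a) ^ n"
  by (simp add: measure_def emeasure_hbox)

lemma hbox_fmeasurable [simp]: "hbox n a b \<in> fmeasurable (vol n)"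
proof (cases "a \<le> b")
  case True
  then show ?thesis by (auto intro!: fmeasurableI simp: emeasure_hbox)
next
  case False
  show ?thesis
  proof (cases "n = 0")
    case True
    then have "hbox n a b = hbox n 0 0" by (auto simp: hbox_def)
    then show ?thesis by (auto intro!: fmeasurableI simp: emeasure_hbox)
  next
    case n: False
    with False have "hbox n a b = {}" by (fastforce simp: hbox_def)
    then show ?thesis by simp
  qed
qed

section \<open>Periodic sets\<close>

definition period_lattice :: "nat \<Rightarrow> real \<Rightarrow> rvec set" where
  "period_lattice n l = {w \<in> Rn n. \<forall>i<n. \<exists>z::int. coord w i = l * of_int z}"

definition periodic :: "nat \<Rightarrow> real \<Rightarrow> rvec set \<Rightarrow> bool" where
  "periodic n l S \<longleftrightarrow> (\<forall>y\<in>Rn n. \<forall>w\<in>period_lattice n l. y + w \<in> S \<longleftrightarrow> y \<in> S)"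

lemma period_lattice_Rn: "w \<in> period_lattice n l \<Longrightarrow> w \<in> Rn n"
  by (simp add: period_lattice_def)

lemma period_lattice_zero [simp]: "0 \<in> period_lattice n l"
  by (auto simp: period_lattice_def intro!: exI[of _ 0])

lemma period_lattice_add [simp]:
  assumes "v \<in> period_lattice n l" "w \<in> period_lattice n l"
  shows "v + w \<in> period_lattice n l"
proof -
  have "\<exists>z::int. coord (v + w) i = l * of_int z" if i: "i < n" for i
  proof -
    from assms i obtain y z :: int where "coord v i = l * of_int y" "coord w i = l * of_int z"
      by (fastforce simp: period_lattice_def)
    then show ?thesis
      by (auto simp: lookup_add algebra_simps intro!: exI[of _ "y + z"])
  qed
  then show ?thesis
    using assms by (simp add: period_lattice_def)
qed

lemma period_lattice_uminus [simp]:
  assumes "v \<in> period_lattice n l"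
  shows "- v \<in> period_lattice n l"
proof -
  have "\<exists>z::int. coord (- v) i = l * of_int z" if i: "i < n" for i
  proof -
    from assms i obtain y :: int where "coord v i = l * of_int y"
      by (fastforce simp: period_lattice_def)
    then show ?thesis
      by (auto intro!: exI[of _ "- y"])
  qed
  then show ?thesis
    using assms by (simp add: period_lattice_def)
qed

lemma period_lattice_diff [simp]:
  "v \<in> period_lattice n l \<Longrightarrow> w \<in> period_lattice n l \<Longrightarrow> v - w \<in> period_lattice n l"
  using period_lattice_add[of v n l "- w"] by simp

lemma countable_period_lattice: "countable (period_lattice n l)"
proof -
  have "period_lattice n l \<subseteq> (\<lambda>z. emb n (\<lambda>i. l * of_int (z i))) ` (Pi\<^sub>E {..<n} (\<lambda>_. UNIV :: int set))"
  proof
    fix w assume w: "w \<in> period_lattice n l"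
    then have "\<forall>i\<in>{..<n}. \<exists>z::int. coord w i = l * of_int z"
      by (auto simp: period_lattice_def)
    then obtain z :: "nat \<Rightarrow> int" where z: "\<And>i. i < n \<Longrightarrow> coord w i = l * of_int (z i)"
      by (metis lessThan_iff)
    have "w = emb n (\<lambda>i. l * of_int (restrict z {..<n} i))"
      using w z by (intro Rn_eqI[of _ n]) (auto simp: coord_emb period_lattice_Rn)
    then show "w \<in> (\<lambda>z. emb n (\<lambda>i. l * of_int (z i))) ` (Pi\<^sub>E {..<n} (\<lambda>_. UNIV :: int set))"
      by (intro image_eqI[of _ _ "restrict z {..<n}"]) auto
  qed
  moreover have "countable (Pi\<^sub>E {..<n} (\<lambda>_. UNIV :: int set))"
    by (intro countable_PiE) auto
  ultimately show ?thesis
    by (meson countable_image countable_subset)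
qed

lemma period_reduce:
  assumes "l > 0" "x \<in> Rn n"
  obtains w where "w \<in> period_lattice n l" "x + w \<in> hbox n 0 l"
proof
  define w where "w = emb n (\<lambda>i. l * of_int (- \<lfloor>coord x i / l\<rfloor>))"
  show "w \<in> period_lattice n l"
    unfolding period_lattice_def w_def by (auto simp: coord_emb) (metis mult_minus_right of_int_minus)
  have "0 \<le> coord x i + l * of_int (- \<lfloor>coord x i / l\<rfloor>) \<and> coord x i + l * of_int (- \<lfloor>coord x i / l\<rfloor>) < l" for i
  proof -
    have "of_int \<lfloor>coord x i / l\<rfloor> * l \<le> coord x i"
      using pos_le_divide_eq[OF \<open>l > 0\<close>] of_int_floor_le by blast
    moreover have "coord x i < (of_int \<lfloor>coord x i / l\<rfloor> + 1) * l"
      by (rule iffD1[OF pos_divide_less_eq[OF \<open>l > 0\<close>]]) linarith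
    ultimately show ?thesis
      by (simp add: algebra_simps)
  qed
  with assms show "x + w \<in> hbox n 0 l"
    by (auto simp: hbox_def w_def coord_emb lookup_add)
qed

lemma period_unique:
  assumes "l > 0" "v \<in> period_lattice n l" "w \<in> period_lattice n l"
    and "x + v \<in> hbox n 0 l" "x + w \<in> hbox n 0 l"
  shows "v = w"
proof (rule Rn_eqI[of _ n])
  fix i assume i: "i < n"
  from assms i obtain y z :: int where yz: "coord v i = l * of_int y" "coord w i = l * of_int z"
    by (fastforce simp: period_lattice_def)
  have "\<bar>coord (x + v) i - coord (x + w) i\<bar> < l"
  proof -
    have "0 \<le> coord (x + v) i" "coord (x + v) i < l" "0 \<le> coord (x + w) i" "coord (x + w) i < l"
      using assms(4,5) i by (auto simp: hbox_def)
    then show ?thesis by linarith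
  qed
  then have "\<bar>l * (of_int y - of_int z)\<bar> < l * 1"
    by (simp add: lookup_add yz algebra_simps)
  then have "\<bar>real_of_int y - of_int z\<bar> < 1"
    using \<open>l > 0\<close> by (simp add: abs_mult)
  then have "y = z"
    by linarith
  then show "coord v i = coord w i"
    using yz by simp
qed (use assms in \<open>auto simp: period_lattice_Rn\<close>)

text \<open>Under a uniformly random shift in the box every point meets a periodic set with the same
  probability. The shifted set is cut into countably many pieces \<open>P w\<close> according to the
  period vector that brings the shifted point back into the box; the translated pieces
  \<open>Q w\<close> partition \<open>S\<close> within the box.\<close>

lemma emeasure_periodic_shift:
  assumes l: "l > 0" and t: "t \<in> Rn n" and S [measurable]: "S \<in> sets borel" and per: "periodic n l S"
  shows "emeasure (vol n) {x \<in> hbox n 0 l. t + x \<in> S} = emeasure (vol n) (S \<inter> hbox n 0 l)"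
proof -
  let ?D = "hbox n 0 l" and ?L = "period_lattice n l"
  define Q where "Q = (\<lambda>w. S \<inter> ?D \<inter> {y. (w - t) + y \<in> ?D})"
  define P where "P = (\<lambda>w. {x. (t - w) + x \<in> Q w})"
  have tr: "{y. a + y \<in> T} \<in> sets borel" if "T \<in> sets borel" for a :: rvec and T
    using borel_affine_preimage[OF that, of a 1] by simp
  have Q_meas: "Q w \<in> sets (vol n)" and P_meas: "P w \<in> sets (vol n)" for w
    unfolding Q_def P_def by (auto intro!: tr)
  have Rn: "y \<in> Rn n" if "y \<in> ?D" for y using that by (simp add: hbox_def)
  have "{x \<in> ?D. t + x \<in> S} = (\<Union>w\<in>?L. P w)"
  proof (intro set_eqI iffI)
    fix x assume x: "x \<in> {x \<in> ?D. t + x \<in> S}"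
    then have xR: "x \<in> Rn n" by (auto intro: Rn)
    then obtain w where w: "w \<in> ?L" "(t + x) + w \<in> ?D"
      using period_reduce[OF l, of "t + x" n] t by auto
    have "(t + x) + w \<in> S"
      using per w x xR t by (auto simp: periodic_def)
    then have "x \<in> P (- w)"
      using w x by (simp add: P_def Q_def algebra_simps)
    then show "x \<in> (\<Union>w\<in>?L. P w)" using w by (auto intro!: bexI[of _ "- w"])
  next
    fix x assume "x \<in> (\<Union>w\<in>?L. P w)"
    then obtain w where w: "w \<in> ?L" "x \<in> P w" by auto
    then have "x \<in> ?D" "t - w + x \<in> S" "t - w + x \<in> Rn n"
      by (auto simp: P_def Q_def intro: Rn)
    moreover have "(t - w + x) + w \<in> S \<longleftrightarrow> t - w + x \<in> S"
      using per w \<open>t - w + x \<in> Rn n\<close> unfolding periodic_def by blast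
    moreover have "(t - w + x) + w = t + x" by simp
    ultimately show "x \<in> {x \<in> ?D. t + x \<in> S}" by simp
  qed
  then have "emeasure (vol n) {x \<in> ?D. t + x \<in> S} = emeasure (vol n) (\<Union>w\<in>?L. P w)"
    by simp
  also have "\<dots> = (\<integral>\<^sup>+w. emeasure (vol n) (P w) \<partial>count_space ?L)"
  proof (rule emeasure_UN_countable)
    show "disjoint_family_on P ?L"
    proof (unfold disjoint_family_on_def, intro ballI impI)
      fix v w assume "v \<in> ?L" "w \<in> ?L" "v \<noteq> w"
      have False if "x \<in> P v" "x \<in> P w" for x
      proof -
        have "(t + x) + (- v) \<in> ?D" "(t + x) + (- w) \<in> ?D"
          using that by (auto simp: P_def Q_def algebra_simps)
        then have "- v = - w"
          using period_unique[OF l] \<open>v \<in> ?L\<close> \<open>w \<in> ?L\<close> by (meson period_lattice_uminus)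
        with \<open>v \<noteq> w\<close> show False by simp
      qed
      then show "P v \<inter> P w = {}" by blast
    qed
  qed (auto simp: countable_period_lattice intro: P_meas[simplified])
  also have "\<dots> = (\<integral>\<^sup>+w. emeasure (vol n) (Q w) \<partial>count_space ?L)"
  proof (rule nn_integral_cong)
    fix w assume "w \<in> space (count_space ?L)"
    then have "t - w \<in> Rn n" using t by (auto simp: period_lattice_Rn)
    then show "emeasure (vol n) (P w) = emeasure (vol n) (Q w)"
      unfolding P_def using Q_meas by (intro emeasure_vol_translate) auto
  qed
  also have "\<dots> = emeasure (vol n) (\<Union>w\<in>?L. Q w)"
  proof (rule emeasure_UN_countable[symmetric])
    show "disjoint_family_on Q ?L"
    proof (unfold disjoint_family_on_def, intro ballI impI)
      fix v w assume "v \<in> ?L" "w \<in> ?L" "v \<noteq> w"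
      have False if "x \<in> Q v" "x \<in> Q w" for x
      proof -
        have "(x - t) + v \<in> ?D" "(x - t) + w \<in> ?D"
          using that by (auto simp: Q_def algebra_simps)
        then have "v = w"
          using period_unique[OF l] \<open>v \<in> ?L\<close> \<open>w \<in> ?L\<close> by meson
        with \<open>v \<noteq> w\<close> show False by simp
      qed
      then show "Q v \<inter> Q w = {}" by blast
    qed
  qed (auto simp: countable_period_lattice intro: Q_meas[simplified])
  also have "(\<Union>w\<in>?L. Q w) = S \<inter> ?D"
  proof (intro set_eqI iffI)
    fix x assume x: "x \<in> S \<inter> ?D"
    then have "x - t \<in> Rn n" using t Rn by auto
    then obtain w where "w \<in> ?L" "(x - t) + w \<in> ?D"
      using period_reduce[OF l] by blast
    then have "x \<in> Q w" using x by (simp add: Q_def algebra_simps)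
    then show "x \<in> (\<Union>w\<in>?L. Q w)" using \<open>w \<in> ?L\<close> by auto
  qed (auto simp: Q_def)
  finally show ?thesis .
qed

section \<open>Greedy covering\<close>

text \<open>The mean over \<open>V\<close> of the number of sets \<open>A x\<close> containing
  \<open>v\<close> is at least \<open>h * card X\<close>, and some point does not fall below the
  mean.\<close>

lemma exists_good_point:
  fixes h :: real
  assumes fin: "finite X" and V: "V \<in> fmeasurable M" "measure M V > 0"
    and meas: "\<And>x. x \<in> X \<Longrightarrow> A x \<in> sets M"
    and h: "\<And>x. x \<in> X \<Longrightarrow> h * measure M V \<le> measure M (A x \<inter> V)"
  shows "\<exists>v\<in>V. h * card X \<le> card {x \<in> X. v \<in> A x}"
proof (rule ccontr)
  assume neg: "\<not> ?thesis"
  have AV: "A x \<inter> V \<in> fmeasurable M" if "x \<in> X" for x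
    using V meas[OF that] by (simp add: fmeasurable_Int_fmeasurable Int_commute)
  have intg: "integrable M (indicat_real (A x \<inter> V))" if "x \<in> X" for x
    using AV[OF that] by (auto simp: integrable_indicator_iff fmeasurable_def)
  have intV: "integrable M (indicat_real V)"
    using V by (auto simp: integrable_indicator_iff fmeasurable_def)
  \<comment> \<open>The deficit of the count at \<open>v\<close>: if the claim failed it would be
    positive on all of \<open>V\<close>, although its integral is at most 0.\<close>
  define g where "g = (\<lambda>v. h * card X * indicat_real V v - (\<Sum>x\<in>X. indicat_real (A x \<inter> V) v))"
  have cnt: "(\<Sum>x\<in>X. indicat_real (A x \<inter> V) v) = card {x \<in> X. v \<in> A x}" if "v \<in> V" for v
  proof -
    have "(\<Sum>x\<in>X. indicat_real (A x \<inter> V) v) = (\<Sum>x\<in>X. if v \<in> A x then 1 else 0)"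
      using that by (intro sum.cong) (auto simp: indicator_def)
    also have "\<dots> = card {x \<in> X. v \<in> A x}"
      using fin by (simp add: sum.If_cases Int_def conj_commute)
    finally show ?thesis .
  qed
  have gpos: "g v > 0" if "v \<in> V" for v
    using neg that cnt[OF that] by (force simp: g_def)
  have g0: "g v = 0" if "v \<notin> V" for v
    using that by (simp add: g_def)
  have intgg: "integrable M g"
    unfolding g_def using intg intV by (intro Bochner_Integration.integrable_diff integrable_mult_right Bochner_Integration.integrable_sum) auto
  have "integral\<^sup>L M g = h * card X * measure M V - (\<Sum>x\<in>X. measure M (A x \<inter> V))"
    unfolding g_def using intg intV V AV
    by (subst Bochner_Integration.integral_diff)
       (auto simp: Bochner_Integration.integral_sum fmeasurableD sets.Int_space_eq2
          intro!: integrable_mult_right Bochner_Integration.integrable_sum)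
  also have "\<dots> \<le> 0"
    using sum_mono[OF h, of X] by (simp add: mult_ac)
  finally have "integral\<^sup>L M g \<le> 0" .
  moreover have "0 \<le> g v" for v
    using gpos[of v] g0[of v] by (cases "v \<in> V") auto
  ultimately have "AE v in M. g v = 0"
    using integral_nonneg_eq_0_iff_AE[OF intgg] Bochner_Integration.integral_nonneg[of M g]
    by (metis (no_types, lifting) AE_I2 order_antisym)
  then have "AE v in M. v \<notin> V"
    by (rule AE_mp) (use gpos in \<open>force intro!: AE_I2\<close>)
  then have "V \<in> null_sets M"
    using AE_iff_null_sets[OF fmeasurableD[OF V(1)]] by simp
  then have "measure M V = 0"
    by (rule measure_eq_0_null_sets)
  with V show False by simp
qed

text \<open>A good point leaves at most the fraction \<open>1 - h\<close> of the uncovered elements,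
  and \<open>(1 - h) ^ m * card X < 1\<close>. This derandomised union bound serves twice: with
  \<open>V\<close> a period box for uniform translates, and with \<open>V\<close> the part of
  \<open>S\<close> in a box for translates through a given point.\<close>

lemma greedy_cover:
  fixes h :: real and m :: nat
  assumes fin: "finite X" and V: "V \<in> fmeasurable M" "measure M V > 0"
    and meas: "\<And>x. x \<in> X \<Longrightarrow> A x \<in> sets M"
    and h: "\<And>x. x \<in> X \<Longrightarrow> h * measure M V \<le> measure M (A x \<inter> V)" "0 < h"
    and m: "card X < exp (h * m)"
  shows "\<exists>v. (\<forall>i<m. v i \<in> V) \<and> (\<forall>x\<in>X. \<exists>i<m. v i \<in> A x)"
proof (cases "X = {}")
  case True
  have "V \<noteq> {}" using V by auto
  with True show ?thesis by auto
next
  case False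
  then obtain x0 where "x0 \<in> X" by auto
  have "measure M (A x0 \<inter> V) \<le> measure M V"
    using V meas[OF \<open>x0 \<in> X\<close>] by (intro measure_mono_fmeasurable) auto
  with h(1)[OF \<open>x0 \<in> X\<close>] have "h * measure M V \<le> 1 * measure M V"
    by linarith
  with V(2) have h1: "h \<le> 1"
    by (simp only: mult_le_cancel_right_pos)
  have "\<exists>v. (\<forall>i<j. v i \<in> V) \<and> card {x \<in> X. \<forall>i<j. v i \<notin> A x} \<le> (1 - h) ^ j * card X" for j :: nat
  proof (induction j)
    case 0
    then show ?case by auto
  next
    case (Suc j)
    then obtain v where v: "\<forall>i<j. v i \<in> V" "card {x \<in> X. \<forall>i<j. v i \<notin> A x} \<le> (1 - h) ^ j * card X"
      by blast
    let ?Y = "{x \<in> X. \<forall>i<j. v i \<notin> A x}"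
    obtain u where u: "u \<in> V" "h * card ?Y \<le> card {x \<in> ?Y. u \<in> A x}"
      using exists_good_point[of ?Y V M A h] fin V meas h by auto
    let ?v = "v(j := u)"
    have eq: "{x \<in> X. \<forall>i<Suc j. ?v i \<notin> A x} = ?Y - {x \<in> ?Y. u \<in> A x}"
      by (auto simp: less_Suc_eq)
    have "real (card {x \<in> X. \<forall>i<Suc j. ?v i \<notin> A x}) = card ?Y - card {x \<in> ?Y. u \<in> A x}"
      unfolding eq using fin by (subst card_Diff_subset[symmetric]) auto
    also have "\<dots> \<le> real (card ?Y) - h * card ?Y"
    proof -
      have "card {x \<in> ?Y. u \<in> A x} \<le> card ?Y" using fin by (intro card_mono) auto
      then show ?thesis using u(2) by (simp add: of_nat_diff)
    qed
    also have "\<dots> = (1 - h) * card ?Y" by (simp add: algebra_simps)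
    also have "\<dots> \<le> (1 - h) * ((1 - h) ^ j * card X)"
      using v(2) h1 by (intro mult_left_mono) auto
    finally have "card {x \<in> X. \<forall>i<Suc j. ?v i \<notin> A x} \<le> (1 - h) ^ Suc j * card X"
      by (simp add: mult_ac)
    moreover have "\<forall>i<Suc j. ?v i \<in> V" using v u by (auto simp: less_Suc_eq)
    ultimately show ?case by blast
  qed
  then obtain v where v: "\<forall>i<m. v i \<in> V" "card {x \<in> X. \<forall>i<m. v i \<notin> A x} \<le> (1 - h) ^ m * card X"
    by blast
  have "(1 - h) ^ m \<le> exp (- h) ^ m"
    using h1 exp_ge_add_one_self[of "- h"] by (intro power_mono) auto
  also have "\<dots> = exp (- (h * m))"
    by (simp add: exp_of_nat_mult[symmetric] mult_ac)
  finally have "(1 - h) ^ m * card X \<le> exp (- (h * m)) * card X"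
    by (intro mult_right_mono) auto
  also have "\<dots> < 1"
    using m by (simp add: exp_minus field_simps)
  finally have "card {x \<in> X. \<forall>i<m. v i \<notin> A x} = 0"
    using v(2) by linarith
  then have "{x \<in> X. \<forall>i<m. v i \<notin> A x} = {}"
    using fin by simp
  with v(1) show ?thesis by blast
qed

text \<open>Adding the sets one at a time, each new one overlaps the union of the previous ones in
  at most the sum of the pairwise overlaps. As long as \<open>card T * e\<close> is small against
  \<open>k\<close>, the union is almost as large as if the sets were disjoint.\<close>

lemma bonferroni_lower:
  fixes k e :: real
  assumes fin: "finite T" and V: "V \<in> fmeasurable M"
    and meas: "\<And>p. p \<in> T \<Longrightarrow> A p \<in> sets M"
    and single: "\<And>p. p \<in> T \<Longrightarrow> k \<le> measure M (A p \<inter> V)"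
    and pair: "\<And>p q. p \<in> T \<Longrightarrow> q \<in> T \<Longrightarrow> p \<noteq> q \<Longrightarrow> measure M (A p \<inter> A q \<inter> V) \<le> e" and e: "e \<ge> 0"
  shows "card T * (k - card T * e) \<le> measure M ((\<Union>p\<in>T. A p) \<inter> V)"
proof -
  have "card U * k - card U * card U * e \<le> measure M ((\<Union>p\<in>U. A p) \<inter> V)" if "U \<subseteq> T" for U
    using finite_subset[OF that fin] that
  proof (induction U rule: finite_induct)
    case empty
    then show ?case by simp
  next
    case (insert q U)
    let ?W = "(\<Union>p\<in>U. A p) \<inter> V"
    have mW: "?W \<in> fmeasurable M"
      using V insert.hyps insert.prems meas
      by (subst Int_commute, intro fmeasurable_Int_fmeasurable V sets.finite_UN) auto
    have mq: "A q \<inter> V \<in> fmeasurable M"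
      using V meas insert.prems by (subst Int_commute, intro fmeasurable_Int_fmeasurable V) auto
    have "measure M (A q \<inter> V \<inter> ?W) = measure M (\<Union>p\<in>U. A p \<inter> A q \<inter> V)"
      by (rule arg_cong[of _ _ "measure M"]) auto
    also have "\<dots> \<le> (\<Sum>p\<in>U. measure M (A p \<inter> A q \<inter> V))"
    proof (rule measure_UNION_le[OF insert.hyps(1)])
      fix p assume "p \<in> U"
      then show "A p \<inter> A q \<inter> V \<in> sets M"
        using V meas insert.prems by (intro sets.Int) auto
    qed
    also have "\<dots> \<le> (\<Sum>p\<in>U. e)"
      using pair insert.prems insert.hyps by (intro sum_mono) auto
    finally have ov: "measure M (A q \<inter> V \<inter> ?W) \<le> card U * e" by simp
    have "(\<Union>p\<in>insert q U. A p) \<inter> V = (A q \<inter> V) \<union> ?W" by auto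
    then have "measure M ((\<Union>p\<in>insert q U. A p) \<inter> V)
        = measure M (A q \<inter> V) + measure M ?W - measure M (A q \<inter> V \<inter> ?W)"
      using measure_Un3[OF mq mW] by simp
    also have "\<dots> \<ge> k + (card U * k - card U * card U * e) - card U * e"
      using ov single insert.IH insert.prems by fastforce
    finally have "k + (card U * k - card U * card U * e) - card U * e
      \<le> measure M ((\<Union>p\<in>insert q U. A p) \<inter> V)" .
    moreover have "k + (card U * k - card U * card U * e) - card U * e
       \<ge> card (insert q U) * k - card (insert q U) * card (insert q U) * e"
      using insert.hyps e by (simp add: algebra_simps)
    ultimately show ?case by linarith
  qed
  from this[OF order_refl] show ?thesis by (simp add: algebra_simps)
qed

section \<open>Norms on the coordinate space\<close>

text \<open>The normed space after a linear change of coordinates. On the ambient type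
  \<open>N\<close> is a seminorm that ignores the coordinates from \<open>n\<close> on. The last two
  assumptions compare it with the coordinates by constants that depend on \<open>n\<close> only,
  which makes all later estimates uniform in the body.\<close>

locale coord_norm =
  fixes n :: nat and N :: "rvec \<Rightarrow> real"
  assumes n_pos: "n \<ge> 1"
    and N_triangle: "N (x + y) \<le> N x + N y"
    and N_scaleR: "N (r *\<^sub>R x) = \<bar>r\<bar> * N x"
    and N_upper: "N x \<le> (\<Sum>i<n. \<bar>coord x i\<bar>)"
    and N_lower: "i < n \<Longrightarrow> \<bar>coord x i\<bar> \<le> 3 ^ n * N x"
begin

lemma N_zero [simp]: "N 0 = 0"
  using N_scaleR[of 0 0] by simp

lemma N_uminus [simp]: "N (- x) = N x"
  using N_scaleR[of "-1" x] by simp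

lemma N_minus_commute: "N (x - y) = N (y - x)"
  using N_uminus[of "x - y"] by simp

lemma N_nonneg [simp]: "0 \<le> N x"
  using N_triangle[of x "- x"] by simp

lemma N_diff_triangle: "N (x - z) \<le> N (x - y) + N (y - z)"
  using N_triangle[of "x - y" "y - z"] by simp

lemma N_lipschitz: "\<bar>N x - N y\<bar> \<le> norm (x - y)"
proof -
  have "N x \<le> N (x - y) + N y" "N y \<le> N (y - x) + N x"
    using N_triangle[of "x - y" y] N_triangle[of "y - x" x] by auto
  moreover have "N (x - y) \<le> norm (x - y)"
    using N_upper sum_coord_le_norm order_trans by blast
  ultimately show ?thesis
    using N_minus_commute[of x y] by linarith
qed

lemma continuous_on_N [continuous_intros]:
  assumes "continuous_on A f"
  shows "continuous_on A (\<lambda>x. N (f x))"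
proof -
  have "continuous_on UNIV N"
    unfolding continuous_on_iff dist_real_def dist_norm
    using N_lipschitz by (meson le_less_trans)
  then show ?thesis
    using assms continuous_on_compose2 by blast
qed

definition nball :: "rvec \<Rightarrow> real \<Rightarrow> rvec set" where
  "nball x r = {y \<in> Rn n. N (y - x) < r}"

definition unit_vol :: real where
  "unit_vol = measure (vol n) (nball 0 1)"

lemma borel_nball [measurable]: "nball x r \<in> sets borel"
proof -
  have "nball x r = Rn n \<inter> {y. N (y - x) < r}"
    by (auto simp: nball_def)
  moreover have "open {y. N (y - x) < r}"
    by (intro open_Collect_less continuous_intros)
  ultimately show ?thesis
    using closed_Rn by (auto intro!: sets.Int borel_closed borel_open)
qed

lemma nball_subset_hbox:
  assumes "x \<in> hbox n a b"
  shows "nball x r \<subseteq> hbox n (a - 3 ^ n * r) (b + 3 ^ n * r)"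
proof
  fix y assume y: "y \<in> nball x r"
  have *: "\<bar>coord y i - coord x i\<bar> \<le> 3 ^ n * r" if "i < n" for i
  proof -
    have "\<bar>coord (y - x) i\<bar> \<le> 3 ^ n * N (y - x)"
      by (rule N_lower[OF that])
    also have "\<dots> \<le> 3 ^ n * r"
      using y by (simp add: nball_def)
    finally show ?thesis by (simp add: lookup_minus)
  qed
  have "a - 3 ^ n * r \<le> coord y i \<and> coord y i < b + 3 ^ n * r" if "i < n" for i
  proof -
    have "a \<le> coord x i" "coord x i < b" "\<bar>coord y i - coord x i\<bar> \<le> 3 ^ n * r"
      using that assms * by (auto simp: hbox_def)
    then show ?thesis by linarith
  qed
  then show "y \<in> hbox n (a - 3 ^ n * r) (b + 3 ^ n * r)"
    using y by (auto simp: hbox_def nball_def)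
qed

lemma nball_fmeasurable [simp]: 
  assumes "x \<in> Rn n"
  shows "nball x r \<in> fmeasurable (vol n)"
proof -
  define c where "c = (\<Sum>i<n. \<bar>coord x i\<bar>) + 1"
  have "\<bar>coord x i\<bar> < c" if "i < n" for i
    using member_le_sum[of i "{..<n}" "\<lambda>i. \<bar>coord x i\<bar>"] that by (auto simp: c_def)
  then have "x \<in> hbox n (- c) c"
    using assms by (force simp: hbox_def abs_less_iff)
  from nball_subset_hbox[OF this] show ?thesis
    by (rule fmeasurableI2[rotated]) auto
qed

lemma nball_eq_image:
  assumes "x \<in> Rn n" "r > 0"
  shows "nball x r = (\<lambda>y. x + r *\<^sub>R y) ` nball 0 1"
proof (intro set_eqI iffI)
  fix y assume y: "y \<in> nball x r"
  have "(1 / r) *\<^sub>R (y - x) \<in> nball 0 1"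
    using y assms by (auto simp: nball_def N_scaleR)
  moreover have "y = x + r *\<^sub>R ((1 / r) *\<^sub>R (y - x))"
    using assms by simp
  ultimately show "y \<in> (\<lambda>y. x + r *\<^sub>R y) ` nball 0 1" by blast
qed (use assms in \<open>auto simp: nball_def N_scaleR\<close>)

lemma measure_nball:
  assumes "x \<in> Rn n" "r > 0"
  shows "measure (vol n) (nball x r) = r ^ n * unit_vol"
  unfolding nball_eq_image[OF assms] unit_vol_def
  using assms by (intro measure_vol_affine_image) auto

text \<open>A cube of side \<open>1 / n\<close> fits into the unit ball. The factor
  \<open>n ^ n\<close> that this puts into packing bounds is harmless, because only the logarithms
  of these bounds are used, and they are compared with \<open>n ^ 3\<close>.\<close>

lemma unit_vol_lower: "(1 / n) ^ n \<le> unit_vol"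
proof -
  have "hbox n 0 (1 / n) \<subseteq> nball 0 1"
  proof
    fix x assume x: "x \<in> hbox n 0 (1 / n)"
    have "N x \<le> (\<Sum>i<n. \<bar>coord x i\<bar>)" by (rule N_upper)
    also have "\<dots> < (\<Sum>i<n. 1 / n)"
      using x n_pos by (intro sum_strict_mono) (auto simp: hbox_def lessThan_empty_iff)
    also have "\<dots> = 1" using n_pos by simp
    finally show "x \<in> nball 0 1"
      using x by (simp add: nball_def hbox_def)
  qed
  then have "measure (vol n) (hbox n 0 (1 / n)) \<le> unit_vol"
    unfolding unit_vol_def by (intro measure_mono_fmeasurable) auto
  then show ?thesis
    by (simp add: measure_hbox)
qed

lemma unit_vol_pos: "unit_vol > 0"
proof -
  have "0 < (1 / real n) ^ n" using n_pos by simp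
  with unit_vol_lower show ?thesis by linarith
qed

section \<open>Packings and separated nets\<close>

lemma packing:
  assumes P: "P \<subseteq> Rn n" and r: "r > 0" and B: "B \<in> fmeasurable (vol n)"
    and sub: "\<And>p. p \<in> P \<Longrightarrow> nball p r \<subseteq> B"
    and disj: "\<And>p q. p \<in> P \<Longrightarrow> q \<in> P \<Longrightarrow> p \<noteq> q \<Longrightarrow> nball p r \<inter> nball q r = {}"
  shows "finite P \<and> card P * (r ^ n * unit_vol) \<le> measure (vol n) B"
proof -
  have bound: "card Q * (r ^ n * unit_vol) \<le> measure (vol n) B" if "finite Q" "Q \<subseteq> P" for Q
  proof -
    have "card Q * (r ^ n * unit_vol) = (\<Sum>p\<in>Q. measure (vol n) (nball p r))"
      using that P r by (simp add: measure_nball subset_iff)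
    also have "\<dots> = measure (vol n) (\<Union>p\<in>Q. nball p r)"
    proof (rule measure_UNION'[symmetric, OF that(1)])
      show "pairwise (\<lambda>p q. disjnt (nball p r) (nball q r)) Q"
        using that disj by (auto simp: pairwise_def disjnt_def)
    qed (use that P in auto)
    also have "\<dots> \<le> measure (vol n) B"
      using that sub B by (intro measure_mono_fmeasurable) (auto intro!: sets.finite_UN)
    finally show ?thesis .
  qed
  have "r ^ n * unit_vol > 0" using r unit_vol_pos by simp
  obtain k :: nat where "k > measure (vol n) B / (r ^ n * unit_vol)"
    using reals_Archimedean2 by blast
  then have k: "k * (r ^ n * unit_vol) > measure (vol n) B"
    using \<open>r ^ n * unit_vol > 0\<close> by (simp add: field_simps)
  have "finite P"
  proof (rule ccontr)
    assume "infinite P"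
    then obtain Q where "Q \<subseteq> P" "finite Q" "card Q = k"
      by (meson infinite_arbitrarily_large)
    with bound[of Q] k show False by simp
  qed
  with bound show ?thesis by blast
qed

lemma packing_separated:
  assumes P: "P \<subseteq> Rn n" and d: "d > 0" and B: "B \<in> fmeasurable (vol n)"
    and sub: "\<And>p. p \<in> P \<Longrightarrow> nball p (d / 2) \<subseteq> B"
    and sep: "\<And>p q. p \<in> P \<Longrightarrow> q \<in> P \<Longrightarrow> p \<noteq> q \<Longrightarrow> d \<le> N (p - q)"
  shows "finite P \<and> card P * ((d / 2) ^ n * unit_vol) \<le> measure (vol n) B"
proof (rule packing[OF P _ B sub])
  fix p q assume pq: "p \<in> P" "q \<in> P" "p \<noteq> q"
  have False if "y \<in> nball p (d / 2)" "y \<in> nball q (d / 2)" for y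
  proof -
    have "N (p - q) \<le> N (p - y) + N (y - q)" by (rule N_diff_triangle)
    also have "\<dots> < d / 2 + d / 2"
      using that N_minus_commute[of p y] by (auto simp: nball_def)
    finally show False using sep[OF pq] by simp
  qed
  then show "nball p (d / 2) \<inter> nball q (d / 2) = {}" by blast
qed (use d in auto)

text \<open>Packing bounds the size of \<open>d\<close>-separated sets, so one of maximal
  cardinality exists; a point at distance at least \<open>d\<close> from it could be added.\<close>

lemma separated_net:
  assumes Z: "Z \<subseteq> Rn n" and d: "d > 0" and B: "B \<in> fmeasurable (vol n)"
    and sub: "\<And>p. p \<in> Z \<Longrightarrow> nball p (d / 2) \<subseteq> B"
  obtains F where "finite F" "F \<subseteq> Z" "card F * ((d / 2) ^ n * unit_vol) \<le> measure (vol n) B"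
    and "\<And>p q. p \<in> F \<Longrightarrow> q \<in> F \<Longrightarrow> p \<noteq> q \<Longrightarrow> d \<le> N (p - q)"
    and "\<And>z. z \<in> Z \<Longrightarrow> \<exists>p\<in>F. N (z - p) < d"
proof -
  let ?sep = "\<lambda>F. F \<subseteq> Z \<and> (\<forall>p\<in>F. \<forall>q\<in>F. p \<noteq> q \<longrightarrow> d \<le> N (p - q))"
  have bound: "finite F \<and> card F * ((d / 2) ^ n * unit_vol) \<le> measure (vol n) B" if "?sep F" for F
    using that Z d B sub by (intro packing_separated) auto
  have pos: "(d / 2) ^ n * unit_vol > 0" using d unit_vol_pos by simp
  obtain k :: nat where k: "k > measure (vol n) B / ((d / 2) ^ n * unit_vol)"
    using reals_Archimedean2 by blast
  have le: "card F \<le> k" if "?sep F" for F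
  proof -
    have "card F \<le> measure (vol n) B / ((d / 2) ^ n * unit_vol)"
      using bound[OF that] pos by (simp add: field_simps)
    with k show ?thesis by linarith
  qed
  have "\<exists>F. ?sep F \<and> (\<forall>G. ?sep G \<longrightarrow> card G \<le> card F)"
    by (rule ex_has_greatest_nat[where k = "{}" and b = "Suc k"]) (use le in \<open>auto simp: less_Suc_eq_le\<close>)
  then obtain F where F: "?sep F" "\<And>G. ?sep G \<Longrightarrow> card G \<le> card F"
    by auto
  have "\<exists>p\<in>F. N (z - p) < d" if z: "z \<in> Z" for z
  proof (rule ccontr)
    assume neg: "\<not> ?thesis"
    then have far: "d \<le> N (z - p)" if "p \<in> F" for p using that by force
    have "z \<notin> F" using far[of z] d by auto
    have "?sep (insert z F)"
      using F(1) z far N_minus_commute[of z] by (auto simp: subset_iff)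
    then have "card (insert z F) \<le> card F" by (rule F(2))
    then show False using \<open>z \<notin> F\<close> bound[OF F(1)] by simp
  qed
  with F(1) bound[OF F(1)] show ?thesis by (intro that[of F]) auto
qed

section \<open>Sets avoiding the distance 1\<close>

definition colorable :: "nat \<Rightarrow> bool" where
  "colorable m \<longleftrightarrow> (\<exists>c :: rvec \<Rightarrow> nat. c ` Rn n \<subseteq> {..<m} \<and>
     (\<forall>x\<in>Rn n. \<forall>y\<in>Rn n. N (x - y) = 1 \<longrightarrow> c x \<noteq> c y))"

definition avoids_one :: "rvec set \<Rightarrow> bool" where
  "avoids_one B \<longleftrightarrow> (\<forall>x\<in>B. \<forall>y\<in>B. N (x - y) \<noteq> 1)"

lemma colorable_if_cover:
  assumes cov: "\<And>y. y \<in> Rn n \<Longrightarrow> \<exists>k<m. y \<in> B k"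
    and av: "\<And>k. k < m \<Longrightarrow> avoids_one (B k)"
  shows "colorable m"
proof -
  define c where "c y = (LEAST k. k < m \<and> y \<in> B k)" for y
  have c: "c y < m \<and> y \<in> B (c y)" if "y \<in> Rn n" for y
    unfolding c_def using cov[OF that] by (rule LeastI_ex)
  show ?thesis
    unfolding colorable_def
  proof (intro exI[of _ c] conjI ballI impI)
    show "c ` Rn n \<subseteq> {..<m}" using c by auto
    fix x y assume "x \<in> Rn n" "y \<in> Rn n" "N (x - y) = 1"
    then show "c x \<noteq> c y"
      using c[of x] c[of y] av[of "c x"] unfolding avoids_one_def by metis
  qed
qed

text \<open>Thickening a set with this property by less than \<open>\<delta>\<close> still avoids the distance 1.\<close>

definition gap_set :: "real \<Rightarrow> rvec set \<Rightarrow> bool" where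
  "gap_set \<delta> S \<longleftrightarrow> (\<forall>x\<in>S. \<forall>y\<in>S. N (x - y) \<le> 1 - 2 * \<delta> \<or> 1 + 2 * \<delta> \<le> N (x - y))"

text \<open>The translate of \<open>S\<close> by \<open>- z\<close>, thickened by less than
  \<open>\<delta>\<close>. The thickening is the reason why covering the points \<open>q\<close> of
  a net by translates of \<open>S\<close> is enough.\<close>

definition shifted_class :: "real \<Rightarrow> rvec set \<Rightarrow> rvec \<Rightarrow> rvec set" where
  "shifted_class \<delta> S z = {y \<in> Rn n. \<exists>q\<in>Rn n. N (y - q) < \<delta> \<and> q + z \<in> S}"

lemma avoids_one_shifted_class:
  assumes "gap_set \<delta> S"
  shows "avoids_one (shifted_class \<delta> S z)"
  unfolding avoids_one_def
proof (intro ballI)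
  fix x y assume "x \<in> shifted_class \<delta> S z" "y \<in> shifted_class \<delta> S z"
  then obtain p q where pq: "N (x - p) < \<delta>" "p + z \<in> S" "N (y - q) < \<delta>" "q + z \<in> S"
    by (auto simp: shifted_class_def)
  have "N ((p + z) - (q + z)) \<le> 1 - 2 * \<delta> \<or> 1 + 2 * \<delta> \<le> N ((p + z) - (q + z))"
    using assms pq unfolding gap_set_def by blast
  then have "N (p - q) \<le> 1 - 2 * \<delta> \<or> 1 + 2 * \<delta> \<le> N (p - q)" by simp
  moreover have "N (p - q) \<le> N (p - x) + N (x - y) + N (y - q)"
    using N_diff_triangle[of p q x] N_diff_triangle[of x q y] by linarith
  moreover have "N (x - y) \<le> N (x - p) + N (p - q) + N (q - y)"
    using N_diff_triangle[of x y p] N_diff_triangle[of p y q] by linarith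
  ultimately show "N (x - y) \<noteq> 1"
    using pq N_minus_commute[of p x] N_minus_commute[of q y] by linarith
qed

lemma shifted_class_periodic:
  assumes S: "periodic n l S" and w: "w \<in> period_lattice n l" and y: "y \<in> shifted_class \<delta> S z" and z: "z \<in> Rn n"
  shows "y + w \<in> shifted_class \<delta> S z"
proof -
  have wR: "w \<in> Rn n" using w by (rule period_lattice_Rn)
  from y obtain q where q: "q \<in> Rn n" "N (y - q) < \<delta>" "q + z \<in> S" "y \<in> Rn n"
    by (auto simp: shifted_class_def)
  have "(q + z) + w \<in> S"
    using S q z w unfolding periodic_def by (meson Rn_add)
  then have "(q + w) + z \<in> S" by (simp add: algebra_simps)
  then show ?thesis
    unfolding shifted_class_def using q wR by (auto intro!: bexI[of _ "q + w"])
qed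

lemma translate_borel: "S \<in> sets borel \<Longrightarrow> {z. p + z \<in> S} \<in> sets (borel :: rvec measure)"
  using borel_affine_preimage[of S p 1] by simp

lemma measure_periodic_shift:
  assumes "l > 0" "t \<in> Rn n" "S \<in> sets borel" "periodic n l S"
  shows "measure (vol n) ({x. t + x \<in> S} \<inter> hbox n 0 l) = measure (vol n) (S \<inter> hbox n 0 l)"
proof -
  have "{x. t + x \<in> S} \<inter> hbox n 0 l = {x \<in> hbox n 0 l. t + x \<in> S}" by auto
  then show ?thesis
    using emeasure_periodic_shift[OF assms] by (simp add: measure_def)
qed

lemma cover_by_shifts:
  fixes m :: nat and h :: real
  assumes l: "l > 0" and S: "S \<in> sets borel" "periodic n l S"
    and h: "h * l ^ n \<le> measure (vol n) (S \<inter> hbox n 0 l)" "0 < h"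
    and X: "finite X" "X \<subseteq> Rn n" "card X < exp (h * m)"
  shows "\<exists>v. (\<forall>i<m. v i \<in> hbox n 0 l) \<and> (\<forall>x\<in>X. \<exists>i<m. x + v i \<in> S)"
proof -
  have "\<exists>v. (\<forall>i<m. v i \<in> hbox n 0 l) \<and> (\<forall>x\<in>X. \<exists>i<m. v i \<in> {z. x + z \<in> S})"
  proof (rule greedy_cover[where M = "vol n" and h = h])
    show "h * measure (vol n) (hbox n 0 l) \<le> measure (vol n) ({z. x + z \<in> S} \<inter> hbox n 0 l)"
      if "x \<in> X" for x
      using that X S h l by (subst measure_periodic_shift) (auto simp: measure_hbox)
  qed (use assms in \<open>auto simp: measure_hbox translate_borel\<close>)
  then show ?thesis by simp
qed

text \<open>The plain union bound over a net of the whole period box. Its price is the logarithm of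
  \<open>card X\<close>, which is acceptable where an exponential bound with a generous base is
  wanted.\<close>

lemma colorable_if_gap_set:
  fixes m :: nat and h :: real
  assumes l: "l > 0" and S: "S \<in> sets borel" "periodic n l S" "gap_set \<delta> S"
    and h: "h * l ^ n \<le> measure (vol n) (S \<inter> hbox n 0 l)" "0 < h"
    and X: "finite X" "X \<subseteq> Rn n" "card X < exp (h * m)"
    and net: "\<And>y. y \<in> hbox n 0 l \<Longrightarrow> \<exists>x\<in>X. N (y - x) < \<delta>"
  shows "colorable m"
proof -
  obtain v where v: "\<forall>i<m. v i \<in> hbox n 0 l" "\<forall>x\<in>X. \<exists>i<m. x + v i \<in> S"
    using cover_by_shifts[OF l S(1,2) h X] by blast
  show ?thesis
  proof (rule colorable_if_cover)
    show "avoids_one (shifted_class \<delta> S (v k))" for k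
      using S(3) by (rule avoids_one_shifted_class)
    fix y assume y: "y \<in> Rn n"
    obtain w where w: "w \<in> period_lattice n l" "y + w \<in> hbox n 0 l"
      using period_reduce[OF l y] by blast
    obtain x where x: "x \<in> X" "N (y + w - x) < \<delta>" using net[OF w(2)] by blast
    obtain i where i: "i < m" "x + v i \<in> S" using v x by blast
    have "v i \<in> Rn n" using v i by (auto simp: hbox_def)
    have yw: "y + w \<in> shifted_class \<delta> S (v i)"
      using x i X w by (auto simp: shifted_class_def hbox_def)
    have "(y + w) + (- w) \<in> shifted_class \<delta> S (v i)"
      by (rule shifted_class_periodic[OF S(2) period_lattice_uminus[OF w(1)] yw \<open>v i \<in> Rn n\<close>])
    then show "\<exists>k<m. y \<in> shifted_class \<delta> S (v k)"
      using i by auto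
  qed
qed

end

section \<open>Systems of separated cells\<close>

context coord_norm
begin

lemma fmeasurable_if_subset_hbox:
  "B \<in> sets borel \<Longrightarrow> B \<subseteq> hbox n a b \<Longrightarrow> B \<in> fmeasurable (vol n)"
  by (rule fmeasurableI2[OF hbox_fmeasurable]) simp_all

text \<open>The alternative \<open>w \<noteq> 0\<close> also keeps a cell away from its own periodic
  copies, so that cells near opposite faces of the box stay separated once the box is
  repeated.\<close>

definition cell_system :: "real \<Rightarrow> 'i set \<Rightarrow> ('i \<Rightarrow> rvec set) \<Rightarrow> real \<Rightarrow> bool" where
  "cell_system l I A s \<longleftrightarrow> finite I \<and> 0 < s \<and>
     (\<forall>i\<in>I. A i \<in> sets borel \<and> A i \<subseteq> hbox n 0 l) \<and>
     (\<forall>i\<in>I. \<forall>j\<in>I. \<forall>w\<in>period_lattice n l. i \<noteq> j \<or> w \<noteq> 0 \<longrightarrow>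
        (\<forall>a\<in>A i. \<forall>b\<in>A j. s \<le> N (a + w - b)))"

text \<open>The factor \<open>1\<close> gives the translation the affine form to which
  \<open>borel_affine_image\<close> applies.\<close>

definition cell_union :: "real \<Rightarrow> 'i set \<Rightarrow> ('i \<Rightarrow> rvec set) \<Rightarrow> rvec set" where
  "cell_union l I A = (\<Union>i\<in>I. \<Union>w\<in>period_lattice n l. (\<lambda>a. w + 1 *\<^sub>R a) ` A i)"

lemma mem_cell_union:
  "y \<in> cell_union l I A \<longleftrightarrow> (\<exists>i\<in>I. \<exists>w\<in>period_lattice n l. \<exists>a\<in>A i. y = a + w)"
  by (auto simp: cell_union_def add.commute)

lemma cell_union_borel:
  assumes "cell_system l I A s"
  shows "cell_union l I A \<in> sets borel"
  unfolding cell_union_def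
  using assms
  by (intro sets.finite_UN sets.countable_UN'' countable_period_lattice borel_affine_image)
     (auto simp: cell_system_def)

lemma cell_union_periodic: "periodic n l (cell_union l I A)"
  unfolding periodic_def
proof (intro ballI iffI)
  fix y w assume yw: "y \<in> Rn n" "w \<in> period_lattice n l"
  { assume "y \<in> cell_union l I A"
    then obtain i v a where "i \<in> I" "v \<in> period_lattice n l" "a \<in> A i" "y = a + v"
      by (auto simp: mem_cell_union)
    then show "y + w \<in> cell_union l I A"
      unfolding mem_cell_union using yw
      by (intro bexI[of _ i] bexI[of _ "v + w"] bexI[of _ a]) (auto simp: algebra_simps) }
  { assume "y + w \<in> cell_union l I A"
    then obtain i v a where *: "i \<in> I" "v \<in> period_lattice n l" "a \<in> A i" "y + w = a + v"
      by (auto simp: mem_cell_union)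
    then have "y = a + (v - w)" by (simp add: algebra_simps)
    then show "y \<in> cell_union l I A"
      unfolding mem_cell_union using yw *
      by (intro bexI[of _ i] bexI[of _ "v - w"] bexI[of _ a]) auto }
qed

lemma measure_cell_union:
  assumes "cell_system l I A s"
  shows "(\<Sum>i\<in>I. measure (vol n) (A i)) \<le> measure (vol n) (cell_union l I A \<inter> hbox n 0 l)"
proof -
  have fin: "finite I" and bor: "A i \<in> sets borel" and sub: "A i \<subseteq> hbox n 0 l" if "i \<in> I" for i
    using assms that by (auto simp: cell_system_def)
  have fm: "A i \<in> fmeasurable (vol n)" if "i \<in> I" for i
    by (rule fmeasurable_if_subset_hbox[OF bor[OF that] sub[OF that]])
  show ?thesis
  proof (cases "I = {}")
    case False
    then have fin: "finite I" using fin by blast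
    have "(\<Sum>i\<in>I. measure (vol n) (A i)) = measure (vol n) (\<Union>i\<in>I. A i)"
    proof (rule measure_UNION'[symmetric, OF fin])
      show "pairwise (\<lambda>i j. disjnt (A i) (A j)) I"
      proof (unfold pairwise_def disjnt_def, intro ballI impI)
        fix i j assume ij: "i \<in> I" "j \<in> I" "i \<noteq> j"
        have False if "a \<in> A i" "a \<in> A j" for a
        proof -
          have "s \<le> N (a + 0 - a)" "0 < s"
            using assms ij that period_lattice_zero[of n l] unfolding cell_system_def by blast+
          then show False by simp
        qed
        then show "A i \<inter> A j = {}" by blast
      qed
    qed (use fm in auto)
    also have "\<dots> \<le> measure (vol n) (cell_union l I A \<inter> hbox n 0 l)"
    proof (rule measure_mono_fmeasurable)
      show "(\<Union>i\<in>I. A i) \<subseteq> cell_union l I A \<inter> hbox n 0 l"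
      proof
        fix a assume "a \<in> (\<Union>i\<in>I. A i)"
        then obtain i where "i \<in> I" "a \<in> A i" by auto
        then have "a \<in> cell_union l I A"
          unfolding mem_cell_union by (intro bexI[of _ i] bexI[of _ 0] bexI[of _ a]) auto
        with sub \<open>i \<in> I\<close> \<open>a \<in> A i\<close> show "a \<in> cell_union l I A \<inter> hbox n 0 l" by auto
      qed
      show "(\<Union>i\<in>I. A i) \<in> sets (vol n)" using fin bor by (auto intro!: sets.finite_UN)
      show "cell_union l I A \<inter> hbox n 0 l \<in> fmeasurable (vol n)"
        by (rule fmeasurable_if_subset_hbox[OF sets.Int[OF cell_union_borel[OF assms] borel_hbox] Int_lower2])
    qed
    finally show ?thesis .
  qed simp
qed

lemma gap_set_cell_union:
  assumes cs: "cell_system l I A s" and s: "1 + 2 * \<delta> \<le> s"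
    and diam: "\<And>i a b. i \<in> I \<Longrightarrow> a \<in> A i \<Longrightarrow> b \<in> A i \<Longrightarrow> N (a - b) \<le> 1 - 2 * \<delta>"
  shows "gap_set \<delta> (cell_union l I A)"
  unfolding gap_set_def
proof (intro ballI)
  fix x y assume "x \<in> cell_union l I A" "y \<in> cell_union l I A"
  then obtain i v a j w b where *: "i \<in> I" "v \<in> period_lattice n l" "a \<in> A i" "x = a + v"
      "j \<in> I" "w \<in> period_lattice n l" "b \<in> A j" "y = b + w"
    unfolding mem_cell_union by blast
  have xy: "x - y = a + (v - w) - b" using * by (simp add: algebra_simps)
  show "N (x - y) \<le> 1 - 2 * \<delta> \<or> 1 + 2 * \<delta> \<le> N (x - y)"
  proof (cases "i = j \<and> v = w")
    case True
    then show ?thesis using diam[of i a b] * xy by simp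
  next
    case False
    have "v - w \<in> period_lattice n l" using * by simp
    moreover have "i \<noteq> j \<or> v - w \<noteq> 0" using False by simp
    ultimately have "s \<le> N (a + (v - w) - b)"
      using cs * unfolding cell_system_def by blast
    then show ?thesis using s xy by simp
  qed
qed

section \<open>Colouring by a sparse set of residual points\<close>

text \<open>\<open>S\<close> is the fine periodic set with density \<open>h\<close>; the
  \<open>A i\<close> are coarse cells inside unit balls, and \<open>G\<close> translates of their
  union cover the space. The first \<open>m\<close> translates of \<open>S\<close> hit every set of
  \<open>t\<close> weakly correlated net points in such a ball. In each ball \<open>t * J\<close>
  further translates suffice, and different balls share colours because the cells are more than 1
  apart, so the residual colours do not multiply with \<open>card I\<close>.\<close>

lemma colorable_main:
  fixes m G t J b :: nat and \<tau> h h' \<delta> \<delta>' s :: real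
  assumes l: "l > 0" and S: "S \<in> sets borel" "periodic n l S" "gap_set \<delta> S"
    and \<delta>: "\<delta> > 0"
    and h: "h * l ^ n \<le> measure (vol n) (S \<inter> hbox n 0 l)" "0 < h"
    and cs: "cell_system l I A s" and s: "1 + 2 * \<delta>' < s"
    and ctr: "\<And>i. i \<in> I \<Longrightarrow> ctr i \<in> Rn n" "\<And>i a. i \<in> I \<Longrightarrow> a \<in> A i \<Longrightarrow> N (a - ctr i) \<le> 1 - \<delta>'"
    and h': "h' * l ^ n \<le> measure (vol n) (cell_union l I A \<inter> hbox n 0 l)" "0 < h'"
    and X: "finite X" "X \<subseteq> Rn n" "card X < exp (h' * G)"
    and netX: "\<And>y. y \<in> hbox n 0 l \<Longrightarrow> \<exists>x\<in>X. N (y - x) < \<delta>'"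
    and netF: "\<And>c. c \<in> Rn n \<Longrightarrow> \<exists>F. finite F \<and> F \<subseteq> Rn n \<and> card F \<le> b \<and>
                 (\<forall>y\<in>Rn n. N (y - c) \<le> 1 \<longrightarrow> (\<exists>q\<in>F. N (y - q) < \<delta>))"
    and t: "t \<ge> 1" and \<tau>: "0 < \<tau>" "t * \<tau> < 1"
    and m: "card I * G * b ^ t < exp (t * (1 - t * \<tau>) * h * m)"
    and J: "b < exp (\<tau> * J)"
  shows "colorable (m + G * (t * J))"
proof -
  let ?D = "hbox n 0 l" and ?L = "period_lattice n l" and ?M = "vol n"
  define \<kappa> where "\<kappa> = measure ?M (S \<inter> ?D)"
  have lpos: "0 < l ^ n" using l by simp
  have \<kappa>: "\<kappa> > 0"
  proof -
    have "0 < h * l ^ n" using h(2) lpos by simp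
    with h(1) show ?thesis unfolding \<kappa>_def by linarith
  qed
  have "\<tau> \<le> t * \<tau>" using t \<tau> by simp
  with \<tau> have \<tau>1: "\<tau> < 1" by linarith
  have DR: "z \<in> Rn n" if "z \<in> ?D" for z using that by (simp add: hbox_def)
  have SD: "S \<inter> ?D \<in> fmeasurable ?M"
    by (rule fmeasurable_if_subset_hbox[OF sets.Int[OF S(1) borel_hbox] Int_lower2])

  obtain zb where zb: "\<And>g. g < G \<Longrightarrow> zb g \<in> ?D" "\<And>x. x \<in> X \<Longrightarrow> \<exists>g<G. x + zb g \<in> cell_union l I A"
    using cover_by_shifts[OF l cell_union_borel[OF cs] cell_union_periodic h' X] by blast
  \<comment> \<open>The centres of all coarse cells of all \<open>G\<close> families within one
    period: only the balls around these finitely many points enter the union bound.\<close>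
  define C where "C = (\<lambda>(i, g). ctr i - zb g) ` (I \<times> {..<G})"
  have fI: "finite I" using cs by (simp add: cell_system_def)
  have C: "finite C" "card C \<le> card I * G" "C \<subseteq> Rn n"
    using fI ctr(1) DR[OF zb(1)] card_image_le[of "I \<times> {..<G}" "\<lambda>(i, g). ctr i - zb g"]
    by (auto simp: C_def card_cartesian_product)
  from bchoice[OF ballI[OF netF]]
  obtain F where F': "\<forall>c\<in>Rn n. finite (F c) \<and> F c \<subseteq> Rn n \<and> card (F c) \<le> b \<and>
                 (\<forall>y\<in>Rn n. N (y - c) \<le> 1 \<longrightarrow> (\<exists>q\<in>F c. N (y - q) < \<delta>))" ..
  note F = bspec[OF F']

  define hit where "hit p = {z. p + z \<in> S}" for p
  have hit_borel: "hit p \<in> sets ?M" for p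
    unfolding hit_def using translate_borel[OF S(1)] by simp
  define ov where "ov p q = measure ?M (hit p \<inter> hit q \<inter> ?D)" for p q
  have single: "measure ?M (hit p \<inter> ?D) = \<kappa>" if "p \<in> Rn n" for p
    unfolding hit_def \<kappa>_def by (rule measure_periodic_shift[OF l that S(1,2)])
  define adm where "adm T \<longleftrightarrow> (\<forall>p\<in>T. \<forall>q\<in>T. p \<noteq> q \<longrightarrow> ov p q \<le> \<tau> * \<kappa>)" for T
  \<comment> \<open>A set counts as hit once a single one of its points is covered; this raises the
    hitting density from \<open>h\<close> to about \<open>t * h\<close>.\<close>
  define TT where "TT = (\<Union>c\<in>C. {T. T \<subseteq> F c \<and> card T = t \<and> adm T})"
  have finTT: "finite TT"
    unfolding TT_def using C F by (intro finite_UN_I) (auto intro: finite_subset[OF _ finite_Pow_iff[THEN iffD2]])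
  have "card TT \<le> (\<Sum>c\<in>C. card {T. T \<subseteq> F c \<and> card T = t \<and> adm T})"
    unfolding TT_def by (rule card_UN_le[OF C(1)])
  also have "\<dots> \<le> (\<Sum>c\<in>C. b ^ t)"
  proof (rule sum_mono)
    fix c assume "c \<in> C"
    then have Fc: "finite (F c)" "card (F c) \<le> b" using C F by auto
    have "card {T. T \<subseteq> F c \<and> card T = t \<and> adm T} \<le> card {T. T \<subseteq> F c \<and> card T = t}"
      using Fc by (intro card_mono) auto
    also have "\<dots> = card (F c) choose t" using Fc by (simp add: n_subsets)
    also have "\<dots> \<le> card (F c) ^ t"
      by (cases "t \<le> card (F c)") (auto simp: binomial_le_pow binomial_eq_0)
    also have "\<dots> \<le> b ^ t" using Fc by (intro power_mono) auto
    finally show "card {T. T \<subseteq> F c \<and> card T = t \<and> adm T} \<le> b ^ t" .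
  qed
  also have "\<dots> \<le> card I * G * b ^ t" using C by simp
  finally have cardTT: "card TT < exp (t * (1 - t * \<tau>) * h * m)"
    using m by (meson le_less_trans of_nat_le_iff)
  have "\<exists>v. (\<forall>i<m. v i \<in> ?D) \<and> (\<forall>T\<in>TT. \<exists>i<m. v i \<in> (\<Union>p\<in>T. hit p))"
  proof (rule greedy_cover[OF finTT, where M = ?M and h = "t * (1 - t * \<tau>) * h"])
    show "?D \<in> fmeasurable ?M" by simp
    show "0 < measure ?M ?D" using l by (simp add: measure_hbox)
    fix T assume "T \<in> TT"
    then obtain c where c: "c \<in> C" "T \<subseteq> F c" "card T = t" "adm T" by (auto simp: TT_def)
    then have T: "finite T" "T \<subseteq> Rn n" using F[of c] C by (auto intro: finite_subset)
    then show "(\<Union>p\<in>T. hit p) \<in> sets ?M" using hit_borel by (intro sets.finite_UN) auto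
    have "t * (1 - t * \<tau>) * h * measure ?M ?D = t * (1 - t * \<tau>) * (h * l ^ n)"
      using l by (simp add: measure_hbox)
    also have "\<dots> \<le> t * (1 - t * \<tau>) * \<kappa>"
      using h(1) \<tau> unfolding \<kappa>_def by (intro mult_left_mono) auto
    also have "\<dots> = card T * (\<kappa> - card T * (\<tau> * \<kappa>))"
      using c by (simp add: algebra_simps)
    also have "\<dots> \<le> measure ?M ((\<Union>p\<in>T. hit p) \<inter> ?D)"
    proof (rule bonferroni_lower[OF T(1)])
      show "\<kappa> \<le> measure ?M (hit p \<inter> ?D)" if "p \<in> T" for p
        using single[of p] that T by auto
      show "measure ?M (hit p \<inter> hit q \<inter> ?D) \<le> \<tau> * \<kappa>" if "p \<in> T" "q \<in> T" "p \<noteq> q" for p q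
        using c(4) that unfolding adm_def ov_def by blast
    qed (use hit_borel \<tau> \<kappa> in auto)
    finally show "t * (1 - t * \<tau>) * h * measure ?M ?D \<le> measure ?M ((\<Union>p\<in>T. hit p) \<inter> ?D)" .
  next
    show "0 < t * (1 - t * \<tau>) * h" using t \<tau> h by simp
    show "real (card TT) < exp (t * (1 - t * \<tau>) * h * real m)" using cardTT by simp
  qed
  then obtain z1 where z1: "\<And>i. i < m \<Longrightarrow> z1 i \<in> ?D" "\<And>T. T \<in> TT \<Longrightarrow> \<exists>i<m. \<exists>p\<in>T. p + z1 i \<in> S"
    unfolding hit_def by fastforce

  define U where "U c = {q \<in> F c. \<forall>i<m. q + z1 i \<notin> S}" for c

  txt \<open>Fewer than \<open>t\<close> points of \<open>U c\<close> are pairwise weakly correlated; hence every point of \<open>U c\<close>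
    is strongly correlated with one of them, and strong correlation with \<open>p\<close> means that a random
    translate of \<open>S\<close> through \<open>p\<close> contains the point with probability at least \<open>\<tau>\<close>.\<close>
  have residual: "\<exists>sh. \<forall>q\<in>U c. \<exists>k<t * J. sh k \<in> Rn n \<and> q + sh k \<in> S" if c: "c \<in> C" for c
  proof -
    have cR: "c \<in> Rn n" using c C by auto
    have finU: "finite (U c)" and UF: "U c \<subseteq> F c" using F[OF cR] by (auto simp: U_def)
    have FR: "F c \<subseteq> Rn n" "finite (F c)" "card (F c) \<le> b" using F[OF cR] by auto
    \<comment> \<open>Otherwise some \<open>t\<close>-subset of \<open>P\<close> would belong to
      \<open>TT\<close>, and one of the first \<open>m\<close> shifts would have covered one of its
      points.\<close>
    have lt: "card P < t" if P: "P \<subseteq> U c" "adm P" for P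
    proof (rule ccontr)
      assume "\<not> card P < t"
      then obtain T where T: "T \<subseteq> P" "card T = t"
        using P finU by (metis linorder_not_less obtain_subset_with_card_n)
      have "adm T" using P(2) T(1) unfolding adm_def by (meson subsetD)
      moreover have "T \<subseteq> F c" using T(1) P(1) UF by (meson order_trans)
      ultimately have "T \<in> TT"
        unfolding TT_def using c T(2) by (intro UN_I[of c]) simp_all
      then obtain i p where "i < m" "p \<in> T" "p + z1 i \<in> S" using z1(2) by blast
      then show False using T P by (auto simp: U_def)
    qed
    have "\<exists>P. (P \<subseteq> U c \<and> adm P) \<and> (\<forall>Q. Q \<subseteq> U c \<and> adm Q \<longrightarrow> card Q \<le> card P)"
      by (rule ex_has_greatest_nat[where k = "{}" and b = t]) (use lt in \<open>auto simp: adm_def\<close>)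
    then obtain P where P: "P \<subseteq> U c" "adm P" and Pmax: "\<And>Q. Q \<subseteq> U c \<Longrightarrow> adm Q \<Longrightarrow> card Q \<le> card P"
      by blast
    have finP: "finite P" using P finU finite_subset by blast
    have ov_sym: "ov p q = ov q p" for p q by (simp add: ov_def Int_commute)
    have corr: "\<exists>p\<in>P. \<tau> * \<kappa> < ov p q" if q: "q \<in> U c" for q
    proof (rule ccontr)
      assume neg: "\<not> ?thesis"
      have "ov q q = \<kappa>" using single[of q] q UF FR by (auto simp: ov_def)
      then have "q \<notin> P" using neg \<tau>1 \<kappa> by force
      moreover have "adm (insert q P)"
        using P(2) neg ov_sym unfolding adm_def by (auto simp: not_less)
      then have "card (insert q P) \<le> card P" using q P by (intro Pmax) auto
      ultimately show False using finP by simp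
    qed
    have "\<exists>v. \<forall>q. q \<in> F c \<and> \<tau> * \<kappa> < ov p q \<longrightarrow> (\<exists>j<J. v j \<in> Rn n \<and> q + v j \<in> S)" if p: "p \<in> P" for p
    proof -
      have pR: "p \<in> Rn n" using p P UF FR by auto
      let ?X = "{q \<in> F c. \<tau> * \<kappa> < ov p q}"
      \<comment> \<open>The sample space is now the part of \<open>S\<close> in the box: moving
        \<open>p\<close> to a random point of \<open>S\<close> amounts to choosing a random
        translate of \<open>S\<close> through \<open>p\<close>.\<close>
      have "\<exists>v. (\<forall>j<J. v j \<in> S \<inter> ?D) \<and> (\<forall>q\<in>?X. \<exists>j<J. v j \<in> hit (q - p))"
      proof (rule greedy_cover[where M = ?M and h = \<tau>])
        show "finite ?X" using FR by simp
        have "card ?X \<le> card (F c)" using FR by (intro card_mono) auto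
        then show "card ?X < exp (\<tau> * J)" using FR J by linarith
        fix q assume q: "q \<in> ?X"
        then have qR: "q \<in> Rn n" using FR by auto
        have per: "periodic n l (S \<inter> hit (q - p))"
          unfolding periodic_def
        proof (intro ballI)
          fix y w assume "y \<in> Rn n" "w \<in> ?L"
          then have "y + w \<in> S \<longleftrightarrow> y \<in> S" "((q - p) + y) + w \<in> S \<longleftrightarrow> (q - p) + y \<in> S"
            using S(2) pR qR unfolding periodic_def by (meson Rn_add Rn_diff)+
          then show "y + w \<in> S \<inter> hit (q - p) \<longleftrightarrow> y \<in> S \<inter> hit (q - p)"
            by (simp add: hit_def add.assoc)
        qed
        have "measure ?M (hit (q - p) \<inter> (S \<inter> ?D)) = measure ?M (S \<inter> hit (q - p) \<inter> ?D)"
          by (rule arg_cong[of _ _ "measure ?M"]) auto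
        \<comment> \<open>Translation by \<open>p\<close> turns \<open>S\<close> and
          \<open>hit (q - p)\<close> into \<open>hit p\<close> and \<open>hit q\<close>, so the
          conditional probability becomes an overlap.\<close>
        also have "\<dots> = measure ?M ({x. p + x \<in> S \<inter> hit (q - p)} \<inter> ?D)"
          using S(1) hit_borel by (intro measure_periodic_shift[symmetric] l pR per) auto
        also have "{x. p + x \<in> S \<inter> hit (q - p)} \<inter> ?D = hit p \<inter> hit q \<inter> ?D"
          by (auto simp: hit_def)
        finally have "measure ?M (hit (q - p) \<inter> (S \<inter> ?D)) = ov p q" by (simp add: ov_def)
        then show "\<tau> * measure ?M (S \<inter> ?D) \<le> measure ?M (hit (q - p) \<inter> (S \<inter> ?D))"
          using q by (simp add: \<kappa>_def)
      qed (use SD \<kappa> hit_borel \<tau> in \<open>auto simp: \<kappa>_def\<close>)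
      then obtain v where v: "\<forall>j<J. v j \<in> S \<inter> ?D" "\<forall>q\<in>?X. \<exists>j<J. v j \<in> hit (q - p)" by blast
      show ?thesis
      proof (intro exI[of _ "\<lambda>j. v j - p"] allI impI)
        fix q assume "q \<in> F c \<and> \<tau> * \<kappa> < ov p q"
        then obtain j where "j < J" "v j \<in> hit (q - p)" using v(2) by blast
        then show "\<exists>j<J. v j - p \<in> Rn n \<and> q + (v j - p) \<in> S"
          using v(1) DR pR by (intro exI[of _ j]) (auto simp: hit_def algebra_simps)
      qed
    qed
    from bchoice[OF ballI[OF this]]
    obtain v where v: "\<forall>p\<in>P. \<forall>q. q \<in> F c \<and> \<tau> * \<kappa> < ov p q \<longrightarrow> (\<exists>j<J. v p j \<in> Rn n \<and> q + v p j \<in> S)" ..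
    obtain e where e: "bij_betw e {..<card P} P"
      using ex_bij_betw_nat_finite[OF finP] by (auto simp: atLeast0LessThan)
    show ?thesis
    \<comment> \<open>The shifts of the points of \<open>P\<close> are concatenated in blocks of
      length \<open>J\<close>. Blocks from index \<open>card P\<close> on carry arbitrary values,
      which is why membership in \<open>Rn n\<close> is claimed only for the \<open>k\<close> that
      is found.\<close>
    proof (intro exI[of _ "\<lambda>k. v (e (k div J)) (k mod J)"] ballI)
      fix q assume q: "q \<in> U c"
      then obtain p where p: "p \<in> P" "\<tau> * \<kappa> < ov p q" using corr by blast
      then obtain a where a: "a < card P" "p = e a"
        using e by (auto simp: bij_betw_def)
      obtain j where j: "j < J" "v p j \<in> Rn n" "q + v p j \<in> S" using v p q UF by blast
      have "a < t" using a lt[OF P] by simp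
      then have "a * J + j < t * J"
        using j(1) by (metis add_less_cancel_left less_le_trans mult_Suc mult_le_mono1 Suc_leI add.commute)
      moreover have "(a * J + j) div J = a" "(a * J + j) mod J = j" using j(1) by auto
      ultimately show "\<exists>k<t * J. v (e (k div J)) (k mod J) \<in> Rn n \<and> q + v (e (k div J)) (k mod J) \<in> S"
        using j a by (intro exI[of _ "a * J + j"]) auto
    qed
  qed
  from bchoice[OF ballI[OF this]]
  obtain sh where sh: "\<forall>c\<in>C. \<forall>q\<in>U c. \<exists>k<t * J. sh c k \<in> Rn n \<and> q + sh c k \<in> S" ..
  define cell where "cell g i W y \<longleftrightarrow> i \<in> I \<and> W \<in> ?L \<and> (\<exists>a\<in>A i. N (y + W + zb g - a) < \<delta>')" for g i W y
  \<comment> \<open>One colour class combines the \<open>k\<close>-th residual shift of every cell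
    of family \<open>g\<close>. Within a cell it is part of a single shifted class; points of
    different cells are farther apart than \<open>s - 2 * \<delta>' > 1\<close>.\<close>
  define BB where "BB g k = {y \<in> Rn n. \<exists>i W. cell g i W y \<and> y + W \<in> shifted_class \<delta> S (sh (ctr i - zb g) k)}" for g k
  define B where "B j = (if j < m then shifted_class \<delta> S (z1 j)
     else BB ((j - m) div (t * J)) ((j - m) mod (t * J)))" for j
  show ?thesis
  proof (rule colorable_if_cover)
    fix j assume "j < m + G * (t * J)"
    have "avoids_one (BB g k)" for g k
      unfolding avoids_one_def
    proof (intro ballI)
      fix x y assume "x \<in> BB g k" "y \<in> BB g k"
      then obtain i W i' W' where iW: "cell g i W x" "x + W \<in> shifted_class \<delta> S (sh (ctr i - zb g) k)"
          "cell g i' W' y" "y + W' \<in> shifted_class \<delta> S (sh (ctr i' - zb g) k)"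
        unfolding BB_def by blast
      show "N (x - y) \<noteq> 1"
      proof (cases "i = i' \<and> W = W'")
        case True
        then have "N ((x + W) - (y + W)) \<noteq> 1"
          using avoids_one_shifted_class[OF S(3)] iW unfolding avoids_one_def by blast
        then show ?thesis by simp
      next
        case False
        obtain a a' where a: "a \<in> A i" "N (x + W + zb g - a) < \<delta>'" "a' \<in> A i'" "N (y + W' + zb g - a') < \<delta>'"
          using iW unfolding cell_def by blast
        have "W' - W \<in> ?L" "i \<in> I" "i' \<in> I" using iW by (auto simp: cell_def)
        moreover have "i \<noteq> i' \<or> W' - W \<noteq> 0" using False by auto
        ultimately have "s \<le> N (a + (W' - W) - a')"
          using cs a unfolding cell_system_def by blast
        also have "a + (W' - W) - a' = (a - (x + W + zb g)) + ((x - y) + ((y + W' + zb g) - a'))"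
          by (simp add: algebra_simps)
        also have "N \<dots> \<le> N (a - (x + W + zb g)) + (N (x - y) + N ((y + W' + zb g) - a'))"
          using N_triangle[of "a - (x + W + zb g)"] N_triangle[of "x - y" "(y + W' + zb g) - a'"]
          by (meson add_left_mono order_trans)
        also have "N (a - (x + W + zb g)) = N (x + W + zb g - a)" by (rule N_minus_commute)
        finally show ?thesis using a s by linarith
      qed
    qed
    then show "avoids_one (B j)"
      unfolding B_def using avoids_one_shifted_class[OF S(3)] by simp
  next
    fix y assume y: "y \<in> Rn n"
    show "\<exists>j<m + G * (t * J). y \<in> B j"
    proof (cases "\<exists>i<m. y \<in> shifted_class \<delta> S (z1 i)")
      case True
      then obtain i where "i < m" "y \<in> shifted_class \<delta> S (z1 i)" by blast
      then show ?thesis by (intro exI[of _ i]) (auto simp: B_def)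
    next
      case False
      obtain w where w: "w \<in> ?L" "y + w \<in> ?D" using period_reduce[OF l y] by blast
      obtain x where x: "x \<in> X" "N (y + w - x) < \<delta>'" using netX[OF w(2)] by blast
      obtain g where g: "g < G" "x + zb g \<in> cell_union l I A" using zb(2)[OF x(1)] by blast
      then obtain i v a where i: "i \<in> I" "v \<in> ?L" "a \<in> A i" "x + zb g = a + v"
        by (auto simp: mem_cell_union)
      \<comment> \<open>This period vector takes \<open>y\<close>, after the shift by
        \<open>zb g\<close>, near the cell \<open>A i\<close> itself rather than near one of its
        periodic copies.\<close>
      define W where "W = w - v"
      define c where "c = ctr i - zb g"
      have W: "W \<in> ?L" using w i by (simp add: W_def)
      then have WR: "W \<in> Rn n" by (rule period_lattice_Rn)
      have yW: "y + W + zb g - a = y + w - x"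
      proof -
        have "a = x + zb g - v" using i by (simp add: algebra_simps)
        then show ?thesis by (simp add: W_def)
      qed
      have "N (y + W + zb g - a) < \<delta>'" unfolding yW by (rule x(2))
      then have cell: "cell g i W y" using i W unfolding cell_def by blast
      have cC: "c \<in> C" using i g by (auto simp: C_def c_def)
      then have cR: "c \<in> Rn n" using C by auto
      have "N (y + W - c) \<le> 1"
      proof -
        have "y + W - c = (y + W + zb g - a) + (a - ctr i)" by (simp add: c_def)
        then have "N (y + W - c) \<le> N (y + W + zb g - a) + N (a - ctr i)"
          using N_triangle by metis
        then show ?thesis using yW x ctr(2)[OF i(1,3)] by simp
      qed
      then obtain q where q: "q \<in> F c" "N (y + W - q) < \<delta>"
        using F[OF cR] y WR by (meson Rn_add)
      then have qR: "q \<in> Rn n" using F[OF cR] by auto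
      have "q + z1 k \<notin> S" if "k < m" for k
      proof
        assume "q + z1 k \<in> S"
        then have yc: "y + W \<in> shifted_class \<delta> S (z1 k)"
          using q qR y WR by (auto simp: shifted_class_def)
        have "(y + W) + (- W) \<in> shifted_class \<delta> S (z1 k)"
          by (rule shifted_class_periodic[OF S(2) period_lattice_uminus[OF W] yc DR[OF z1(1)[OF that]]])
        then show False using False that by auto
      qed
      then have "q \<in> U c" using q by (auto simp: U_def)
      then obtain k where k: "k < t * J" "q + sh c k \<in> S" using sh cC by blast
      have "y + W \<in> shifted_class \<delta> S (sh c k)"
        using q qR y WR k by (auto simp: shifted_class_def)
      then have "y \<in> BB g k" using cell y unfolding BB_def c_def by blast
      moreover have "(g * M + k) div M = g \<and> (g * M + k) mod M = k" if "k < M" for M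
        using that by auto
      from this[OF k(1)] have "(g * (t * J) + k) div (t * J) = g" "(g * (t * J) + k) mod (t * J) = k"
        by blast+
      moreover have "g * (t * J) + k < G * (t * J)"
        using g(1) k(1) by (metis add_less_cancel_left less_le_trans mult_Suc mult_le_mono1 Suc_leI add.commute)
      ultimately show ?thesis
        by (intro exI[of _ "m + (g * (t * J) + k)"]) (auto simp: B_def)
    qed
  qed
qed

end

section \<open>Convex tilings\<close>

context coord_norm
begin

text \<open>Tiles are indexed by their centres. The last clause expresses disjointness of interiors
  by balls of \<open>N\<close>: no ball of positive radius lies in two different tiles.\<close>

definition convex_tiling :: "real \<Rightarrow> real \<Rightarrow> rvec set \<Rightarrow> (rvec \<Rightarrow> rvec set) \<Rightarrow> bool" where
  "convex_tiling \<alpha> \<beta> \<Phi> \<psi> \<longleftrightarrow> 0 < \<alpha> \<and> \<Phi> \<subseteq> Rn n \<and> Rn n \<subseteq> (\<Union>x\<in>\<Phi>. \<psi> x) \<and>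
     (\<forall>x\<in>\<Phi>. closed (\<psi> x) \<and> convex (\<psi> x) \<and> \<psi> x \<subseteq> Rn n \<and>
        (\<forall>y\<in>Rn n. N (y - x) \<le> \<alpha> \<longrightarrow> y \<in> \<psi> x) \<and> (\<forall>y\<in>\<psi> x. N (y - x) \<le> \<beta>)) \<and>
     (\<forall>x\<in>\<Phi>. \<forall>x'\<in>\<Phi>. \<forall>z\<in>Rn n. \<forall>\<epsilon>>0. nball z \<epsilon> \<subseteq> \<psi> x \<inter> \<psi> x' \<longrightarrow> x = x')"

lemma convex_tilingD:
  assumes "convex_tiling \<alpha> \<beta> \<Phi> \<psi>"
  shows "0 < \<alpha>" and "\<Phi> \<subseteq> Rn n" and "y \<in> Rn n \<Longrightarrow> \<exists>x\<in>\<Phi>. y \<in> \<psi> x"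
    and "x \<in> \<Phi> \<Longrightarrow> closed (\<psi> x)" and "x \<in> \<Phi> \<Longrightarrow> convex (\<psi> x)" and "x \<in> \<Phi> \<Longrightarrow> \<psi> x \<subseteq> Rn n"
    and "x \<in> \<Phi> \<Longrightarrow> y \<in> Rn n \<Longrightarrow> N (y - x) \<le> \<alpha> \<Longrightarrow> y \<in> \<psi> x"
    and "x \<in> \<Phi> \<Longrightarrow> y \<in> \<psi> x \<Longrightarrow> N (y - x) \<le> \<beta>"
    and "x \<in> \<Phi> \<Longrightarrow> x' \<in> \<Phi> \<Longrightarrow> z \<in> Rn n \<Longrightarrow> 0 < \<epsilon> \<Longrightarrow> nball z \<epsilon> \<subseteq> \<psi> x \<inter> \<psi> x' \<Longrightarrow> x = x'"
  using assms by (auto simp: convex_tiling_def)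

text \<open>One tiling is used at two scales, for the fine colour classes and for the coarse
  cells.\<close>

lemma convex_tiling_scale:
  assumes T: "convex_tiling \<alpha> \<beta> \<Phi> \<psi>" and c: "c > 0"
  shows "convex_tiling (c * \<alpha>) (c * \<beta>) ((\<lambda>x. c *\<^sub>R x) ` \<Phi>) (\<lambda>x. {y. (1 / c) *\<^sub>R y \<in> \<psi> ((1 / c) *\<^sub>R x)})"
proof -
  have c': "(1 / c) *\<^sub>R (c *\<^sub>R x) = x" "c *\<^sub>R ((1 / c) *\<^sub>R x) = x" for x :: rvec using c by simp_all
  have N: "N ((1 / c) *\<^sub>R y - x) = N (y - c *\<^sub>R x) / c" for x y
  proof -
    have "(1 / c) *\<^sub>R y - x = (1 / c) *\<^sub>R (y - c *\<^sub>R x)" using c by (simp add: algebra_simps)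
    then show ?thesis using c by (simp add: N_scaleR)
  qed
  have RnI: "y \<in> Rn n" if "(1 / c) *\<^sub>R y \<in> Rn n" for y
    using Rn_scaleR[OF that, of c] c' by simp
  have cl: "closed {y. (1 / c) *\<^sub>R y \<in> \<psi> x}" if "x \<in> \<Phi>" for x
  proof -
    have "closed ((\<lambda>y. (1 / c) *\<^sub>R y) -` \<psi> x)"
      using convex_tilingD(4)[OF T that] by (intro closed_vimage continuous_intros)
    then show ?thesis by (simp add: vimage_def)
  qed
  have cv: "convex {y. (1 / c) *\<^sub>R y \<in> \<psi> x}" if "x \<in> \<Phi>" for x
  proof -
    have "convex ((\<lambda>y. (1 / c) *\<^sub>R y) -` \<psi> x)"
      using convex_tilingD(5)[OF T that] by (intro convex_linear_vimage linear_scaleR)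
    then show ?thesis by (simp add: vimage_def)
  qed
  have disj: "x = x'" if "x \<in> \<Phi>" "x' \<in> \<Phi>" "z \<in> Rn n" "\<epsilon> > 0"
    "nball z \<epsilon> \<subseteq> {y. (1 / c) *\<^sub>R y \<in> \<psi> x} \<inter> {y. (1 / c) *\<^sub>R y \<in> \<psi> x'}" for x x' z \<epsilon>
  proof -
    have "nball ((1 / c) *\<^sub>R z) (\<epsilon> / c) \<subseteq> \<psi> x \<inter> \<psi> x'"
    proof
      fix y assume y: "y \<in> nball ((1 / c) *\<^sub>R z) (\<epsilon> / c)"
      have "y - (1 / c) *\<^sub>R z = (1 / c) *\<^sub>R (c *\<^sub>R y - z)" using c by (simp add: algebra_simps)
      then have "N (y - (1 / c) *\<^sub>R z) = N (c *\<^sub>R y - z) / c" using c by (simp add: N_scaleR)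
      then have "c *\<^sub>R y \<in> nball z \<epsilon>" using y c by (auto simp: nball_def divide_less_cancel)
      then show "y \<in> \<psi> x \<inter> \<psi> x'" using that(5) c' by auto
    qed
    moreover have "(1 / c) *\<^sub>R z \<in> Rn n" "\<epsilon> / c > 0" using that c by auto
    ultimately show ?thesis using convex_tilingD(9)[OF T that(1,2)] by blast
  qed
  show ?thesis
    unfolding convex_tiling_def
  proof (intro conjI ballI allI impI)
    show "Rn n \<subseteq> (\<Union>x\<in>(\<lambda>x. c *\<^sub>R x) ` \<Phi>. {y. (1 / c) *\<^sub>R y \<in> \<psi> ((1 / c) *\<^sub>R x)})"
    proof
      fix y assume "y \<in> Rn n"
      then have "(1 / c) *\<^sub>R y \<in> Rn n" by simp
      then obtain x where "x \<in> \<Phi>" "(1 / c) *\<^sub>R y \<in> \<psi> x" using convex_tilingD(3)[OF T] by blast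
      then show "y \<in> (\<Union>x\<in>(\<lambda>x. c *\<^sub>R x) ` \<Phi>. {y. (1 / c) *\<^sub>R y \<in> \<psi> ((1 / c) *\<^sub>R x)})"
        using c' by auto
    qed
    show "0 < c * \<alpha>" using convex_tilingD(1)[OF T] c by simp
    show "(\<lambda>x. c *\<^sub>R x) ` \<Phi> \<subseteq> Rn n" using convex_tilingD(2)[OF T] by auto
  next
    fix x assume "x \<in> (\<lambda>x. c *\<^sub>R x) ` \<Phi>"
    then obtain x0 where x0: "x0 \<in> \<Phi>" "x = c *\<^sub>R x0" by blast
    have x: "(1 / c) *\<^sub>R x = x0" using x0 c by simp
    show "closed {y. (1 / c) *\<^sub>R y \<in> \<psi> ((1 / c) *\<^sub>R x)}" "convex {y. (1 / c) *\<^sub>R y \<in> \<psi> ((1 / c) *\<^sub>R x)}"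
      unfolding x using x0 cl cv by blast+
    show "{y. (1 / c) *\<^sub>R y \<in> \<psi> ((1 / c) *\<^sub>R x)} \<subseteq> Rn n"
      unfolding x using convex_tilingD(6)[OF T x0(1)] RnI by blast
    show "y \<in> {y. (1 / c) *\<^sub>R y \<in> \<psi> ((1 / c) *\<^sub>R x)}" if "y \<in> Rn n" "N (y - x) \<le> c * \<alpha>" for y
    proof -
      have "N ((1 / c) *\<^sub>R y - x0) \<le> \<alpha>" using that c x0 by (simp add: N divide_le_eq mult.commute)
      then have "(1 / c) *\<^sub>R y \<in> \<psi> x0" using that by (intro convex_tilingD(7)[OF T x0(1)]) auto
      then show ?thesis unfolding x by blast
    qed
    show "N (y - x) \<le> c * \<beta>" if "y \<in> {y. (1 / c) *\<^sub>R y \<in> \<psi> ((1 / c) *\<^sub>R x)}" for y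
    proof -
      have "(1 / c) *\<^sub>R y \<in> \<psi> x0" using that unfolding x by blast
      then have "N ((1 / c) *\<^sub>R y - x0) \<le> \<beta>" by (rule convex_tilingD(8)[OF T x0(1)])
      then show ?thesis using c x0 by (simp add: N divide_le_eq mult.commute)
    qed
    fix x' z \<epsilon> assume x': "x' \<in> (\<lambda>x. c *\<^sub>R x) ` \<Phi>" and z: "z \<in> Rn n" "0 < \<epsilon>"
      "nball z \<epsilon> \<subseteq> {y. (1 / c) *\<^sub>R y \<in> \<psi> ((1 / c) *\<^sub>R x)} \<inter> {y. (1 / c) *\<^sub>R y \<in> \<psi> ((1 / c) *\<^sub>R x')}"
    from x' obtain x0' where x0': "x0' \<in> \<Phi>" "x' = c *\<^sub>R x0'" by blast
    have x'0: "(1 / c) *\<^sub>R x' = x0'" using x0' c by simp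
    have "x0 = x0'" using disj[OF x0(1) x0'(1) z(1,2)] z(3) unfolding x x'0 by blast
    then show "x = x'" using x0 x0' by simp
  qed
qed

definition shrunk_tile :: "(rvec \<Rightarrow> rvec set) \<Rightarrow> real \<Rightarrow> rvec \<Rightarrow> rvec set" where
  "shrunk_tile \<psi> \<rho> x = (\<lambda>y. (1 - \<rho>) *\<^sub>R x + \<rho> *\<^sub>R y) ` \<psi> x"

text \<open>By convexity a tile contains the combination of its inner ball of radius
  \<open>\<alpha>\<close>, weighted by \<open>1 - \<rho>\<close>, with any of its points, weighted
  by \<open>\<rho>\<close>. Hence every point of the shrunk tile has a ball of radius
  \<open>(1 - \<rho>) * \<alpha>\<close> in the tile.\<close>

lemma shrunk_tile_depth:
  assumes T: "convex_tiling \<alpha> \<beta> \<Phi> \<psi>" and \<rho>: "0 < \<rho>" "\<rho> < 1" and x: "x \<in> \<Phi>"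
    and y: "y \<in> shrunk_tile \<psi> \<rho> x" and u: "u \<in> Rn n" "N (u - y) \<le> (1 - \<rho>) * \<alpha>"
  shows "u \<in> \<psi> x"
proof -
  obtain p where p: "p \<in> \<psi> x" "y = (1 - \<rho>) *\<^sub>R x + \<rho> *\<^sub>R p" using y by (auto simp: shrunk_tile_def)
  \<comment> \<open>The solution of
    \<open>(1 - \<rho>) *\<^sub>R q + \<rho> *\<^sub>R p = u\<close>.\<close>
  define q where "q = x + (1 / (1 - \<rho>)) *\<^sub>R (u - y)"
  have R: "x \<in> Rn n" "p \<in> Rn n" using convex_tilingD(2,6)[OF T] x p by blast+
  then have "y \<in> Rn n" using p by simp
  have "q \<in> Rn n" using R u \<open>y \<in> Rn n\<close> by (simp add: q_def)
  moreover have "N (q - x) \<le> \<alpha>"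
    using u \<rho> by (simp add: q_def N_scaleR divide_le_eq mult.commute)
  ultimately have "q \<in> \<psi> x" using convex_tilingD(7)[OF T x] by blast
  moreover have "convex (\<psi> x)" using convex_tilingD(5)[OF T x] .
  ultimately have "(1 - \<rho>) *\<^sub>R q + \<rho> *\<^sub>R p \<in> \<psi> x"
    using p \<rho> by (intro convexD) auto
  moreover have "(1 - \<rho>) *\<^sub>R q + \<rho> *\<^sub>R p = u"
    using \<rho> by (simp add: q_def p scaleR_add_right)
  ultimately show ?thesis by simp
qed

text \<open>Keeping just the tiles that lie in the box makes the shrunk tiles repeatable with period
  \<open>l\<close>; the tiles lost are confined to a margin of the box. Separation comes from depth:
  the midpoint of two points that are too close would be interior to both tiles.\<close>

lemma tiling_cells:
  assumes T: "convex_tiling \<alpha> \<beta> \<Phi> \<psi>" and \<rho>: "0 < \<rho>" "\<rho> < 1" and l: "0 < l" "4 * \<beta> * 3 ^ n \<le> l"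
  shows "\<exists>(I :: rvec set) A. cell_system l I A (2 * (1 - \<rho>) * \<alpha>) \<and>
    (\<forall>x\<in>I. x \<in> Rn n \<and> (\<forall>a\<in>A x. N (a - x) \<le> \<rho> * \<beta>)) \<and>
    \<rho> ^ n * (l - 4 * \<beta> * 3 ^ n) ^ n \<le> measure (vol n) (cell_union l I A \<inter> hbox n 0 l) \<and>
    card I * (\<alpha> ^ n * unit_vol) \<le> l ^ n"
proof -
  have \<alpha>: "\<alpha> > 0" using convex_tilingD(1)[OF T] .
  define I where "I = {x \<in> \<Phi>. \<psi> x \<subseteq> hbox n 0 l}"
  define A where "A = shrunk_tile \<psi> \<rho>"
  have I: "x \<in> \<Phi>" "x \<in> Rn n" "\<psi> x \<subseteq> hbox n 0 l" "closed (\<psi> x)" if "x \<in> I" for x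
    using that convex_tilingD(2,4)[OF T] by (auto simp: I_def)
  have same: "x = x'" if "x \<in> I" "x' \<in> I" "z \<in> Rn n" "\<epsilon> > 0" "nball z \<epsilon> \<subseteq> \<psi> x" "nball z \<epsilon> \<subseteq> \<psi> x'" for x x' z \<epsilon>
    using convex_tilingD(9)[OF T I(1)[OF that(1)] I(1)[OF that(2)] that(3,4)] that(5,6) by blast
  have ball: "nball x \<alpha> \<subseteq> \<psi> x" if "x \<in> I" for x
    using convex_tilingD(7)[OF T I(1)[OF that]] by (auto simp: nball_def)
  have pack: "finite I \<and> card I * (\<alpha> ^ n * unit_vol) \<le> measure (vol n) (hbox n 0 l)"
  proof (rule packing)
    show "nball p \<alpha> \<inter> nball q \<alpha> = {}" if "p \<in> I" "q \<in> I" "p \<noteq> q" for p q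
    proof (rule ccontr)
      assume "nball p \<alpha> \<inter> nball q \<alpha> \<noteq> {}"
      then obtain y where y: "y \<in> Rn n" "N (y - p) < \<alpha>" "N (y - q) < \<alpha>" by (auto simp: nball_def)
      define \<epsilon> where "\<epsilon> = min (\<alpha> - N (y - p)) (\<alpha> - N (y - q))"
      have "N (u - p) < \<alpha> \<and> N (u - q) < \<alpha>" if "N (u - y) < \<epsilon>" for u
        using that N_diff_triangle[of u p y] N_diff_triangle[of u q y] by (auto simp: \<epsilon>_def)
      then have "nball y \<epsilon> \<subseteq> nball p \<alpha>" "nball y \<epsilon> \<subseteq> nball q \<alpha>" by (auto simp: nball_def)
      then have "p = q" using ball that y by (intro same[of p q y \<epsilon>]) (auto simp: \<epsilon>_def)
      with that show False by simp
    qed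
    show "nball p \<alpha> \<subseteq> hbox n 0 l" if "p \<in> I" for p using ball[OF that] I(3)[OF that] by blast
  qed (use \<alpha> I(2) in auto)
  have Aeq: "A x = (\<lambda>y. (1 - \<rho>) *\<^sub>R x + \<rho> *\<^sub>R y) ` \<psi> x" for x by (simp add: A_def shrunk_tile_def)
  have Asub: "A x \<subseteq> \<psi> x" if x: "x \<in> I" for x
  proof
    fix y assume y: "y \<in> A x"
    have "\<psi> x \<subseteq> Rn n" using convex_tilingD(6)[OF T I(1)[OF x]] .
    then have "y \<in> Rn n" using y I(2)[OF x] by (auto simp: Aeq)
    then show "y \<in> \<psi> x"
      using y \<rho> \<alpha> by (intro shrunk_tile_depth[OF T \<rho> I(1)[OF x], of y]) (auto simp: A_def)
  qed
  have bor: "A x \<in> sets borel" "\<psi> x \<in> sets borel" if "x \<in> I" for x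
    unfolding Aeq using I(4)[OF that] \<rho> by (auto intro!: borel_affine_image)
  have sep: "2 * (1 - \<rho>) * \<alpha> \<le> N (a + w - b)"
    if x: "x \<in> I" "x' \<in> I" and w: "w \<in> period_lattice n l" and ne: "x \<noteq> x' \<or> w \<noteq> 0"
      and ab: "a \<in> A x" "b \<in> A x'" for x x' w a b
  proof (rule ccontr)
    assume neg: "\<not> ?thesis"
    have wR: "w \<in> Rn n" using w by (rule period_lattice_Rn)
    have R: "a \<in> Rn n" "b \<in> Rn n" using ab Asub I(3) x by (auto simp: hbox_def)
    \<comment> \<open>The midpoint is at distance \<open>N (a + w - b) / 2\<close> from both points,
      hence \<open>\<epsilon>\<close> is the depth left there in each of the two tiles.\<close>
    define z where "z = (1 / 2) *\<^sub>R (a + w + b)"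
    define \<epsilon> where "\<epsilon> = (1 - \<rho>) * \<alpha> - N (a + w - b) / 2"
    have \<epsilon>: "\<epsilon> > 0" using neg by (simp add: \<epsilon>_def algebra_simps)
    have zR: "z \<in> Rn n" using R wR by (simp add: z_def)
    have "z - w - a = (1 / 2) *\<^sub>R (b - (a + w))"
    proof -
      have "2 *\<^sub>R (z - w - a) = (a + w + b) - 2 *\<^sub>R w - 2 *\<^sub>R a" by (simp add: z_def scaleR_diff_right)
      also have "\<dots> = 2 *\<^sub>R ((1 / 2) *\<^sub>R (b - (a + w)))" by (simp add: scaleR_2)
      finally show ?thesis by (rule scaleR_left_imp_eq[rotated]) simp
    qed
    then have za: "N (z - w - a) = N (a + w - b) / 2"
      using N_minus_commute[of b "a + w"] by (simp add: N_scaleR)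
    have "z - b = (1 / 2) *\<^sub>R (a + w - b)"
    proof -
      have "2 *\<^sub>R (z - b) = (a + w + b) - 2 *\<^sub>R b" by (simp add: z_def scaleR_diff_right)
      also have "\<dots> = 2 *\<^sub>R ((1 / 2) *\<^sub>R (a + w - b))" by (simp add: scaleR_2)
      finally show ?thesis by (rule scaleR_left_imp_eq[rotated]) simp
    qed
    then have zb: "N (z - b) = N (a + w - b) / 2" by (simp add: N_scaleR)
    have in1: "u - w \<in> \<psi> x" and in2: "u \<in> \<psi> x'" if u: "u \<in> Rn n" "N (u - z) < \<epsilon>" for u
    proof -
      have "N (u - w - a) \<le> N (u - z) + N (z - w - a)"
        using N_diff_triangle[of u "w + a" z] by (simp only: diff_diff_eq)
      then show "u - w \<in> \<psi> x"
        using u za ab wR by (intro shrunk_tile_depth[OF T \<rho> I(1)[OF x(1)], of a]) (auto simp: A_def \<epsilon>_def)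
      have "N (u - b) \<le> N (u - z) + N (z - b)" by (rule N_diff_triangle)
      then show "u \<in> \<psi> x'"
        using u zb ab by (intro shrunk_tile_depth[OF T \<rho> I(1)[OF x(2)], of b]) (auto simp: A_def \<epsilon>_def)
    qed
    have "z - w \<in> \<psi> x" "z \<in> \<psi> x'" using in1[OF zR] in2[OF zR] \<epsilon> by auto
    \<comment> \<open>Two points of the same orbit in the half-open box coincide; so different
      periods cannot meet, and the case of two tiles of one period remains.\<close>
    then have "z + (- w) \<in> hbox n 0 l" "z + 0 \<in> hbox n 0 l" using I(3) x by auto
    then have "- w = 0" using period_unique[OF l(1)] w by (meson period_lattice_uminus period_lattice_zero)
    then have w0: "w = 0" by simp
    have "nball z \<epsilon> \<subseteq> \<psi> x" "nball z \<epsilon> \<subseteq> \<psi> x'" using in1 in2 w0 by (auto simp: nball_def)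
    then have "x = x'" using same[OF x zR \<epsilon>] by blast
    with ne w0 show False by simp
  qed
  have cs: "cell_system l I A (2 * (1 - \<rho>) * \<alpha>)"
    unfolding cell_system_def
  proof (intro conjI ballI impI)
    show "A x \<subseteq> hbox n 0 l" if "x \<in> I" for x using Asub I(3) that by blast
  qed (use pack \<rho> \<alpha> bor sep in auto)
  have dist: "N (a - x) \<le> \<rho> * \<beta>" if x: "x \<in> I" and a: "a \<in> A x" for x a
  proof -
    obtain y where y: "y \<in> \<psi> x" "a = (1 - \<rho>) *\<^sub>R x + \<rho> *\<^sub>R y" using a by (auto simp: Aeq)
    have "a - x = \<rho> *\<^sub>R (y - x)" using y by (simp add: algebra_simps)
    moreover have "N (y - x) \<le> \<beta>" using convex_tilingD(8)[OF T I(1)[OF x]] y by blast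
    ultimately show ?thesis using \<rho> by (simp add: N_scaleR)
  qed
  \<comment> \<open>A tile has diameter at most \<open>2 * \<beta>\<close> in \<open>N\<close>,
    hence extent at most \<open>?o\<close> in each coordinate; every tile that meets the box reduced
    by this margin lies in the full box.\<close>
  let ?o = "2 * \<beta> * 3 ^ n"
  have "hbox n ?o (l - ?o) \<subseteq> (\<Union>x\<in>I. \<psi> x)"
  proof
    fix y assume y: "y \<in> hbox n ?o (l - ?o)"
    then have "y \<in> Rn n" by (simp add: hbox_def)
    then obtain x where x: "x \<in> \<Phi>" "y \<in> \<psi> x" using convex_tilingD(3)[OF T] by blast
    have "\<psi> x \<subseteq> hbox n 0 l"
    proof
      fix u assume u: "u \<in> \<psi> x"
      have "N (u - x) \<le> \<beta>" "N (y - x) \<le> \<beta>" using convex_tilingD(8)[OF T x(1)] x u by blast+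
      then have uy: "N (u - y) \<le> 2 * \<beta>"
        using N_diff_triangle[of u y x] N_minus_commute[of x y] by simp
      have "0 \<le> coord u i \<and> coord u i < l" if i: "i < n" for i
      proof -
        have "\<bar>coord (u - y) i\<bar> \<le> 3 ^ n * N (u - y)" by (rule N_lower[OF i])
        also have "\<dots> \<le> 3 ^ n * (2 * \<beta>)" using uy by simp
        finally have "\<bar>coord u i - coord y i\<bar> \<le> ?o" by (simp add: lookup_minus mult_ac)
        moreover have "?o \<le> coord y i" "coord y i < l - ?o" using y i by (auto simp: hbox_def)
        ultimately show ?thesis by linarith
      qed
      moreover have "u \<in> Rn n" using convex_tilingD(6)[OF T x(1)] u by blast
      ultimately show "u \<in> hbox n 0 l" by (simp add: hbox_def)
    qed
    then show "y \<in> (\<Union>x\<in>I. \<psi> x)" using x by (auto simp: I_def)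
  qed
  then have "measure (vol n) (hbox n ?o (l - ?o)) \<le> measure (vol n) (\<Union>x\<in>I. \<psi> x)"
  proof (rule measure_mono_fmeasurable)
    have "(\<Union>x\<in>I. \<psi> x) \<in> sets borel" using pack bor by (intro sets.finite_UN) auto
    moreover have "(\<Union>x\<in>I. \<psi> x) \<subseteq> hbox n 0 l" using I(3) by (rule UN_least)
    ultimately show "(\<Union>x\<in>I. \<psi> x) \<in> fmeasurable (vol n)" by (rule fmeasurable_if_subset_hbox)
  qed simp
  also have "\<dots> \<le> (\<Sum>x\<in>I. measure (vol n) (\<psi> x))"
    using pack bor by (intro measure_UNION_le) auto
  finally have "(l - 4 * \<beta> * 3 ^ n) ^ n \<le> (\<Sum>x\<in>I. measure (vol n) (\<psi> x))"
    using l by (subst (asm) measure_hbox) (auto simp: mult.assoc)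
  then have "\<rho> ^ n * (l - 4 * \<beta> * 3 ^ n) ^ n \<le> \<rho> ^ n * (\<Sum>x\<in>I. measure (vol n) (\<psi> x))"
    using \<rho> by (intro mult_left_mono) auto
  also have "\<dots> = (\<Sum>x\<in>I. measure (vol n) (A x))"
    using \<rho> I(2) bor by (auto simp: Aeq sum_distrib_left measure_vol_affine_image intro!: sum.cong)
  also have "\<dots> \<le> measure (vol n) (cell_union l I A \<inter> hbox n 0 l)"
    by (rule measure_cell_union[OF cs])
  finally have dens: "\<rho> ^ n * (l - 4 * \<beta> * 3 ^ n) ^ n \<le> measure (vol n) (cell_union l I A \<inter> hbox n 0 l)" .
  have "card I * (\<alpha> ^ n * unit_vol) \<le> l ^ n" using pack l by (simp add: measure_hbox)
  with cs dens I(2) dist show ?thesis by blast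
qed

section \<open>Nets of boxes and of balls\<close>

lemma hbox_net:
  fixes d l :: real
  assumes d: "0 < d" "d \<le> 1" and l: "3 ^ n \<le> l"
  obtains X where "finite X" "X \<subseteq> Rn n" "card X \<le> (4 * l * n / d) ^ n"
    "\<And>y. y \<in> hbox n 0 l \<Longrightarrow> \<exists>x\<in>X. N (y - x) < d"
proof -
  let ?B = "hbox n (0 - 3 ^ n * (d / 2)) (l + 3 ^ n * (d / 2))"
  obtain X where X: "finite X" "X \<subseteq> hbox n 0 l" "card X * ((d / 2) ^ n * unit_vol) \<le> measure (vol n) ?B"
    "\<And>y. y \<in> hbox n 0 l \<Longrightarrow> \<exists>x\<in>X. N (y - x) < d"
  proof (rule separated_net[of "hbox n 0 l" d ?B])
    show "nball p (d / 2) \<subseteq> ?B" if "p \<in> hbox n 0 l" for p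
      by (rule nball_subset_hbox[OF that])
    show "hbox n 0 l \<subseteq> Rn n" by (auto simp: hbox_def)
  qed (use d in auto)
  have n0: "real n > 0" using n_pos by simp
  have "0 < (3::real) ^ n" by simp
  then have l0: "l > 0" using l by linarith
  have d3: "3 ^ n * d \<le> 3 ^ n * 1" using d by (intro mult_left_mono) auto
  have "0 \<le> 3 ^ n * (d / 2)" using d by simp
  then have "measure (vol n) ?B = (l + 3 ^ n * (d / 2) - (0 - 3 ^ n * (d / 2))) ^ n"
    using l0 by (intro measure_hbox) linarith
  also have "\<dots> = (l + 3 ^ n * d) ^ n" by (simp add: add.commute mult.commute)
  also have "\<dots> \<le> (2 * l) ^ n"
  proof (rule power_mono)
    show "l + 3 ^ n * d \<le> 2 * l" using d3 l by linarith
    show "0 \<le> l + 3 ^ n * d" using d l0 by simp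
  qed
  finally have "card X * ((d / 2) ^ n * unit_vol) \<le> (2 * l) ^ n" using X(3) by linarith
  moreover have "card X * ((d / 2) ^ n * (1 / n) ^ n) \<le> card X * ((d / 2) ^ n * unit_vol)"
    using d unit_vol_lower by (intro mult_left_mono) auto
  ultimately have "card X * ((d / 2) * (1 / n)) ^ n \<le> (2 * l) ^ n"
    unfolding power_mult_distrib[of "d / 2"] by linarith
  moreover have "((d / 2) * (1 / n)) ^ n > 0" using d n0 by simp
  ultimately have "card X \<le> (2 * l) ^ n / ((d / 2) * (1 / n)) ^ n"
    by (simp add: pos_le_divide_eq)
  also have "\<dots> = ((2 * l) / ((d / 2) * (1 / n))) ^ n"
    by (simp only: power_divide)
  also have "(2 * l) / ((d / 2) * (1 / n)) = 4 * l * n / d"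
    using d n0 by (simp add: field_simps)
  finally have "card X \<le> (4 * l * n / d) ^ n" .
  with X show ?thesis by (intro that[of X]) (auto simp: hbox_def)
qed

text \<open>Balls are compared with balls, so \<open>unit_vol\<close> cancels and no factor
  \<open>n ^ n\<close> appears. This matters because the logarithm of this cardinality is the
  leading term of the final bound.\<close>

lemma ball_net:
  fixes d :: real
  assumes d: "0 < d" and c: "c \<in> Rn n"
  shows "\<exists>F. finite F \<and> F \<subseteq> Rn n \<and> card F \<le> nat \<lfloor>(2 / d + 1) ^ n\<rfloor> \<and>
     (\<forall>y\<in>Rn n. N (y - c) \<le> 1 \<longrightarrow> (\<exists>q\<in>F. N (y - q) < d))"
proof -
  let ?Z = "{y \<in> Rn n. N (y - c) \<le> 1}"
  obtain F where F: "finite F" "F \<subseteq> ?Z" "card F * ((d / 2) ^ n * unit_vol) \<le> measure (vol n) (nball c (1 + d / 2))"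
    "\<And>y. y \<in> ?Z \<Longrightarrow> \<exists>q\<in>F. N (y - q) < d"
  proof (rule separated_net[of ?Z d "nball c (1 + d / 2)"])
    show "nball p (d / 2) \<subseteq> nball c (1 + d / 2)" if "p \<in> ?Z" for p
    proof
      fix y assume "y \<in> nball p (d / 2)"
      then show "y \<in> nball c (1 + d / 2)"
        using that N_diff_triangle[of y c p] by (auto simp: nball_def)
    qed
  qed (use d c in auto)
  have "card F * (d / 2) ^ n * unit_vol \<le> (1 + d / 2) ^ n * unit_vol"
    using F(3) d c by (simp add: measure_nball mult_ac)
  then have "card F * (d / 2) ^ n \<le> (1 + d / 2) ^ n"
    using unit_vol_pos by simp
  then have "card F \<le> (1 + d / 2) ^ n / (d / 2) ^ n"
    using d by (simp add: pos_le_divide_eq)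
  also have "\<dots> = ((1 + d / 2) / (d / 2)) ^ n"
    by (simp only: power_divide)
  also have "(1 + d / 2) / (d / 2) = 2 / d + 1"
    using d by (simp add: field_simps)
  finally have "card F \<le> nat \<lfloor>(2 / d + 1) ^ n\<rfloor>" by (simp add: le_nat_floor)
  then show ?thesis using F by (intro exI[of _ F]) auto
qed

end

section \<open>Colourings from a tiling and from a separated set\<close>

context coord_norm
begin

text \<open>By Bernoulli's inequality a total margin \<open>q\<close> costs at most the fraction
  \<open>n * q / l \<le> 1 / n\<close> of the volume.\<close>

lemma period_density:
  fixes l q :: real
  assumes l: "l > 0" and q: "0 \<le> q" "n * n * q \<le> l"
  shows "(1 - 1 / n) * l ^ n \<le> (l - q) ^ n"
proof -
  have n0: "real n > 0" using n_pos by simp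
  have "1 * q \<le> n * n * q" using q n_pos by (intro mult_right_mono) (auto simp: mult_ge1_I)
  then have "q \<le> l" using q by linarith
  then have "1 + real n * (- (q / l)) \<le> (1 + (- (q / l))) ^ n"
    using l by (intro Bernoulli_inequality) (simp add: field_simps)
  moreover have "real n * (q / l) \<le> 1 / n"
    using q l n0 by (simp add: field_simps)
  ultimately have "1 - 1 / n \<le> (1 - q / l) ^ n" by simp
  then have "(1 - 1 / n) * l ^ n \<le> (1 - q / l) ^ n * l ^ n"
    using l by (intro mult_right_mono) auto
  also have "\<dots> = (l - q) ^ n"
    using l by (simp add: power_mult_distrib[symmetric] algebra_simps)
  finally show ?thesis .
qed

lemma card_le_if_packing:
  fixes a k l :: real
  assumes "a > 0" "k * (a ^ n * unit_vol) \<le> l ^ n" "l > 0" "k \<ge> 0"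
  shows "k \<le> (l * n / a) ^ n"
proof -
  have n0: "real n > 0" using n_pos by simp
  have "k * (a ^ n * (1 / n) ^ n) \<le> k * (a ^ n * unit_vol)"
    using assms unit_vol_lower by (intro mult_left_mono) auto
  then have "k * (a * (1 / n)) ^ n \<le> l ^ n"
    unfolding power_mult_distrib[of a] using assms(2) by linarith
  moreover have "(a * (1 / n)) ^ n > 0" using assms n0 by simp
  ultimately have "k \<le> l ^ n / (a * (1 / n)) ^ n"
    by (simp add: pos_le_divide_eq)
  also have "\<dots> = (l / (a * (1 / n))) ^ n"
    by (simp only: power_divide)
  also have "l / (a * (1 / n)) = l * n / a"
    using assms n0 by (simp add: field_simps)
  finally show ?thesis .
qed

text \<open>\<open>\<eta>\<close> is an additional shrinking of the tiles beyond
  \<open>1 / (1 + \<gamma>)\<close>; it opens the gap around the distance 1 that the net of mesh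
  \<open>\<delta>\<close> consumes.\<close>

lemma tiling_colorable:
  fixes m G t J b :: nat and \<tau> \<eta> \<gamma> l :: real
  assumes T: "convex_tiling \<alpha> \<beta> \<Phi> \<psi>" and \<beta>: "\<beta> = \<gamma> * \<alpha>" and \<gamma>: "1 \<le> \<gamma>" "\<gamma> \<le> 8"
    and n: "n \<ge> 2" and \<eta>: "0 < \<eta>" "\<eta> < 1"
    and l_def: "l = 30 * real n ^ 2 * 3 ^ n" and b_def: "b = nat \<lfloor>(4 * \<gamma> / \<eta> + 1) ^ n\<rfloor>"
    and G: "(80 * l * n) ^ n < exp ((6 / (5 * (1 + \<gamma>))) ^ n * (1 - 1 / n) * G)"
    and t: "t \<ge> 1" and \<tau>: "0 < \<tau>" "t * \<tau> < 1"
    and m: "(2 * l * n) ^ n * G * b ^ t < exp (t * (1 - t * \<tau>) * (((1 - \<eta>) / (1 + \<gamma>)) ^ n * (1 - 1 / n)) * m)"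
    and J: "b < exp (\<tau> * J)"
  shows "colorable (m + G * (t * J))"
proof -
  have \<alpha>: "\<alpha> > 0" using T by (simp add: convex_tiling_def)
  have n0: "real n \<ge> 2" using n by simp
  have l0: "l > 0" using n0 by (simp add: l_def)
  have l3: "3 ^ n \<le> l"
  proof -
    have "1 \<le> real n ^ 2" using n0 by (intro one_le_power) simp
    then have "1 \<le> 30 * real n ^ 2" by linarith
    then have "1 * 3 ^ n \<le> 30 * real n ^ 2 * 3 ^ n" by (intro mult_right_mono) auto
    then show ?thesis by (simp add: l_def)
  qed
  \<comment> \<open>\<open>63 / 10\<close> bounds the outer radius of the tiles at both scales; the
    second scale reaches it at \<open>\<gamma> = 8\<close>. The constant 30 in \<open>l\<close>
    exceeds \<open>4 * 63 / 10\<close>.\<close>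
  have big: "4 * B * 3 ^ n \<le> l \<and> n * n * (4 * B * 3 ^ n) \<le> l" if "0 \<le> B" "B \<le> 63 / 10" for B :: real
  proof -
    have "n * n * (4 * B * 3 ^ n) = (4 * B) * (real n ^ 2 * 3 ^ n)" by (simp add: power2_eq_square)
    also have "\<dots> \<le> 30 * (real n ^ 2 * 3 ^ n)" using that by (intro mult_right_mono) auto
    finally have 1: "n * n * (4 * B * 3 ^ n) \<le> l" by (simp add: l_def)
    have "1 * (4 * B * 3 ^ n) \<le> (n * n) * (4 * B * 3 ^ n)"
      using that n by (intro mult_right_mono) (auto simp: mult_ge1_I)
    with 1 show ?thesis by simp
  qed

  \<comment> \<open>At this scale the tiles shrunk by \<open>\<rho>\<close> have diameter at most
    \<open>1 - \<eta>\<close> and mutual distance at least \<open>1 + \<eta> / \<gamma>\<close>. The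
    second gap is the smaller one, and \<open>\<delta>\<close> is half of it.\<close>
  define c1 where "c1 = (1 + \<gamma>) / (2 * \<gamma> * \<alpha>)"
  have c1: "c1 > 0" "c1 * \<alpha> = (1 + \<gamma>) / (2 * \<gamma>)" "c1 * \<beta> = (1 + \<gamma>) / 2"
    using \<alpha> \<gamma> by (auto simp: c1_def \<beta>)
  note T1 = convex_tiling_scale[OF T c1(1), unfolded c1(2,3)]
  define \<rho> where "\<rho> = (1 - \<eta>) / (1 + \<gamma>)"
  have \<rho>: "0 < \<rho>" "\<rho> < 1" using \<eta> \<gamma> by (auto simp: \<rho>_def)
  have B1: "0 \<le> (1 + \<gamma>) / 2" "(1 + \<gamma>) / 2 \<le> 63 / 10" using \<gamma> by auto
  define \<delta> where "\<delta> = \<eta> / (2 * \<gamma>)"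
  have \<delta>: "\<delta> > 0" using \<eta> \<gamma> by (simp add: \<delta>_def)
  obtain I A where XIA: "cell_system l I A (2 * (1 - \<rho>) * ((1 + \<gamma>) / (2 * \<gamma>))) \<and>
    (\<forall>x\<in>I. x \<in> Rn n \<and> (\<forall>a\<in>A x. N (a - x) \<le> \<rho> * ((1 + \<gamma>) / 2))) \<and>
    \<rho> ^ n * (l - 4 * ((1 + \<gamma>) / 2) * 3 ^ n) ^ n \<le> measure (vol n) (cell_union l I A \<inter> hbox n 0 l) \<and>
    card I * (((1 + \<gamma>) / (2 * \<gamma>)) ^ n * unit_vol) \<le> l ^ n"
    using tiling_cells[OF T1 \<rho> l0 big[OF B1, THEN conjunct1]] by (elim exE)
  have IA: "cell_system l I A (2 * (1 - \<rho>) * ((1 + \<gamma>) / (2 * \<gamma>)))"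
    "\<And>x. x \<in> I \<Longrightarrow> x \<in> Rn n" "\<And>x a. x \<in> I \<Longrightarrow> a \<in> A x \<Longrightarrow> N (a - x) \<le> \<rho> * ((1 + \<gamma>) / 2)"
    "\<rho> ^ n * (l - 4 * ((1 + \<gamma>) / 2) * 3 ^ n) ^ n \<le> measure (vol n) (cell_union l I A \<inter> hbox n 0 l)"
    "card I * (((1 + \<gamma>) / (2 * \<gamma>)) ^ n * unit_vol) \<le> l ^ n"
    using XIA by simp_all
  have sep1: "2 * (1 - \<rho>) * ((1 + \<gamma>) / (2 * \<gamma>)) = 1 + 2 * \<delta>"
  proof -
    have g: "1 + \<gamma> \<noteq> 0" "\<gamma> \<noteq> 0" using \<gamma> by auto
    have gen: "2 * (u / s) * (s / (2 * \<gamma>)) = u / \<gamma>" if "s \<noteq> 0" for u s :: real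
      using that g by (simp add: field_simps)
    have "1 - \<rho> = (\<gamma> + \<eta>) / (1 + \<gamma>)" using g by (simp add: \<rho>_def field_simps)
    then have "2 * (1 - \<rho>) * ((1 + \<gamma>) / (2 * \<gamma>)) = (\<gamma> + \<eta>) / \<gamma>"
      using gen[OF g(1), of "\<gamma> + \<eta>"] by simp
    then show ?thesis using g by (simp add: \<delta>_def add_divide_distrib)
  qed
  have gap: "gap_set \<delta> (cell_union l I A)"
  proof (rule gap_set_cell_union[OF IA(1)])
    fix x a a' assume "x \<in> I" "a \<in> A x" "a' \<in> A x"
    then have "N (a - a') \<le> 2 * (\<rho> * ((1 + \<gamma>) / 2))"
      using IA(3)[of x a] IA(3)[of x a'] N_diff_triangle[of a a' x] N_minus_commute[of x a'] by linarith
    also have "\<dots> = 1 - \<eta>" using \<gamma> by (simp add: \<rho>_def field_simps)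
    also have "\<dots> \<le> 1 - 2 * \<delta>" using \<gamma> \<eta> by (simp add: \<delta>_def field_simps)
    finally show "N (a - a') \<le> 1 - 2 * \<delta>" .
  qed (simp only: sep1)
  have dens1: "(\<rho> ^ n * (1 - 1 / n)) * l ^ n \<le> measure (vol n) (cell_union l I A \<inter> hbox n 0 l)"
  proof -
    have "(1 - 1 / n) * l ^ n \<le> (l - 4 * ((1 + \<gamma>) / 2) * 3 ^ n) ^ n"
      using big[OF B1] B1 by (intro period_density l0) auto
    then have "\<rho> ^ n * ((1 - 1 / n) * l ^ n) \<le> \<rho> ^ n * (l - 4 * ((1 + \<gamma>) / 2) * 3 ^ n) ^ n"
      using \<rho> by (intro mult_left_mono) auto
    with IA(4) show ?thesis by (simp add: mult.assoc)
  qed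

  \<comment> \<open>The coarse cells need radius, not diameter, below 1, so a factor
    \<open>\<theta>\<close> that is \<open>6 / 5\<close> times larger is possible. At this scale the
    radius is at most \<open>84 / 100\<close> and the distance at least
    \<open>7 / 5 * (1 - 1 / (5 * \<gamma>)) \<ge> 112 / 100\<close>.\<close>
  define c2 where "c2 = 7 * (1 + \<gamma>) / (10 * \<gamma> * \<alpha>)"
  have c2: "c2 > 0" "c2 * \<alpha> = 7 * (1 + \<gamma>) / (10 * \<gamma>)" "c2 * \<beta> = 7 * (1 + \<gamma>) / 10"
    using \<alpha> \<gamma> by (auto simp: c2_def \<beta>)
  note T2 = convex_tiling_scale[OF T c2(1), unfolded c2(2,3)]
  define \<theta> where "\<theta> = 6 / (5 * (1 + \<gamma>))"
  have \<theta>: "0 < \<theta>" "\<theta> < 1" using \<gamma> by (auto simp: \<theta>_def)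
  have B2: "0 \<le> 7 * (1 + \<gamma>) / 10" "7 * (1 + \<gamma>) / 10 \<le> 63 / 10" using \<gamma> by auto
  obtain I' A' where XIA': "cell_system l I' A' (2 * (1 - \<theta>) * (7 * (1 + \<gamma>) / (10 * \<gamma>))) \<and>
    (\<forall>x\<in>I'. x \<in> Rn n \<and> (\<forall>a\<in>A' x. N (a - x) \<le> \<theta> * (7 * (1 + \<gamma>) / 10))) \<and>
    \<theta> ^ n * (l - 4 * (7 * (1 + \<gamma>) / 10) * 3 ^ n) ^ n \<le> measure (vol n) (cell_union l I' A' \<inter> hbox n 0 l) \<and>
    card I' * ((7 * (1 + \<gamma>) / (10 * \<gamma>)) ^ n * unit_vol) \<le> l ^ n"
    using tiling_cells[OF T2 \<theta> l0 big[OF B2, THEN conjunct1]] by (elim exE)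
  have IA': "cell_system l I' A' (2 * (1 - \<theta>) * (7 * (1 + \<gamma>) / (10 * \<gamma>)))"
    "\<And>x. x \<in> I' \<Longrightarrow> x \<in> Rn n" "\<And>x a. x \<in> I' \<Longrightarrow> a \<in> A' x \<Longrightarrow> N (a - x) \<le> \<theta> * (7 * (1 + \<gamma>) / 10)"
    "\<theta> ^ n * (l - 4 * (7 * (1 + \<gamma>) / 10) * 3 ^ n) ^ n \<le> measure (vol n) (cell_union l I' A' \<inter> hbox n 0 l)"
    "card I' * ((7 * (1 + \<gamma>) / (10 * \<gamma>)) ^ n * unit_vol) \<le> l ^ n"
    using XIA' by simp_all
  have dens2: "(\<theta> ^ n * (1 - 1 / n)) * l ^ n \<le> measure (vol n) (cell_union l I' A' \<inter> hbox n 0 l)"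
  proof -
    have "(1 - 1 / n) * l ^ n \<le> (l - 4 * (7 * (1 + \<gamma>) / 10) * 3 ^ n) ^ n"
      using big[OF B2] B2 by (intro period_density l0) auto
    then have "\<theta> ^ n * ((1 - 1 / n) * l ^ n) \<le> \<theta> ^ n * (l - 4 * (7 * (1 + \<gamma>) / 10) * 3 ^ n) ^ n"
      using \<theta> by (intro mult_left_mono) auto
    with IA'(4) show ?thesis by (simp add: mult.assoc)
  qed
  have cardI': "card I' \<le> (2 * l * n) ^ n"
  proof -
    have a: "7 * (1 + \<gamma>) / (10 * \<gamma>) \<ge> 1 / 2" "7 * (1 + \<gamma>) / (10 * \<gamma>) > 0" using \<gamma> by (auto simp: field_simps)
    have "card I' \<le> (l * n / (7 * (1 + \<gamma>) / (10 * \<gamma>))) ^ n"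
      by (rule card_le_if_packing[OF a(2) IA'(5) l0]) simp
    also have "\<dots> \<le> (l * n / (1 / 2)) ^ n"
    proof (rule power_mono)
      show "l * n / (7 * (1 + \<gamma>) / (10 * \<gamma>)) \<le> l * n / (1 / 2)"
        using a l0 by (intro divide_left_mono) auto
      show "0 \<le> l * n / (7 * (1 + \<gamma>) / (10 * \<gamma>))" using a(2) l0 by (intro divide_nonneg_pos) auto
    qed
    finally show ?thesis by (simp add: mult_ac)
  qed

  \<comment> \<open>The mesh \<open>1 / 20\<close> fits both margins:
    \<open>84 / 100 + 1 / 20 \<le> 1\<close> and \<open>112 / 100 > 1 + 2 / 20\<close>.\<close>
  have d20: "0 < (1::real) / 20" "(1::real) / 20 \<le> 1" by auto
  obtain X where X: "finite X" "X \<subseteq> Rn n" "card X \<le> (4 * l * n / (1 / 20)) ^ n"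
    "\<And>y. y \<in> hbox n 0 l \<Longrightarrow> \<exists>x\<in>X. N (y - x) < 1 / 20"
    using hbox_net[OF d20 l3] by metis
  have np: "0 < 1 - 1 / real n" using n0 by (simp add: field_simps)
  show ?thesis
  proof (rule colorable_main[OF l0 cell_union_borel[OF IA(1)] cell_union_periodic gap \<delta> dens1 _ IA'(1) _ IA'(2) _ dens2 _ X(1,2) _ X(4)])
    show "0 < \<rho> ^ n * (1 - 1 / n)" "0 < \<theta> ^ n * (1 - 1 / n)" using \<rho> \<theta> np by auto
    show "1 + 2 * (1 / 20) < 2 * (1 - \<theta>) * (7 * (1 + \<gamma>) / (10 * \<gamma>))"
    proof -
      have g: "1 + \<gamma> \<noteq> 0" "\<gamma> \<noteq> 0" using \<gamma> by auto
      have gen: "2 * (u / s) * (7 * s / (10 * \<gamma>)) = 7 * u / (5 * \<gamma>)" if "s \<noteq> 0" for u s :: real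
        using that g by (simp add: field_simps)
      have "1 - \<theta> = (\<gamma> - 1 / 5) / (1 + \<gamma>)" using g by (simp add: \<theta>_def field_simps)
      then have "2 * (1 - \<theta>) * (7 * (1 + \<gamma>) / (10 * \<gamma>)) = 7 * (\<gamma> - 1 / 5) / (5 * \<gamma>)"
        using gen[OF g(1), of "\<gamma> - 1 / 5"] by simp
      also have "\<dots> > 1 + 2 * (1 / 20)" using \<gamma> by (simp add: field_simps)
      finally show ?thesis .
    qed
    show "N (a - i) \<le> 1 - 1 / 20" if "i \<in> I'" "a \<in> A' i" for i a
    proof -
      have "\<theta> * (7 * (1 + \<gamma>) / 10) = 84 / 100" using \<gamma> by (simp add: \<theta>_def field_simps)
      then show ?thesis using IA'(3)[OF that] by simp
    qed
    show "card X < exp (\<theta> ^ n * (1 - 1 / n) * G)"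
      using X(3) G by (simp add: \<theta>_def mult_ac)
    show "\<exists>F. finite F \<and> F \<subseteq> Rn n \<and> card F \<le> b \<and> (\<forall>y\<in>Rn n. N (y - c) \<le> 1 \<longrightarrow> (\<exists>q\<in>F. N (y - q) < \<delta>))"
      if "c \<in> Rn n" for c
    proof -
      have "2 / \<delta> + 1 = 4 * \<gamma> / \<eta> + 1" using \<gamma> \<eta> by (simp add: \<delta>_def)
      then show ?thesis using ball_net[OF \<delta> that] by (simp add: b_def)
    qed
    have "card I' * G * b ^ t \<le> (2 * l * n) ^ n * G * b ^ t"
      unfolding of_nat_mult using cardI' by (intro mult_right_mono) auto
    also note m
    finally show "real (card I' * G * b ^ t) < exp (t * (1 - t * \<tau>) * (\<rho> ^ n * (1 - 1 / n)) * m)"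
      by (simp add: \<rho>_def)
  qed (use t \<tau> J in auto)
qed

text \<open>Balls of radius \<open>2 / 5\<close> around a maximal 2-separated set have diameter at
  most \<open>4 / 5\<close> and distance at least \<open>6 / 5\<close>. Balls of radius 2 around the
  same points cover the reduced box, so the density is at least \<open>(1 / 5) ^ n\<close> up to the
  factor \<open>1 - 1 / n\<close>.\<close>

lemma trivial_colorable:
  fixes m :: nat and l :: real
  assumes n: "n \<ge> 2" and l_def: "l = 30 * real n ^ 2 * 3 ^ n"
    and m: "(40 * l * n) ^ n < exp ((1 / 5) ^ n * (1 - 1 / n) * m)"
  shows "colorable m"
proof -
  have n0: "real n \<ge> 2" using n by simp
  have l0: "l > 0" using n0 by (simp add: l_def)
  have np: "0 < 1 - 1 / real n" using n0 by (simp add: field_simps)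
  \<comment> \<open>The margin to the faces of the box: a point and a periodic copy of another one
    then differ by at least \<open>4 * 3 ^ n\<close> in some coordinate, hence by at least 4 in
    \<open>N\<close>.\<close>
  let ?o = "2 * 3 ^ n :: real"
  have lo: "n * n * (2 * ?o) \<le> l"
  proof -
    have "real n * n * (2 * ?o) = 4 * (real n ^ 2 * 3 ^ n)" by (simp add: power2_eq_square)
    also have "\<dots> \<le> 30 * (real n ^ 2 * 3 ^ n)" by (intro mult_right_mono) auto
    finally show ?thesis by (simp add: l_def)
  qed
  have l4: "2 * ?o \<le> l"
  proof -
    have "1 * (2 * ?o) \<le> (real n * n) * (2 * ?o)"
      using n0 by (intro mult_right_mono) (auto simp: mult_ge1_I)
    then have "2 * ?o \<le> n * n * (2 * ?o)" by simp
    with lo show ?thesis by (rule order_trans[rotated])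
  qed
  have l3: "3 ^ n \<le> l"
  proof -
    have "(0::real) \<le> 3 ^ n" by simp
    with l4 show ?thesis by linarith
  qed
  let ?Z = "hbox n ?o (l - ?o)"
  obtain F where F: "finite F" "F \<subseteq> ?Z" "\<And>p q. p \<in> F \<Longrightarrow> q \<in> F \<Longrightarrow> p \<noteq> q \<Longrightarrow> 2 \<le> N (p - q)"
    "\<And>z. z \<in> ?Z \<Longrightarrow> \<exists>p\<in>F. N (z - p) < 2"
  proof (rule separated_net[of ?Z 2 "hbox n (?o - 3 ^ n * (2 / 2)) (l - ?o + 3 ^ n * (2 / 2))"])
    show "nball p (2 / 2) \<subseteq> hbox n (?o - 3 ^ n * (2 / 2)) (l - ?o + 3 ^ n * (2 / 2))" if "p \<in> ?Z" for p
      by (rule nball_subset_hbox[OF that])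
    show "?Z \<subseteq> Rn n" by (auto simp: hbox_def)
  qed auto
  have FR: "p \<in> Rn n" if "p \<in> F" for p using F(2) that by (auto simp: hbox_def)
  define A where "A p = nball p (2 / 5)" for p
  have far: "2 \<le> N (p + w - q)" if pq: "p \<in> F" "q \<in> F" and w: "w \<in> period_lattice n l" "p \<noteq> q \<or> w \<noteq> 0" for p q w
  proof (cases "w = 0")
    case True
    then show ?thesis using F(3)[OF pq] w by simp
  next
    case False
    obtain i where i: "i < n" "coord w i \<noteq> 0"
      using False Rn_eqI[of w n 0] period_lattice_Rn[OF w(1)] by auto
    obtain z :: int where z: "coord w i = l * of_int z" using w i by (auto simp: period_lattice_def)
    have "\<bar>z\<bar> \<ge> 1" using z i by auto
    then have "l * 1 \<le> l * \<bar>of_int z\<bar>" using l0 by (intro mult_left_mono) linarith+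
    then have "l \<le> \<bar>coord w i\<bar>" using z l0 by (simp add: abs_mult)
    moreover have "?o \<le> coord p i" "coord p i < l - ?o" "?o \<le> coord q i" "coord q i < l - ?o"
      using pq F(2) i by (auto simp: hbox_def)
    ultimately have "2 * ?o \<le> \<bar>coord (p + w - q) i\<bar>"
      by (simp add: lookup_add lookup_minus)
    also have "\<dots> \<le> 3 ^ n * N (p + w - q)" by (rule N_lower[OF i(1)])
    finally have "3 ^ n * 4 \<le> 3 ^ n * N (p + w - q)" by simp
    then have "4 \<le> N (p + w - q)" by simp
    then show ?thesis by simp
  qed
  have cs: "cell_system l F A (6 / 5)"
    unfolding cell_system_def
  proof (intro conjI ballI impI)
    fix p assume p: "p \<in> F"
    have "nball p (2 / 5) \<subseteq> hbox n (?o - 3 ^ n * (2 / 5)) (l - ?o + 3 ^ n * (2 / 5))"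
      using p F(2) by (intro nball_subset_hbox) auto
    also have "\<dots> \<subseteq> hbox n 0 l"
    proof
      fix y assume y: "y \<in> hbox n (?o - 3 ^ n * (2 / 5)) (l - ?o + 3 ^ n * (2 / 5))"
      have p3: "(0::real) < 3 ^ n" by simp
      have "0 \<le> coord y i \<and> coord y i < l" if "i < n" for i
      proof -
        have "?o - 3 ^ n * (2 / 5) \<le> coord y i" "coord y i < l - ?o + 3 ^ n * (2 / 5)"
          using y that by (auto simp: hbox_def)
        with p3 show ?thesis by linarith
      qed
      then show "y \<in> hbox n 0 l" using y by (auto simp: hbox_def)
    qed
    finally show "A p \<subseteq> hbox n 0 l" by (simp add: A_def)
    show "A p \<in> sets borel" by (simp add: A_def)
  next
    fix p q w a b assume *: "p \<in> F" "q \<in> F" "w \<in> period_lattice n l" "p \<noteq> q \<or> w \<noteq> 0" "a \<in> A p" "b \<in> A q"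
    have eq: "p + w - q = (p - a) + ((a + w - b) + (b - q))" by simp
    have "N (p + w - q) \<le> N (p - a) + (N (a + w - b) + N (b - q))"
      unfolding eq using N_triangle[of "p - a" "(a + w - b) + (b - q)"] N_triangle[of "a + w - b" "b - q"]
      by linarith
    moreover have "N (p - a) < 2 / 5" "N (b - q) < 2 / 5"
      using * N_minus_commute[of p a] by (auto simp: A_def nball_def)
    ultimately show "6 / 5 \<le> N (a + w - b)" using far[OF *(1-4)] by simp
  qed (use F in auto)
  have gap: "gap_set (1 / 10) (cell_union l F A)"
  proof (rule gap_set_cell_union[OF cs])
    fix p a b assume "p \<in> F" "a \<in> A p" "b \<in> A p"
    then show "N (a - b) \<le> 1 - 2 * (1 / 10)"
      using N_diff_triangle[of a b p] N_minus_commute[of p b] by (auto simp: A_def nball_def)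
  qed simp
  have "?Z \<subseteq> (\<Union>p\<in>F. nball p 2)"
    using F(4) by (fastforce simp: nball_def hbox_def)
  then have "measure (vol n) ?Z \<le> measure (vol n) (\<Union>p\<in>F. nball p 2)"
    using F(1) FR by (intro measure_mono_fmeasurable fmeasurable.finite_UN) auto
  also have "\<dots> \<le> (\<Sum>p\<in>F. measure (vol n) (nball p 2))"
    using F(1) by (intro measure_UNION_le) auto
  also have "\<dots> = card F * (2 ^ n * unit_vol)"
    using FR by (simp add: measure_nball)
  finally have "(l - 2 * ?o) ^ n \<le> card F * (2 ^ n * unit_vol)"
    using l4 by (subst (asm) measure_hbox) (auto simp: algebra_simps)
  then have "(1 - 1 / n) * l ^ n \<le> card F * (2 ^ n * unit_vol)"
    using period_density[OF l0 _ lo] by simp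
  then have "(1 / 5) ^ n * ((1 - 1 / n) * l ^ n) \<le> (1 / 5) ^ n * (card F * (2 ^ n * unit_vol))"
    by (intro mult_left_mono) auto
  also have "\<dots> = (\<Sum>p\<in>F. measure (vol n) (A p))"
  proof -
    have "(1 / 5) ^ n * 2 ^ n = (2 / 5 :: real) ^ n" by (simp add: power_mult_distrib[symmetric])
    then show ?thesis using FR by (simp add: A_def measure_nball mult_ac)
  qed
  also have "\<dots> \<le> measure (vol n) (cell_union l F A \<inter> hbox n 0 l)"
    by (rule measure_cell_union[OF cs])
  finally have dens: "((1 / 5) ^ n * (1 - 1 / n)) * l ^ n \<le> measure (vol n) (cell_union l F A \<inter> hbox n 0 l)"
    by (simp add: mult.assoc)
  have d10: "0 < (1::real) / 10" "(1::real) / 10 \<le> 1" by auto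
  obtain X where X: "finite X" "X \<subseteq> Rn n" "card X \<le> (4 * l * n / (1 / 10)) ^ n"
    "\<And>y. y \<in> hbox n 0 l \<Longrightarrow> \<exists>x\<in>X. N (y - x) < 1 / 10"
    using hbox_net[OF d10 l3] by metis
  show ?thesis
  proof (rule colorable_if_gap_set[OF l0 cell_union_borel[OF cs] cell_union_periodic gap dens _ X(1,2) _ X(4)])
    show "0 < (1 / 5) ^ n * (1 - 1 / n)" using np by simp
    show "card X < exp ((1 / 5) ^ n * (1 - 1 / n) * m)" using X(3) m by (simp add: mult_ac)
  qed
qed

end

section \<open>The norm of a symmetric convex body\<close>

lemma Rn_interior_iff:
  "z \<in> Rn_interior n P \<longleftrightarrow> z \<in> Rn n \<and> (\<exists>e>0. \<forall>y\<in>Rn n. dist y z < e \<longrightarrow> y \<in> P)"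
proof
  assume "z \<in> Rn_interior n P"
  then obtain T where T: "openin (top_of_set (Rn n)) T" "z \<in> T" "T \<subseteq> P"
    by (auto simp: Rn_interior_def interior_of_def)
  then have "T \<subseteq> Rn n" "\<exists>e>0. \<forall>y\<in>Rn n. dist y z < e \<longrightarrow> y \<in> T"
    unfolding openin_euclidean_subtopology_iff by blast+
  then show "z \<in> Rn n \<and> (\<exists>e>0. \<forall>y\<in>Rn n. dist y z < e \<longrightarrow> y \<in> P)" using T by blast
next
  assume "z \<in> Rn n \<and> (\<exists>e>0. \<forall>y\<in>Rn n. dist y z < e \<longrightarrow> y \<in> P)"
  then obtain e where e: "z \<in> Rn n" "e > 0" "\<forall>y\<in>Rn n. dist y z < e \<longrightarrow> y \<in> P" by blast
  have "Rn n \<inter> ball z e \<subseteq> Rn_interior n P"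
    unfolding Rn_interior_def using e by (intro interior_of_maximal) (auto simp: dist_commute)
  then show "z \<in> Rn_interior n P" using e by auto
qed

locale sym_body =
  fixes n :: nat and K :: "rvec set"
  assumes n_pos: "n \<ge> 1" and body: "symmetric_convex_body n K"
begin

lemma K_Rn: "K \<subseteq> Rn n" and K_closed: "closed K" and K_bounded: "bounded K" and K_convex: "convex K"
  and K_uminus: "x \<in> K \<Longrightarrow> - x \<in> K"
  using body by (auto simp: symmetric_convex_body_def)

text \<open>By symmetry \<open>y\<close> is the midpoint of the points \<open>x + y\<close> and
  \<open>- (x - y)\<close> of \<open>K\<close>, so a ball around an interior point \<open>x\<close>
  yields one around 0.\<close>

lemma K_inner_ball:
  obtains r where "r > 0" "\<And>y. y \<in> Rn n \<Longrightarrow> norm y \<le> r \<Longrightarrow> y \<in> K"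
proof -
  obtain x where x: "x \<in> Rn_interior n K"
    using body by (auto simp: symmetric_convex_body_def)
  then obtain e where e: "e > 0" "\<And>y. y \<in> Rn n \<Longrightarrow> dist y x < e \<Longrightarrow> y \<in> K" and xR: "x \<in> Rn n"
    unfolding Rn_interior_iff by blast
  show ?thesis
  proof (rule that[of "e / 2"])
    show "e / 2 > 0" using e by simp
    fix y assume y: "y \<in> Rn n" "norm y \<le> e / 2"
    have xy: "x + y \<in> K" "x - y \<in> K"
      using e y xR by (auto simp: dist_norm)
    have "(1 / 2) *\<^sub>R (x + y) + (1 / 2) *\<^sub>R (- (x - y)) \<in> K"
      by (rule convexD[OF K_convex xy(1) K_uminus[OF xy(2)]]) simp_all
    also have "(1 / 2) *\<^sub>R (x + y) + (1 / 2) *\<^sub>R (- (x - y)) = (1 / 2) *\<^sub>R (2 *\<^sub>R y)"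
      unfolding scaleR_add_right[symmetric] by (simp add: scaleR_2)
    finally show "y \<in> K" by simp
  qed
qed

lemma zero_in_K: "0 \<in> K"
  using K_inner_ball by (metis Rn_zero less_imp_le norm_zero)

lemma K_scale: "x \<in> K \<Longrightarrow> 0 \<le> c \<Longrightarrow> c \<le> 1 \<Longrightarrow> c *\<^sub>R x \<in> K"
  using convexD[OF K_convex, of x 0 c "1 - c"] zero_in_K by simp

lemma gauge_set: "0 < t \<Longrightarrow> x \<in> (\<lambda>y. t *\<^sub>R y) ` K \<longleftrightarrow> (1 / t) *\<^sub>R x \<in> K"
  by (auto intro!: image_eqI[of _ _ "(1 / t) *\<^sub>R x"])

lemma body_norm_eq: "body_norm K x = Inf {t. 0 < t \<and> (1 / t) *\<^sub>R x \<in> K}"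
  unfolding body_norm_def using gauge_set by (intro arg_cong[of _ _ Inf]) auto

lemma gauge_bdd: "bdd_below {t. 0 < t \<and> (1 / t) *\<^sub>R x \<in> K}"
  by (auto intro: bdd_belowI[of _ 0])

lemma gauge_nonempty:
  assumes "x \<in> Rn n"
  shows "{t. 0 < t \<and> (1 / t) *\<^sub>R x \<in> K} \<noteq> {}"
proof -
  obtain r where r: "r > 0" "\<And>y. y \<in> Rn n \<Longrightarrow> norm y \<le> r \<Longrightarrow> y \<in> K" using K_inner_ball by blast
  define t where "t = norm x / r + 1"
  have t: "t > 0" using r by (auto simp: t_def intro: add_nonneg_pos)
  have "norm x \<le> r * t" using r by (simp add: t_def algebra_simps)
  then have "norm ((1 / t) *\<^sub>R x) \<le> r" using t by (simp add: divide_le_eq)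
  then show ?thesis using r assms t by auto
qed

lemma body_norm_nonneg: "x \<in> Rn n \<Longrightarrow> 0 \<le> body_norm K x"
  unfolding body_norm_eq using gauge_nonempty by (intro cInf_greatest) auto

text \<open>Closedness of \<open>K\<close> makes the infimum attained for
  \<open>body_norm K x > 0\<close>; membership for all larger \<open>t\<close> follows by scaling
  towards 0 and passes to the limit \<open>s\<close>.\<close>

lemma body_norm_le_iff:
  assumes x: "x \<in> Rn n" and s: "s > 0"
  shows "body_norm K x \<le> s \<longleftrightarrow> (1 / s) *\<^sub>R x \<in> K"
proof
  assume "(1 / s) *\<^sub>R x \<in> K"
  then show "body_norm K x \<le> s"
    unfolding body_norm_eq using s by (intro cInf_lower gauge_bdd) auto
next
  assume le: "body_norm K x \<le> s"
  have mem: "(1 / t) *\<^sub>R x \<in> K" if t: "t > s" for t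
  proof -
    have "Inf {t. 0 < t \<and> (1 / t) *\<^sub>R x \<in> K} < t" using le t unfolding body_norm_eq by linarith
    then obtain u where u: "0 < u" "(1 / u) *\<^sub>R x \<in> K" "u < t"
      using cInf_lessD[OF gauge_nonempty[OF x]] by blast
    have "(u / t) *\<^sub>R ((1 / u) *\<^sub>R x) \<in> K" by (rule K_scale[OF u(2)]) (use u in auto)
    then show ?thesis using u by simp
  qed
  have "(\<lambda>k. (1 / (s + 1 / real (Suc k))) *\<^sub>R x) \<longlonglongrightarrow> (1 / (s + 0)) *\<^sub>R x"
    using s by (intro tendsto_intros LIMSEQ_Suc[OF lim_1_over_n]) auto
  moreover have "(1 / (s + 1 / real (Suc k))) *\<^sub>R x \<in> K" for k
    by (rule mem) simp
  ultimately show "(1 / s) *\<^sub>R x \<in> K"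
    using closed_sequentially[OF K_closed] by (metis (no_types, lifting) add.right_neutral)
qed

lemma body_norm_le_1: "x \<in> Rn n \<Longrightarrow> body_norm K x \<le> 1 \<longleftrightarrow> x \<in> K"
  using body_norm_le_iff[of x 1] by simp

lemma body_norm_triangle:
  assumes x: "x \<in> Rn n" and y: "y \<in> Rn n"
  shows "body_norm K (x + y) \<le> body_norm K x + body_norm K y"
proof (rule field_le_epsilon)
  fix e :: real assume e: "e > 0"
  define s t where "s = body_norm K x + e / 2" and "t = body_norm K y + e / 2"
  have st: "s > 0" "t > 0" "(1 / s) *\<^sub>R x \<in> K" "(1 / t) *\<^sub>R y \<in> K"
    using body_norm_nonneg[OF x] body_norm_nonneg[OF y] body_norm_le_iff[OF x, of s] body_norm_le_iff[OF y, of t] e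
    by (auto simp: s_def t_def)
  have "(s / (s + t)) *\<^sub>R ((1 / s) *\<^sub>R x) + (t / (s + t)) *\<^sub>R ((1 / t) *\<^sub>R y) \<in> K"
    using st by (intro convexD[OF K_convex]) (auto simp: add_divide_distrib[symmetric])
  then have "(1 / (s + t)) *\<^sub>R (x + y) \<in> K"
    using st by (simp add: scaleR_add_right)
  then have "body_norm K (x + y) \<le> s + t"
    using st x y by (subst body_norm_le_iff) auto
  then show "body_norm K (x + y) \<le> body_norm K x + body_norm K y + e"
    by (simp add: s_def t_def)
qed

lemma eq_if_le_iff:
  assumes "0 \<le> a" "0 \<le> b" "\<And>s::real. s > 0 \<Longrightarrow> a \<le> s \<longleftrightarrow> b \<le> s"
  shows "a = b"
proof (rule antisym)
  show "a \<le> b" by (rule field_le_epsilon) (use assms in \<open>auto simp: add_nonneg_pos\<close>)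
  show "b \<le> a" by (rule field_le_epsilon) (use assms(3)[symmetric] assms(1,2) in \<open>auto simp: add_nonneg_pos\<close>)
qed

lemma K_abs_scale: "c *\<^sub>R x \<in> K \<longleftrightarrow> \<bar>c\<bar> *\<^sub>R x \<in> K"
  using K_uminus[of "c *\<^sub>R x"] K_uminus[of "- c *\<^sub>R x"] by (cases "c \<ge> 0") auto

lemma body_norm_scaleR:
  assumes x: "x \<in> Rn n"
  shows "body_norm K (c *\<^sub>R x) = \<bar>c\<bar> * body_norm K x"
proof (rule eq_if_le_iff)
  show "0 \<le> body_norm K (c *\<^sub>R x)" "0 \<le> \<bar>c\<bar> * body_norm K x"
    using x body_norm_nonneg by auto
  fix s :: real assume s: "s > 0"
  have "body_norm K (c *\<^sub>R x) \<le> s \<longleftrightarrow> (c / s) *\<^sub>R x \<in> K"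
    using x s by (subst body_norm_le_iff) auto
  also have "\<dots> \<longleftrightarrow> (\<bar>c\<bar> / s) *\<^sub>R x \<in> K"
    using K_abs_scale[of "c / s" x] s by simp
  also have "\<dots> \<longleftrightarrow> \<bar>c\<bar> * body_norm K x \<le> s"
  proof (cases "c = 0")
    case True
    then show ?thesis using zero_in_K s by simp
  next
    case False
    then have "(\<bar>c\<bar> / s) *\<^sub>R x \<in> K \<longleftrightarrow> body_norm K x \<le> s / \<bar>c\<bar>"
      using s by (subst body_norm_le_iff[OF x]) auto
    then show ?thesis using False by (simp add: pos_le_divide_eq mult.commute)
  qed
  finally show "body_norm K (c *\<^sub>R x) \<le> s \<longleftrightarrow> \<bar>c\<bar> * body_norm K x \<le> s" .
qed

lemma body_norm_sum:
  assumes "\<And>i. i \<in> I \<Longrightarrow> f i \<in> Rn n"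
  shows "body_norm K (\<Sum>i\<in>I. f i) \<le> (\<Sum>i\<in>I. body_norm K (f i))"
  using assms
proof (induction I rule: infinite_finite_induct)
  case (insert i I)
  have "body_norm K (f i + (\<Sum>i\<in>I. f i)) \<le> body_norm K (f i) + body_norm K (\<Sum>i\<in>I. f i)"
    using insert.prems by (intro body_norm_triangle Rn_sum) auto
  also have "\<dots> \<le> body_norm K (f i) + (\<Sum>i\<in>I. body_norm K (f i))"
    using insert.IH insert.prems by simp
  finally show ?case using insert.hyps by simp
qed (use body_norm_scaleR[of 0 0] in auto)

text \<open>A triangular basis: \<open>b i\<close> almost maximises the \<open>i\<close>-th coordinate among the points of \<open>K\<close> whose
  earlier coordinates vanish, so coordinates with respect to it are controlled by the norm with a
  constant that depends on the dimension only.\<close>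

lemma triangular_basis:
  "\<exists>b. \<forall>i<n. b i \<in> K \<and> (\<forall>j<i. coord (b i) j = 0) \<and> 0 < coord (b i) i \<and>
     (\<forall>y\<in>K. (\<forall>j<i. coord y j = 0) \<longrightarrow> coord y i \<le> 2 * coord (b i) i)"
proof -
  have "\<exists>x. x \<in> K \<and> (\<forall>j<i. coord x j = 0) \<and> 0 < coord x i \<and>
     (\<forall>y\<in>K. (\<forall>j<i. coord y j = 0) \<longrightarrow> coord y i \<le> 2 * coord x i)" if i: "i < n" for i
  proof -
    define Q where "Q = {y \<in> K. \<forall>j<i. coord y j = 0}"
    obtain B where B: "\<And>y. y \<in> K \<Longrightarrow> norm y \<le> B" using K_bounded by (auto simp: bounded_iff)
    have bdd: "bdd_above ((\<lambda>y. coord y i) ` Q)"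
    proof (rule bdd_aboveI2)
      fix y assume "y \<in> Q"
      then have "norm y \<le> B" using B by (simp add: Q_def)
      with abs_coord_le_norm[of y i] show "coord y i \<le> B" by linarith
    qed
    obtain r where r: "r > 0" "\<And>y. y \<in> Rn n \<Longrightarrow> norm y \<le> r \<Longrightarrow> y \<in> K" using K_inner_ball by blast
    have eR: "unit_vec i \<in> Rn n" using i by (auto simp: mem_Rn coord_unit_vec)
    have "norm (unit_vec i) = 1" by (simp add: norm_rvec)
    then have "r *\<^sub>R unit_vec i \<in> K" using r eR by (intro r(2)) auto
    then have eQ: "r *\<^sub>R unit_vec i \<in> Q" by (auto simp: Q_def coord_unit_vec)
    define M where "M = (SUP y\<in>Q. coord y i)"
    have "coord (r *\<^sub>R unit_vec i) i \<le> M" unfolding M_def by (rule cSUP_upper[OF eQ bdd])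
    then have M: "M > 0" using r by (simp add: coord_unit_vec)
    \<comment> \<open>A point beyond half the supremum exists without a compactness argument. The
      factor 2 lost here leads to the base \<open>3 = 1 + 2\<close> in
      \<open>coord_norm\<close>.\<close>
    have "M / 2 < (SUP y\<in>Q. coord y i)" using M by (simp add: M_def)
    then obtain x where x: "x \<in> Q" "M / 2 < coord x i"
      using less_cSUP_iff[OF _ bdd] eQ by blast
    have "coord y i \<le> 2 * coord x i" if "y \<in> Q" for y
      using cSUP_upper[OF that bdd] x by (simp add: M_def)
    then show ?thesis using x M by (intro exI[of _ x]) (auto simp: Q_def)
  qed
  then show ?thesis by metis
qed

text \<open>\<open>T\<close> sends the unit vectors to the triangular basis. These basis vectors
  have norm at most 1, which gives the upper bound; for the lower bound the coefficients are peeled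
  off one by one, each time multiplying the norm of the rest by at most 3.\<close>

lemma coordinates:
  obtains T :: "rvec \<Rightarrow> rvec" where "linear T" "\<And>y. T y \<in> Rn n" "\<And>y. y \<in> Rn n \<Longrightarrow> \<exists>x\<in>Rn n. T x = y"
    "continuous_on UNIV T" "coord_norm n (\<lambda>y. body_norm K (T y))"
proof -
  obtain b where b: "\<forall>i<n. b i \<in> K \<and> (\<forall>j<i. coord (b i) j = 0) \<and> 0 < coord (b i) i \<and>
     (\<forall>y\<in>K. (\<forall>j<i. coord y j = 0) \<longrightarrow> coord y i \<le> 2 * coord (b i) i)"
    using triangular_basis by blast
  have bK: "b i \<in> K" and b0: "j < i \<Longrightarrow> coord (b i) j = 0" and bpos: "0 < coord (b i) i"
    and bmax: "y \<in> K \<Longrightarrow> (\<And>j. j < i \<Longrightarrow> coord y j = 0) \<Longrightarrow> coord y i \<le> 2 * coord (b i) i" if "i < n" for i j y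
    using b that by auto
  have bR: "b i \<in> Rn n" if "i < n" for i using bK[OF that] K_Rn by blast
  define T where "T y = (\<Sum>i<n. coord y i *\<^sub>R b i)" for y
  have lin: "linear T"
    unfolding T_def by (intro linearI) (auto simp: lookup_add scaleR_add_left sum.distrib scaleR_sum_right)
  have TR: "T y \<in> Rn n" for y unfolding T_def using bR by (intro Rn_sum) auto
  have cont: "continuous_on UNIV T" unfolding T_def by (intro continuous_intros)
  have surj: "\<exists>x\<in>Rn n. T x = y" if y: "y \<in> Rn n" for y
  proof -
    \<comment> \<open>Downward induction on the number \<open>k\<close> of leading zeros: a multiple
      of \<open>b k\<close> clears coordinate \<open>k\<close> and leaves the earlier ones at
      0.\<close>
    have "\<forall>y\<in>Rn n. (\<forall>j<k. coord y j = 0) \<longrightarrow> (\<exists>x\<in>Rn n. T x = y)" if "k \<le> n" for k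
      using that
    proof (induction k rule: inc_induct)
      case base
      show ?case
      proof (intro ballI impI)
        fix y assume "y \<in> Rn n" "\<forall>j<n. coord y j = 0"
        then have "y = 0" by (intro Rn_eqI[of _ n]) auto
        then show "\<exists>x\<in>Rn n. T x = y" using linear_0[OF lin] by (intro bexI[of _ 0]) auto
      qed
    next
      case (step k)
      show ?case
      proof (intro ballI impI)
        fix y assume y: "y \<in> Rn n" "\<forall>j<k. coord y j = 0"
        define c where "c = coord y k / coord (b k) k"
        let ?y' = "y - c *\<^sub>R b k"
        have "coord ?y' j = 0" if "j < Suc k" for j
          using that y b0[OF step(2)] bpos[OF step(2)] by (auto simp: less_Suc_eq lookup_minus c_def)
        moreover have "?y' \<in> Rn n" using y bR[OF step(2)] by simp
        ultimately obtain x where x: "x \<in> Rn n" "T x = ?y'" using step.IH by blast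
        have "T (unit_vec k) = (\<Sum>i<n. (if i = k then b k else 0))"
          unfolding T_def by (intro sum.cong) (auto simp: coord_unit_vec)
        then have Tk: "T (unit_vec k) = b k" using step(2) by simp
        have "T (x + c *\<^sub>R unit_vec k) = y"
          using x Tk by (simp add: linear_add[OF lin] linear_scale[OF lin])
        moreover have "unit_vec k \<in> Rn n" using step(2) by (auto simp: mem_Rn coord_unit_vec)
        then have "x + c *\<^sub>R unit_vec k \<in> Rn n" using x by simp
        ultimately show "\<exists>x\<in>Rn n. T x = y" by blast
      qed
    qed
    from this[of 0] y show ?thesis by simp
  qed
  have upper: "body_norm K (T y) \<le> (\<Sum>i<n. \<bar>coord y i\<bar>)" for y
  proof -
    have "body_norm K (T y) \<le> (\<Sum>i<n. body_norm K (coord y i *\<^sub>R b i))"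
      unfolding T_def using bR by (intro body_norm_sum) auto
    also have "\<dots> \<le> (\<Sum>i<n. \<bar>coord y i\<bar> * 1)"
    proof (rule sum_mono)
      fix i assume "i \<in> {..<n}"
      then have "body_norm K (b i) \<le> 1" "b i \<in> Rn n" using bK bR body_norm_le_1 by auto
      then show "body_norm K (coord y i *\<^sub>R b i) \<le> \<bar>coord y i\<bar> * 1"
        using mult_left_mono[of "body_norm K (b i)" 1 "\<bar>coord y i\<bar>"] by (simp add: body_norm_scaleR)
    qed
    finally show ?thesis by simp
  qed
  have lower: "\<bar>coord y i\<bar> \<le> 3 ^ n * body_norm K (T y)" if i: "i < n" for i y
  proof -
    \<comment> \<open>The first \<open>k\<close> coordinates of the tail \<open>u k\<close> vanish,
      so after normalisation it competes with \<open>b k\<close>. This bounds its leading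
      coefficient by twice its norm, and removing that term at most triples the norm.\<close>
    define u where "u k = (\<Sum>i\<in>{k..<n}. coord y i *\<^sub>R b i)" for k
    have uR: "u k \<in> Rn n" for k unfolding u_def using bR by (intro Rn_sum) auto
    have u0: "coord (u k) j = 0" if "j < k" for j k
      unfolding u_def coord_sum using that b0 by (intro sum.neutral) auto
    have us: "u k = coord y k *\<^sub>R b k + u (Suc k)" if "k < n" for k
      unfolding u_def using that by (simp add: sum.atLeast_Suc_lessThan)
    have step: "\<bar>coord y k\<bar> \<le> 2 * v \<and> body_norm K (u (Suc k)) \<le> 3 * v"
      if k: "k < n" and v: "v > 0" "body_norm K (u k) \<le> v" for k v
    proof -
      have mem: "(1 / v) *\<^sub>R u k \<in> K" using body_norm_le_iff[OF uR v(1)] v(2) by blast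
      have "coord (u k) k = coord y k * coord (b k) k"
        using us[OF k] u0[of k "Suc k"] by (simp add: lookup_add)
      then have uk: "coord ((1 / v) *\<^sub>R u k) k = coord y k * coord (b k) k / v" by simp
      have "coord ((1 / v) *\<^sub>R u k) k \<le> 2 * coord (b k) k"
        using u0 by (intro bmax[OF k mem]) auto
      moreover have "coord (- ((1 / v) *\<^sub>R u k)) k \<le> 2 * coord (b k) k"
        using u0 by (intro bmax[OF k K_uminus[OF mem]]) auto
      ultimately have "\<bar>coord ((1 / v) *\<^sub>R u k) k\<bar> \<le> 2 * coord (b k) k"
        unfolding lookup_uminus by linarith
      then have "\<bar>coord y k * coord (b k) k / v\<bar> \<le> 2 * coord (b k) k"
        unfolding uk .
      then have "\<bar>coord y k\<bar> * coord (b k) k \<le> (2 * v) * coord (b k) k"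
        using v bpos[OF k] by (simp add: abs_mult divide_le_eq mult_ac)
      then have y2: "\<bar>coord y k\<bar> \<le> 2 * v"
        using bpos[OF k] by (simp only: mult_le_cancel_right_pos)
      have "u (Suc k) = u k + (- coord y k) *\<^sub>R b k" using us[OF k] by simp
      then have "body_norm K (u (Suc k)) \<le> body_norm K (u k) + body_norm K ((- coord y k) *\<^sub>R b k)"
        using body_norm_triangle[OF uR Rn_scaleR[OF bR[OF k]]] by metis
      also have "body_norm K ((- coord y k) *\<^sub>R b k) = \<bar>coord y k\<bar> * body_norm K (b k)"
        using body_norm_scaleR[OF bR[OF k], of "- coord y k"] by simp
      also have "\<bar>coord y k\<bar> * body_norm K (b k) \<le> \<bar>coord y k\<bar> * 1"
        using body_norm_le_1[OF bR[OF k]] bK[OF k] by (intro mult_left_mono) auto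
      finally show ?thesis using y2 v by simp
    qed
    have uk: "body_norm K (u k) \<le> 3 ^ k * s" if s: "s > 0" "body_norm K (T y) \<le> s" and "k \<le> n" for s k
      using that(3)
    proof (induction k)
      case 0
      show ?case using s by (simp add: u_def T_def atLeast0LessThan)
    next
      case (Suc k)
      then have "body_norm K (u k) \<le> 3 ^ k * s" by simp
      then have "body_norm K (u (Suc k)) \<le> 3 * (3 ^ k * s)" using Suc.prems s by (intro step[THEN conjunct2]) auto
      then show ?case by simp
    qed
    show ?thesis
    proof (rule field_le_epsilon)
      fix e :: real assume e: "e > 0"
      \<comment> \<open>The slack keeps \<open>s\<close> positive when \<open>T y\<close> has norm
        0, and it becomes \<open>e\<close> after multiplication by \<open>3 ^ n\<close>.\<close>
      define s where "s = body_norm K (T y) + e / 3 ^ n"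
      have s: "s > 0" "body_norm K (T y) \<le> s"
        using body_norm_nonneg[OF TR] e by (auto simp: s_def add_nonneg_pos)
      have "\<bar>coord y i\<bar> \<le> 2 * (3 ^ i * s)"
        using uk[OF s, of i] s i by (intro step[THEN conjunct1]) auto
      also have "\<dots> \<le> 3 * (3 ^ i * s)" using s by simp
      also have "\<dots> = 3 ^ Suc i * s" by simp
      also have "\<dots> \<le> 3 ^ n * s" using s i by (intro mult_right_mono power_increasing) auto
      also have "\<dots> = 3 ^ n * body_norm K (T y) + e" by (simp add: s_def distrib_left)
      finally show "\<bar>coord y i\<bar> \<le> 3 ^ n * body_norm K (T y) + e" .
    qed
  qed
  have "coord_norm n (\<lambda>y. body_norm K (T y))"
  proof
    show "body_norm K (T (x + y)) \<le> body_norm K (T x) + body_norm K (T y)" for x y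
      using body_norm_triangle[OF TR TR] by (simp add: linear_add[OF lin])
    show "body_norm K (T (r *\<^sub>R x)) = \<bar>r\<bar> * body_norm K (T x)" for r x
      using body_norm_scaleR[OF TR] by (simp add: linear_scale[OF lin])
  qed (use n_pos upper lower in auto)
  with lin TR surj cont show ?thesis by (intro that[of T]) auto
qed

end

text \<open>The nested infima over tilings and over pairs \<open>\<alpha>\<close>,
  \<open>\<beta>\<close> become a single infimum over these ratios.\<close>

definition admissible_ratio :: "nat \<Rightarrow> rvec set \<Rightarrow> nat \<Rightarrow> real \<Rightarrow> bool" where
  "admissible_ratio n K k \<gamma> \<longleftrightarrow> (\<exists>\<Omega> \<Phi> \<Psi> \<alpha> \<beta> \<psi>. is_multilattice n \<Omega> \<Phi> \<and> num_translates \<Omega> \<Phi> \<le> k \<and>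
     is_polytope_tiling n \<Psi> \<and> \<gamma> = \<beta> / \<alpha> \<and> 0 < \<alpha> \<and> 0 < \<beta> \<and> associated_via n \<Phi> \<Psi> \<psi> \<and>
     (\<forall>x\<in>\<Phi>. (\<lambda>y. \<alpha> *\<^sub>R y + x) ` K \<subseteq> \<psi> x \<and> \<psi> x \<subseteq> (\<lambda>y. \<beta> *\<^sub>R y + x) ` K))"

lemma min_tiling_parameter_le: "admissible_ratio n K k \<gamma> \<Longrightarrow> min_tiling_parameter n K k \<le> ereal \<gamma>"
proof -
  assume "admissible_ratio n K k \<gamma>"
  then obtain \<Omega> \<Phi> \<Psi> \<alpha> \<beta> \<psi> where *: "is_multilattice n \<Omega> \<Phi>" "num_translates \<Omega> \<Phi> \<le> k"
     "is_polytope_tiling n \<Psi>" "\<gamma> = \<beta> / \<alpha>" "0 < \<alpha>" "0 < \<beta>" "associated_via n \<Phi> \<Psi> \<psi>"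
     "\<forall>x\<in>\<Phi>. (\<lambda>y. \<alpha> *\<^sub>R y + x) ` K \<subseteq> \<psi> x \<and> \<psi> x \<subseteq> (\<lambda>y. \<beta> *\<^sub>R y + x) ` K"
    unfolding admissible_ratio_def by (elim exE conjE)
  have "min_tiling_parameter n K k \<le> tiling_parameter n K \<Phi> \<Psi>"
    unfolding min_tiling_parameter_def
  proof (rule Inf_lower, rule CollectI, intro exI conjI)
    show "associated n \<Phi> \<Psi>" using * unfolding associated_def by blast
  qed (rule refl, fact+)
  also have "\<dots> \<le> ereal (\<beta> / \<alpha>)"
    unfolding tiling_parameter_def
    by (rule Inf_lower, rule CollectI, intro exI conjI) (rule refl, fact+)
  finally show ?thesis using * by simp
qed

lemma admissible_ratio_if_less:
  assumes "min_tiling_parameter n K k < ereal x"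
  shows "\<exists>\<gamma><x. admissible_ratio n K k \<gamma>"
proof -
  obtain \<Omega> \<Phi> \<Psi> where 1: "is_multilattice n \<Omega> \<Phi>" "num_translates \<Omega> \<Phi> \<le> k" "associated n \<Phi> \<Psi>"
      "tiling_parameter n K \<Phi> \<Psi> < ereal x"
    using assms unfolding min_tiling_parameter_def Inf_less_iff by blast
  obtain \<alpha> \<beta> \<psi> where 2: "0 < \<alpha>" "0 < \<beta>" "associated_via n \<Phi> \<Psi> \<psi>" "ereal (\<beta> / \<alpha>) < ereal x"
      "\<forall>x\<in>\<Phi>. (\<lambda>y. \<alpha> *\<^sub>R y + x) ` K \<subseteq> \<psi> x \<and> \<psi> x \<subseteq> (\<lambda>y. \<beta> *\<^sub>R y + x) ` K"
    using 1(4) unfolding tiling_parameter_def Inf_less_iff by blast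
  have "is_polytope_tiling n \<Psi>" using 1(3) by (simp add: associated_def)
  then have "admissible_ratio n K k (\<beta> / \<alpha>)"
    unfolding admissible_ratio_def using 1 2 by (intro exI conjI) (assumption | rule refl)+
  moreover have "\<beta> / \<alpha> < x" using 2(4) by simp
  ultimately show ?thesis by blast
qed

section \<open>Passing from the body to the coordinates\<close>

context sym_body
begin

text \<open>A translate of \<open>\<alpha> K\<close> lies in the translate of
  \<open>\<beta> K\<close> with the same centre. Comparing the largest norms of points gives
  \<open>\<alpha> \<le> \<beta>\<close>, since this maximum is finite and, as
  \<open>n \<ge> 1\<close>, positive.\<close>

lemma admissible_ratio_ge_1:
  assumes "admissible_ratio n K k \<gamma>"
  shows "\<gamma> \<ge> 1"
proof -
  obtain \<Omega> \<Phi> \<Psi> \<alpha> \<beta> \<psi> where *: "is_multilattice n \<Omega> \<Phi>" "\<gamma> = \<beta> / \<alpha>" "0 < \<alpha>" "0 < \<beta>"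
     "\<forall>x\<in>\<Phi>. (\<lambda>y. \<alpha> *\<^sub>R y + x) ` K \<subseteq> \<psi> x \<and> \<psi> x \<subseteq> (\<lambda>y. \<beta> *\<^sub>R y + x) ` K"
    using assms unfolding admissible_ratio_def by (elim exE conjE)
  have "\<Phi> \<noteq> {}"
  proof -
    obtain B X where "\<Omega> = {(\<Sum>b\<in>B. of_int (z b) *\<^sub>R b) | z :: rvec \<Rightarrow> int. True}"
        "X \<noteq> {}" "\<Phi> = (\<Union>x\<in>X. (+) x ` \<Omega>)"
      using *(1) unfolding is_multilattice_def is_lattice_def by blast
    then show ?thesis by auto
  qed
  then obtain x where x: "x \<in> \<Phi>" by blast
  have sub: "(\<lambda>y. \<alpha> *\<^sub>R y + x) ` K \<subseteq> (\<lambda>y. \<beta> *\<^sub>R y + x) ` K" using * x by blast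
  obtain B where B: "\<And>y. y \<in> K \<Longrightarrow> norm y \<le> B" using K_bounded by (auto simp: bounded_iff)
  have bdd: "bdd_above (norm ` K)" using B by (intro bdd_aboveI2)
  define M where "M = (SUP y\<in>K. norm y)"
  obtain r where r: "r > 0" "\<And>y. y \<in> Rn n \<Longrightarrow> norm y \<le> r \<Longrightarrow> y \<in> K" using K_inner_ball by blast
  have "0 < n" using n_pos by simp
  then obtain j where j: "j < n" by blast
  have "unit_vec j \<in> Rn n" using j by (auto simp: mem_Rn coord_unit_vec)
  moreover have n1: "norm (unit_vec j) = 1" by (simp add: norm_rvec)
  ultimately have "r *\<^sub>R unit_vec j \<in> K" using r by (intro r(2)) auto
  then have "norm (r *\<^sub>R unit_vec j) \<le> M" unfolding M_def by (rule cSUP_upper[OF _ bdd])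
  then have M: "M > 0" using r n1 by simp
  have "M \<le> \<gamma> * M"
    unfolding M_def
  proof (rule cSUP_least)
    show "K \<noteq> {}" using zero_in_K by blast
    fix y assume "y \<in> K"
    then have "\<alpha> *\<^sub>R y + x \<in> (\<lambda>y. \<beta> *\<^sub>R y + x) ` K" using sub by blast
    then obtain y' where y': "y' \<in> K" "\<alpha> *\<^sub>R y = \<beta> *\<^sub>R y'" by auto
    have "\<alpha> * norm y = \<beta> * norm y'" using y'(2) *(3,4) by (metis abs_of_pos norm_scaleR)
    then have "norm y = \<beta> * norm y' / \<alpha>" using *(3) by (simp add: eq_divide_eq mult.commute)
    then have "norm y = \<gamma> * norm y'" using *(2) by simp
    also have "\<dots> \<le> \<gamma> * (SUP y\<in>K. norm y)"
      using * y' by (intro mult_left_mono cSUP_upper bdd) auto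
    finally show "norm y \<le> \<gamma> * (SUP y\<in>K. norm y)" .
  qed
  then have "1 * M \<le> \<gamma> * M" by simp
  with M show ?thesis by (simp only: mult_le_cancel_right_pos)
qed

lemma chromatic_number_le:
  assumes T: "linear T" "\<And>y. y \<in> Rn n \<Longrightarrow> \<exists>x\<in>Rn n. T x = y" and N: "coord_norm n (\<lambda>y. body_norm K (T y))"
    and col: "coord_norm.colorable n (\<lambda>y. body_norm K (T y)) m"
  shows "chromatic_number n K \<le> enat m"
proof -
  obtain c :: "rvec \<Rightarrow> nat" where c: "c ` Rn n \<subseteq> {..<m}"
    "\<And>x y. x \<in> Rn n \<Longrightarrow> y \<in> Rn n \<Longrightarrow> body_norm K (T (x - y)) = 1 \<Longrightarrow> c x \<noteq> c y"
    using col unfolding coord_norm.colorable_def[OF N] by blast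
  obtain R where R: "\<forall>y\<in>Rn n. R y \<in> Rn n \<and> T (R y) = y"
    using T(2) by (metis (no_types))
  have "proper_coloring n K m (c \<circ> R)"
    unfolding proper_coloring_def
  proof (intro conjI ballI impI)
    show "(c \<circ> R) ` Rn n \<subseteq> {..<m}" using c(1) R by auto
    fix x y assume xy: "x \<in> Rn n" "y \<in> Rn n" "body_norm K (x - y) = 1"
    then have "body_norm K (T (R x - R y)) = 1" using R by (simp add: linear_diff[OF T(1)])
    then show "(c \<circ> R) x \<noteq> (c \<circ> R) y" using R xy c(2)[of "R x" "R y"] by auto
  qed
  then show ?thesis
    unfolding chromatic_number_def by (intro Inf_lower) blast
qed

lemma mem_scaled_body:
  assumes "\<alpha> > 0" "x \<in> Rn n"
  shows "y \<in> (\<lambda>y. \<alpha> *\<^sub>R y + x) ` K \<longleftrightarrow> y \<in> Rn n \<and> body_norm K (y - x) \<le> \<alpha>"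
proof
  assume "y \<in> (\<lambda>y. \<alpha> *\<^sub>R y + x) ` K"
  then obtain u where u: "u \<in> K" "y = \<alpha> *\<^sub>R u + x" by blast
  then have uR: "u \<in> Rn n" using K_Rn by blast
  have "body_norm K (y - x) \<le> \<alpha>" using u uR assms by (subst body_norm_le_iff) auto
  then show "y \<in> Rn n \<and> body_norm K (y - x) \<le> \<alpha>" using u uR assms by simp
next
  assume y: "y \<in> Rn n \<and> body_norm K (y - x) \<le> \<alpha>"
  then have "(1 / \<alpha>) *\<^sub>R (y - x) \<in> K" using assms by (subst body_norm_le_iff[symmetric]) auto
  moreover have "y = \<alpha> *\<^sub>R ((1 / \<alpha>) *\<^sub>R (y - x)) + x" using assms by simp
  ultimately show "y \<in> (\<lambda>y. \<alpha> *\<^sub>R y + x) ` K" by blast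
qed

lemma interior_if_ball:
  assumes z: "z \<in> Rn n" and e: "e > 0" and sub: "\<And>y. y \<in> Rn n \<Longrightarrow> body_norm K (y - z) < e \<Longrightarrow> y \<in> P"
  shows "z \<in> Rn_interior n P"
proof -
  obtain r where r: "r > 0" "\<And>y. y \<in> Rn n \<Longrightarrow> norm y \<le> r \<Longrightarrow> y \<in> K" using K_inner_ball by blast
  have "y \<in> P" if y: "y \<in> Rn n" "dist y z < r * (e / 2)" for y
  proof -
    have yz: "y - z \<in> Rn n" "norm (y - z) \<le> r * (e / 2)"
      using y z by (auto simp: dist_norm)
    have "norm ((1 / (e / 2)) *\<^sub>R (y - z)) \<le> r"
      using yz(2) e by (simp add: pos_divide_le_eq mult_ac)
    then have "(1 / (e / 2)) *\<^sub>R (y - z) \<in> K" using yz(1) by (intro r(2)) auto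
    then have "body_norm K (y - z) \<le> e / 2" using yz(1) e by (subst body_norm_le_iff) auto
    then show "y \<in> P" using y e by (intro sub) auto
  qed
  then show ?thesis
    unfolding Rn_interior_iff using z r(1) e by (intro conjI exI[of _ "r * (e / 2)"]) auto
qed

text \<open>\<open>T\<close> vanishes on vectors whose first \<open>n\<close> coordinates are 0, so
  preimages are cut down to \<open>Rn n\<close>, where \<open>T\<close> is a bijection. Common balls
  of two preimages give common interior points of the original tiles.\<close>

lemma convex_tiling_transfer:
  assumes T: "linear T" "\<And>y. T y \<in> Rn n" "\<And>y. y \<in> Rn n \<Longrightarrow> \<exists>x\<in>Rn n. T x = y" "continuous_on UNIV T"
    and N: "coord_norm n (\<lambda>y. body_norm K (T y))"
    and \<Psi>: "is_polytope_tiling n \<Psi>" "associated_via n \<Phi> \<Psi> \<psi>" and pos: "0 < \<alpha>" "0 < \<beta>"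
    and sub: "\<forall>x\<in>\<Phi>. (\<lambda>y. \<alpha> *\<^sub>R y + x) ` K \<subseteq> \<psi> x \<and> \<psi> x \<subseteq> (\<lambda>y. \<beta> *\<^sub>R y + x) ` K"
  shows "coord_norm.convex_tiling n (\<lambda>y. body_norm K (T y)) \<alpha> \<beta> {x \<in> Rn n. T x \<in> \<Phi>} (\<lambda>x. {y \<in> Rn n. T y \<in> \<psi> (T x)})"
proof -
  interpret N: coord_norm n "\<lambda>y. body_norm K (T y)" by (rule N)
  have bij: "bij_betw \<psi> \<Phi> \<Psi>" using \<Psi>(2) by (simp add: associated_via_def)
  have \<Phi>R: "x \<in> Rn n" if "x \<in> \<Phi>" for x
  proof -
    have "x \<in> Rn_interior n (\<psi> x)" using \<Psi>(2) that by (simp add: associated_via_def)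
    then show ?thesis unfolding Rn_interior_def using interior_of_subset_topspace[of "top_of_set (Rn n)"] by auto
  qed
  have poly: "polytope (\<psi> x)" if "x \<in> \<Phi>" for x
    using \<Psi>(1) bij that by (auto simp: is_polytope_tiling_def bij_betw_def)
  have inj: "x = y" if "x \<in> Rn n" "y \<in> Rn n" "T x = T y" for x y
  proof (rule Rn_eqI[OF that(1,2)])
    fix i assume "i < n"
    have "T (x - y) = 0" using that by (simp add: linear_diff[OF T(1)])
    then have "body_norm K (T (x - y)) = 0" using body_norm_scaleR[of 0 0] by simp
    with N.N_lower[OF \<open>i < n\<close>, of "x - y"] show "coord x i = coord y i" by (simp add: lookup_minus)
  qed
  have pre: "closed {y \<in> Rn n. T y \<in> \<psi> x} \<and> convex {y \<in> Rn n. T y \<in> \<psi> x}" if "x \<in> \<Phi>" for x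
  proof -
    have eq: "{y \<in> Rn n. T y \<in> \<psi> x} = Rn n \<inter> T -` \<psi> x" by auto
    have "convex (Rn n)" by (auto simp: convex_def)
    moreover have "closed (\<psi> x)" "convex (\<psi> x)"
      using poly[OF that] by (auto intro: polytope_imp_closed polytope_imp_convex)
    ultimately show ?thesis
      unfolding eq using T(1,4)
      by (auto intro!: closed_Int closed_Rn closed_vimage convex_Int convex_linear_vimage)
  qed
  show ?thesis
    unfolding N.convex_tiling_def
  proof (intro conjI ballI allI impI subsetI)
    fix y assume y: "y \<in> Rn n"
    have "T y \<in> \<Union>\<Psi>" using \<Psi>(1) T(2) by (simp add: is_polytope_tiling_def)
    then obtain x where x: "x \<in> \<Phi>" "T y \<in> \<psi> x" using bij by (auto simp: bij_betw_def)
    obtain x' where "x' \<in> Rn n" "T x' = x" using T(3)[OF \<Phi>R[OF x(1)]] by blast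
    then show "y \<in> (\<Union>x\<in>{x \<in> Rn n. T x \<in> \<Phi>}. {y \<in> Rn n. T y \<in> \<psi> (T x)})" using x y by auto
  next
    fix x y assume x: "x \<in> {x \<in> Rn n. T x \<in> \<Phi>}" and y: "y \<in> Rn n" "body_norm K (T (y - x)) \<le> \<alpha>"
    then have "T y \<in> (\<lambda>y. \<alpha> *\<^sub>R y + T x) ` K"
      using pos T(2) by (subst mem_scaled_body) (auto simp: linear_diff[OF T(1)])
    then show "y \<in> {y \<in> Rn n. T y \<in> \<psi> (T x)}" using sub x y by blast
  next
    fix x y assume x: "x \<in> {x \<in> Rn n. T x \<in> \<Phi>}" and "y \<in> {y \<in> Rn n. T y \<in> \<psi> (T x)}"
    then have "T y \<in> (\<lambda>y. \<beta> *\<^sub>R y + T x) ` K" using sub by blast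
    then show "body_norm K (T (y - x)) \<le> \<beta>"
      using pos T(2) by (subst (asm) mem_scaled_body) (auto simp: linear_diff[OF T(1)])
  next
    fix x x' z \<epsilon> assume x: "x \<in> {x \<in> Rn n. T x \<in> \<Phi>}" "x' \<in> {x \<in> Rn n. T x \<in> \<Phi>}" and z: "z \<in> Rn n" "0 < \<epsilon>"
      "N.nball z \<epsilon> \<subseteq> {y \<in> Rn n. T y \<in> \<psi> (T x)} \<inter> {y \<in> Rn n. T y \<in> \<psi> (T x')}"
    have "y \<in> \<psi> (T x) \<and> y \<in> \<psi> (T x')" if y: "y \<in> Rn n" "body_norm K (y - T z) < \<epsilon>" for y
    proof -
      obtain u where u: "u \<in> Rn n" "T u = y" using T(3)[OF y(1)] by blast
      then have "u \<in> N.nball z \<epsilon>" using y(2) by (simp add: N.nball_def linear_diff[OF T(1)])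
      then show ?thesis using z(3) u by blast
    qed
    then have "T z \<in> Rn_interior n (\<psi> (T x))" "T z \<in> Rn_interior n (\<psi> (T x'))"
      using z(2) T(2) by (auto intro!: interior_if_ball[of "T z" \<epsilon>])
    moreover have "\<psi> (T x) \<in> \<Psi>" "\<psi> (T x') \<in> \<Psi>" using bij x by (auto simp: bij_betw_def)
    ultimately have "\<psi> (T x) = \<psi> (T x')"
      using \<Psi>(1) unfolding is_polytope_tiling_def pairwise_def by blast
    then have "T x = T x'" using bij x by (auto simp: bij_betw_def inj_on_def)
    then show "x = x'" using x inj by blast
  qed (use pos pre in auto)
qed

lemma chromatic_number_le_tiling:
  fixes m G t J b :: nat and \<tau> \<eta> \<gamma> l :: real
  assumes adm: "admissible_ratio n K k \<gamma>" and \<gamma>: "\<gamma> \<le> 8" and n: "n \<ge> 2" and \<eta>: "0 < \<eta>" "\<eta> < 1"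
    and l_def: "l = 30 * real n ^ 2 * 3 ^ n" and b_def: "b = nat \<lfloor>(4 * \<gamma> / \<eta> + 1) ^ n\<rfloor>"
    and G: "(80 * l * n) ^ n < exp ((6 / (5 * (1 + \<gamma>))) ^ n * (1 - 1 / n) * G)"
    and t: "t \<ge> 1" and \<tau>: "0 < \<tau>" "t * \<tau> < 1"
    and m: "(2 * l * n) ^ n * G * b ^ t < exp (t * (1 - t * \<tau>) * (((1 - \<eta>) / (1 + \<gamma>)) ^ n * (1 - 1 / n)) * m)"
    and J: "b < exp (\<tau> * J)"
  shows "chromatic_number n K \<le> enat (m + G * (t * J))"
proof -
  obtain \<Omega> \<Phi> \<Psi> \<alpha> \<beta> \<psi> where *: "is_polytope_tiling n \<Psi>" "\<gamma> = \<beta> / \<alpha>" "0 < \<alpha>" "0 < \<beta>" "associated_via n \<Phi> \<Psi> \<psi>"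
     "\<forall>x\<in>\<Phi>. (\<lambda>y. \<alpha> *\<^sub>R y + x) ` K \<subseteq> \<psi> x \<and> \<psi> x \<subseteq> (\<lambda>y. \<beta> *\<^sub>R y + x) ` K"
    using adm unfolding admissible_ratio_def by (elim exE conjE)
  obtain T where T: "linear T" "\<And>y. T y \<in> Rn n" "\<And>y. y \<in> Rn n \<Longrightarrow> \<exists>x\<in>Rn n. T x = y"
    "continuous_on UNIV T" "coord_norm n (\<lambda>y. body_norm K (T y))"
    using coordinates by metis
  have \<beta>: "\<beta> = \<gamma> * \<alpha>" using * by simp
  have col: "coord_norm.colorable n (\<lambda>y. body_norm K (T y)) (m + G * (t * J))"
    by (rule coord_norm.tiling_colorable[OF T(5) convex_tiling_transfer[OF T *(1,5,3,4,6)] \<beta>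
        admissible_ratio_ge_1[OF adm] \<gamma> n \<eta> l_def b_def G t \<tau> m J])
  show ?thesis by (rule chromatic_number_le[OF T(1,3,5) col])
qed

lemma chromatic_number_le_trivial:
  fixes m :: nat and l :: real
  assumes "n \<ge> 2" "l = 30 * real n ^ 2 * 3 ^ n" "(40 * l * n) ^ n < exp ((1 / 5) ^ n * (1 - 1 / n) * m)"
  shows "chromatic_number n K \<le> enat m"
proof -
  obtain T where T: "linear T" "\<And>y. T y \<in> Rn n" "\<And>y. y \<in> Rn n \<Longrightarrow> \<exists>x\<in>Rn n. T x = y"
    "continuous_on UNIV T" "coord_norm n (\<lambda>y. body_norm K (T y))"
    using coordinates by metis
  show ?thesis
    by (rule chromatic_number_le[OF T(1,3,5) coord_norm.trivial_colorable[OF T(5) assms]])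
qed

end

section \<open>The tiling by unit cubes\<close>

definition unit_cube :: "nat \<Rightarrow> rvec \<Rightarrow> rvec set" where
  "unit_cube n x = {y \<in> Rn n. \<forall>i<n. \<bar>coord y i - coord x i\<bar> \<le> 1 / 2}"

definition int_lattice :: "nat \<Rightarrow> rvec set" where
  "int_lattice n = {x \<in> Rn n. \<forall>i<n. coord x i \<in> \<int>}"

lemma unit_vec_Rn: "i < n \<Longrightarrow> unit_vec i \<in> Rn n"
  by (auto simp: mem_Rn coord_unit_vec)

text \<open>A cube is the Minkowski sum of a cube of one dimension less and a segment, and taking
  convex hulls commutes with Minkowski sums.\<close>

lemma polytope_unit_cube_0: "polytope (unit_cube m 0)"
proof (induction m)
  case 0
  have "unit_cube 0 0 = {0}"
    by (auto simp: unit_cube_def intro: Rn_eqI[of _ 0])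
  then show ?case by (simp add: polytope_sing)
next
  case (Suc m)
  then obtain V where V: "finite V" "unit_cube m 0 = convex hull V"
    by (auto simp: polytope_def)
  let ?e = "unit_vec m"
  let ?W = "{- (1 / 2) *\<^sub>R ?e, (1 / 2) *\<^sub>R ?e}"
  have "unit_cube (Suc m) 0 = unit_cube m 0 + convex hull ?W"
  proof (intro set_eqI iffI)
    fix y assume y: "y \<in> unit_cube (Suc m) 0"
    define c where "c = coord y m"
    have c: "\<bar>c\<bar> \<le> 1 / 2" using y by (auto simp: unit_cube_def c_def)
    have "c *\<^sub>R ?e = (1 / 2 - c) *\<^sub>R (- (1 / 2) *\<^sub>R ?e) + (1 / 2 + c) *\<^sub>R ((1 / 2) *\<^sub>R ?e)"
      by (simp add: scaleR_add_left[symmetric] algebra_simps flip: scaleR_left_distrib)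
    moreover have "0 \<le> 1 / 2 - c" "0 \<le> 1 / 2 + c" "(1 / 2 - c) + (1 / 2 + c) = 1" using c by auto
    ultimately have "c *\<^sub>R ?e \<in> convex hull ?W" unfolding convex_hull_2 by blast
    moreover have "y - c *\<^sub>R ?e \<in> unit_cube m 0"
      using y by (auto simp: unit_cube_def mem_Rn lookup_minus coord_unit_vec c_def)
    ultimately have "(y - c *\<^sub>R ?e) + c *\<^sub>R ?e \<in> unit_cube m 0 + convex hull ?W" by (rule set_plus_intro[rotated])
    then show "y \<in> unit_cube m 0 + convex hull ?W" by simp
  next
    fix y assume "y \<in> unit_cube m 0 + convex hull ?W"
    then obtain a b where ab: "a \<in> unit_cube m 0" "b \<in> convex hull ?W" "y = a + b"
      by (auto elim: set_plus_elim)
    from ab(2) obtain u v where uv: "0 \<le> u" "0 \<le> v" "u + v = 1"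
        "b = u *\<^sub>R (- (1 / 2) *\<^sub>R ?e) + v *\<^sub>R ((1 / 2) *\<^sub>R ?e)"
      unfolding convex_hull_2 by blast
    have cb: "coord b j = (if j = m then (v - u) / 2 else 0)" for j
      unfolding uv(4) by (auto simp: lookup_add lookup_minus coord_unit_vec diff_divide_distrib)
    have "\<bar>(v - u) / 2\<bar> \<le> 1 / 2" using uv by auto
    then show "y \<in> unit_cube (Suc m) 0"
      using ab(1) cb unfolding ab(3) by (auto simp: unit_cube_def mem_Rn lookup_add less_Suc_eq)
  qed
  also have "\<dots> = convex hull (V + ?W)" using V by (simp add: convex_hull_set_plus)
  finally have "unit_cube (Suc m) 0 = convex hull (V + ?W)" .
  moreover have "finite (V + ?W)" using V(1) by (intro finite_set_plus) simp_all
  ultimately show ?case unfolding polytope_def by (intro exI[of _ "V + ?W"] conjI)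
qed

lemma unit_cube_translate: "x \<in> Rn n \<Longrightarrow> unit_cube n x = (+) x ` unit_cube n 0"
proof (intro set_eqI iffI)
  fix y assume "x \<in> Rn n" "y \<in> unit_cube n x"
  then have "y - x \<in> unit_cube n 0" by (auto simp: unit_cube_def lookup_minus)
  then show "y \<in> (+) x ` unit_cube n 0" by (rule image_eqI[rotated]) simp
qed (auto simp: unit_cube_def lookup_add)

lemma polytope_unit_cube: "x \<in> Rn n \<Longrightarrow> polytope (unit_cube n x)"
  by (subst unit_cube_translate) (simp_all add: polytope_translation_eq polytope_unit_cube_0)

lemma unit_cube_interior: "x \<in> Rn n \<Longrightarrow> x \<in> Rn_interior n (unit_cube n x)"
proof -
  assume x: "x \<in> Rn n"
  have "y \<in> unit_cube n x" if "y \<in> Rn n" "dist y x < 1 / 2" for y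
  proof -
    have "\<bar>coord y i - coord x i\<bar> \<le> 1 / 2" for i
      using abs_coord_le_norm[of "y - x" i] that by (simp add: lookup_minus dist_norm)
    then show ?thesis using that by (simp add: unit_cube_def)
  qed
  then show ?thesis using x unfolding Rn_interior_iff by (intro conjI exI[of _ "1 / 2"]) auto
qed

text \<open>Moving a common interior point by \<open>d\<close> in both directions of an axis shows
  that both centres are within \<open>1 / 2 - d\<close> of it in that coordinate; two integers at
  distance less than 1 agree.\<close>

lemma unit_cube_interiors_disjoint:
  assumes x: "x \<in> int_lattice n" "x' \<in> int_lattice n"
    and z: "z \<in> Rn_interior n (unit_cube n x)" "z \<in> Rn_interior n (unit_cube n x')"
  shows "x = x'"
proof (rule Rn_eqI[of _ n])
  fix i assume i: "i < n"
  obtain e where e: "e > 0" "\<forall>y\<in>Rn n. dist y z < e \<longrightarrow> y \<in> unit_cube n x"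
    and zR: "z \<in> Rn n" using z(1) unfolding Rn_interior_iff by blast
  obtain e' where e': "e' > 0" "\<forall>y\<in>Rn n. dist y z < e' \<longrightarrow> y \<in> unit_cube n x'"
    using z(2) unfolding Rn_interior_iff by blast
  define d where "d = min e e' / 2"
  have d: "0 < d" "d < e" "d < e'" using e e' by (auto simp: d_def)
  have n1: "norm (unit_vec i) = 1" by (simp add: norm_rvec)
  have *: "\<bar>coord z i + s - coord x i\<bar> \<le> 1 / 2 \<and> \<bar>coord z i + s - coord x' i\<bar> \<le> 1 / 2" if s: "\<bar>s\<bar> = d" for s
  proof -
    have R: "z + s *\<^sub>R unit_vec i \<in> Rn n" using zR unit_vec_Rn[OF i] by simp
    have "dist (z + s *\<^sub>R unit_vec i) z = d" using s n1 by (simp add: dist_norm)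
    then have "z + s *\<^sub>R unit_vec i \<in> unit_cube n x" "z + s *\<^sub>R unit_vec i \<in> unit_cube n x'"
      using e e' d R by auto
    then show ?thesis using i by (auto simp: unit_cube_def lookup_add coord_unit_vec)
  qed
  have "\<bar>coord z i + d - coord x i\<bar> \<le> 1 / 2" "\<bar>coord z i + d - coord x' i\<bar> \<le> 1 / 2"
    "\<bar>coord z i - d - coord x i\<bar> \<le> 1 / 2" "\<bar>coord z i - d - coord x' i\<bar> \<le> 1 / 2"
    using *[of d] *[of "- d"] d(1) by simp_all
  then have "\<bar>coord x i - coord x' i\<bar> < 1" using d(1) by linarith
  moreover have "coord x i - coord x' i \<in> \<int>" using x i by (auto simp: int_lattice_def)
  then obtain k :: int where "coord x i - coord x' i = of_int k" by (auto elim: Ints_cases)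
  moreover from calculation have "k = 0" by linarith
  ultimately show "coord x i = coord x' i" by simp
qed (use x in \<open>auto simp: int_lattice_def\<close>)

lemma int_lattice_is_lattice: "is_lattice n (int_lattice n)"
proof -
  let ?B = "unit_vec ` {..<n}"
  have inj: "inj_on unit_vec {..<n}"
  proof (rule inj_onI)
    fix i j :: nat assume "unit_vec i = unit_vec j"
    then have "coord (unit_vec i) j = coord (unit_vec j) j" by simp
    then show "i = j" by (simp add: coord_unit_vec split: if_splits)
  qed
  have sum: "(\<Sum>b\<in>?B. f b *\<^sub>R b) = emb n (\<lambda>i. f (unit_vec i))" for f :: "rvec \<Rightarrow> real"
    by (simp add: sum.reindex[OF inj] emb_def)
  have "independent ?B"
  proof (rule real_vector.independent_if_scalars_zero)
    fix f x assume *: "(\<Sum>x\<in>?B. f x *\<^sub>R x) = 0" "x \<in> ?B"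
    then obtain i where i: "i < n" "x = unit_vec i" by auto
    have "coord (emb n (\<lambda>i. f (unit_vec i))) i = 0" using * unfolding sum by simp
    then show "f x = 0" using i by (simp add: coord_emb)
  qed simp
  moreover have "span ?B = Rn n"
  proof
    have "subspace (Rn n)" by (auto simp: subspace_def)
    then show "span ?B \<subseteq> Rn n" by (intro span_minimal) (auto intro: unit_vec_Rn)
    show "Rn n \<subseteq> span ?B"
    proof
      fix x assume "x \<in> Rn n"
      then have "x = (\<Sum>i<n. coord x i *\<^sub>R unit_vec i)" using emb_coord[of x n] by (simp add: emb_def)
      also have "\<dots> \<in> span ?B" by (intro span_sum span_scale span_base) auto
      finally show "x \<in> span ?B" .
    qed
  qed
  moreover have "int_lattice n = {(\<Sum>b\<in>?B. of_int (z b) *\<^sub>R b) | z :: rvec \<Rightarrow> int. True}"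
  proof (intro set_eqI iffI)
    fix x assume x: "x \<in> int_lattice n"
    define z where "z b = \<lfloor>coord x (inv_into {..<n} unit_vec b)\<rfloor>" for b
    have "emb n (\<lambda>i. of_int (z (unit_vec i))) = x"
    proof (rule Rn_eqI[of _ n])
      fix i assume "i < n"
      then have "coord x i \<in> \<int>" "inv_into {..<n} unit_vec (unit_vec i) = i"
        using x inv_into_f_f[OF inj] by (auto simp: int_lattice_def)
      then show "coord (emb n (\<lambda>i. of_int (z (unit_vec i)))) i = coord x i"
        using \<open>i < n\<close> by (simp add: coord_emb z_def)
    qed (use x in \<open>auto simp: int_lattice_def\<close>)
    then show "x \<in> {(\<Sum>b\<in>?B. of_int (z b) *\<^sub>R b) | z :: rvec \<Rightarrow> int. True}"
      using sum[of "\<lambda>b. of_int (z b)"] by (intro CollectI exI[of _ z]) simp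
  next
    fix x assume "x \<in> {(\<Sum>b\<in>?B. of_int (z b) *\<^sub>R b) | z :: rvec \<Rightarrow> int. True}"
    then obtain z :: "rvec \<Rightarrow> int" where "x = emb n (\<lambda>i. of_int (z (unit_vec i)))"
      using sum[of "\<lambda>b. of_int (_ b)"] by auto
    then show "x \<in> int_lattice n" by (simp add: int_lattice_def coord_emb)
  qed
  ultimately show ?thesis unfolding is_lattice_def by (intro exI[of _ ?B]) simp
qed

text \<open>This makes \<open>min_tiling_parameter\<close> finite; at \<infinity> the conversion
  \<open>real_of_ereal\<close> would return 0.\<close>

lemma (in sym_body) admissible_ratio_exists:
  assumes "k \<ge> 1"
  shows "\<exists>\<gamma>. admissible_ratio n K k \<gamma>"
proof -
  let ?L = "int_lattice n"
  have LR: "x \<in> Rn n" if "x \<in> ?L" for x using that by (simp add: int_lattice_def)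
  have "(+) 0 ` ?L = ?L" by auto
  then have ml: "is_multilattice n ?L ?L"
    unfolding is_multilattice_def using int_lattice_is_lattice by (intro conjI exI[of _ "{0}"]) auto
  have trans: "(+) x ` ?L = ?L" if x: "x \<in> ?L" for x
  proof (intro set_eqI iffI)
    fix y assume "y \<in> ?L"
    then have "y - x \<in> ?L" using x by (auto simp: int_lattice_def lookup_minus)
    then show "y \<in> (+) x ` ?L" by (rule image_eqI[rotated]) simp
  qed (use x in \<open>auto simp: int_lattice_def lookup_add\<close>)
  have "0 \<in> ?L" by (simp add: int_lattice_def)
  then have "(\<lambda>x. (+) x ` ?L) ` ?L = {?L}" using trans by auto
  then have nt: "num_translates ?L ?L \<le> k" using assms by (simp add: num_translates_def)
  let ?Psi = "unit_cube n ` ?L"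
  have inj: "inj_on (unit_cube n) ?L"
    by (rule inj_onI) (metis unit_cube_interiors_disjoint unit_cube_interior LR)
  have tiling: "is_polytope_tiling n ?Psi"
    unfolding is_polytope_tiling_def
  proof (intro conjI ballI)
    fix P assume "P \<in> ?Psi"
    then obtain x where x: "x \<in> ?L" "P = unit_cube n x" by blast
    show "polytope P" "Rn_interior n P \<noteq> {}"
      using polytope_unit_cube[OF LR[OF x(1)]] unit_cube_interior[OF LR[OF x(1)]] x(2) by auto
  next
    show "\<Union> ?Psi = Rn n"
    proof (intro set_eqI iffI)
      fix y assume y: "y \<in> Rn n"
      let ?x = "emb n (\<lambda>i. of_int (round (coord y i)))"
      have "?x \<in> ?L" by (simp add: int_lattice_def coord_emb)
      moreover have "y \<in> unit_cube n ?x"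
        using y of_int_round_abs_le by (auto simp: unit_cube_def coord_emb abs_minus_commute)
      ultimately show "y \<in> \<Union> ?Psi" by blast
    qed (auto simp: unit_cube_def)
    show "pairwise (\<lambda>P Q. Rn_interior n P \<inter> Rn_interior n Q = {}) ?Psi"
      unfolding pairwise_def using unit_cube_interiors_disjoint by blast
  qed
  have av: "associated_via n ?L ?Psi (unit_cube n)"
    unfolding associated_via_def using inj unit_cube_interior LR by (auto simp: bij_betw_def)
  obtain B where B: "\<And>y. y \<in> K \<Longrightarrow> norm y \<le> B" using K_bounded by (auto simp: bounded_iff)
  have B0: "0 \<le> B" using B[OF zero_in_K] by simp
  obtain r where r: "r > 0" "\<And>y. y \<in> Rn n \<Longrightarrow> norm y \<le> r \<Longrightarrow> y \<in> K" using K_inner_ball by blast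
  \<comment> \<open>\<open>K\<close> lies in the ball of radius \<open>B\<close> and contains the
    ball of radius \<open>r\<close> of \<open>Rn n\<close>; the cube lies in the ball of radius
    \<open>n / 2\<close> of the sum norm. \<open>B + 1\<close> serves as a visibly positive
    denominator.\<close>
  define \<alpha> \<beta> where "\<alpha> = 1 / (2 * (B + 1))" and "\<beta> = n / (2 * r)"
  have pos: "\<alpha> > 0" "\<beta> > 0" using B0 r n_pos by (auto simp: \<alpha>_def \<beta>_def)
  have sub: "(\<lambda>y. \<alpha> *\<^sub>R y + x) ` K \<subseteq> unit_cube n x \<and> unit_cube n x \<subseteq> (\<lambda>y. \<beta> *\<^sub>R y + x) ` K" if x: "x \<in> ?L" for x
  proof (intro conjI subsetI)
    fix y assume "y \<in> (\<lambda>y. \<alpha> *\<^sub>R y + x) ` K"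
    then obtain u where u: "u \<in> K" "y = \<alpha> *\<^sub>R u + x" by blast
    have "\<bar>\<alpha> * coord u i\<bar> \<le> 1 / 2" for i
    proof -
      have "\<bar>coord u i\<bar> \<le> B + 1" using abs_coord_le_norm[of u i] B[OF u(1)] by linarith
      then show ?thesis using B0 by (simp add: \<alpha>_def abs_mult divide_le_eq)
    qed
    moreover have "u \<in> Rn n" using u K_Rn by blast
    ultimately show "y \<in> unit_cube n x" using u LR[OF x] by (auto simp: unit_cube_def lookup_add)
  next
    fix y assume y: "y \<in> unit_cube n x"
    then have R: "y - x \<in> Rn n" using LR[OF x] by (simp add: unit_cube_def)
    have "norm (y - x) = (\<Sum>i<n. \<bar>coord (y - x) i\<bar>)" by (rule norm_Rn[OF R])
    also have "\<dots> \<le> (\<Sum>i<n. 1 / 2)" using y by (intro sum_mono) (auto simp: unit_cube_def lookup_minus)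
    also have "\<dots> = n / 2" by simp
    also have "n / 2 = r * \<beta>" using r(1) by (simp add: \<beta>_def)
    finally have "norm (y - x) / \<beta> \<le> r" using pos by (simp add: pos_divide_le_eq)
    then have "norm ((1 / \<beta>) *\<^sub>R (y - x)) \<le> r" using pos by simp
    then have "(1 / \<beta>) *\<^sub>R (y - x) \<in> K" using R by (intro r(2)) auto
    moreover have "y = \<beta> *\<^sub>R ((1 / \<beta>) *\<^sub>R (y - x)) + x" using pos by simp
    ultimately show "y \<in> (\<lambda>y. \<beta> *\<^sub>R y + x) ` K" by blast
  qed
  have "admissible_ratio n K k (\<beta> / \<alpha>)"
    unfolding admissible_ratio_def
    using ml nt tiling pos av sub
    by (intro exI[of _ ?L] exI[of _ ?Psi] exI[of _ \<alpha>] exI[of _ \<beta>] exI[of _ "unit_cube n"] conjI ballI) auto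
  then show ?thesis by blast
qed

lemma (in sym_body) tiling_gamma_approx:
  assumes "k \<ge> 1"
  shows "1 \<le> tiling_gamma n K k" "e > 0 \<Longrightarrow> \<exists>\<gamma>. tiling_gamma n K k \<le> \<gamma> \<and> \<gamma> < tiling_gamma n K k + e \<and> admissible_ratio n K k \<gamma>"
proof -
  let ?m = "min_tiling_parameter n K k"
  obtain \<gamma>0 where "admissible_ratio n K k \<gamma>0" using admissible_ratio_exists[OF assms] by blast
  then have up: "?m \<le> ereal \<gamma>0" by (rule min_tiling_parameter_le)
  have lo: "1 \<le> ?m"
  proof (rule ccontr)
    assume "\<not> 1 \<le> ?m"
    then have "?m < ereal 1" by (simp add: one_ereal_def)
    then obtain \<gamma> where "\<gamma> < 1" "admissible_ratio n K k \<gamma>" using admissible_ratio_if_less by blast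
    then show False using admissible_ratio_ge_1 by fastforce
  qed
  have "\<bar>?m\<bar> \<noteq> \<infinity>" using up lo by auto
  then have eq: "?m = ereal (tiling_gamma n K k)" by (simp add: tiling_gamma_def ereal_real')
  then show "1 \<le> tiling_gamma n K k" using lo by (simp add: one_ereal_def)
  assume "e > 0"
  then have "?m < ereal (tiling_gamma n K k + e)" unfolding eq by simp
  then obtain \<gamma> where g: "\<gamma> < tiling_gamma n K k + e" "admissible_ratio n K k \<gamma>"
    using admissible_ratio_if_less by blast
  have "tiling_gamma n K k \<le> \<gamma>" using min_tiling_parameter_le[OF g(2)] unfolding eq by simp
  then show "\<exists>\<gamma>. tiling_gamma n K k \<le> \<gamma> \<and> \<gamma> < tiling_gamma n K k + e \<and> admissible_ratio n K k \<gamma>" using g by blast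
qed

section \<open>Choice of the parameters\<close>

lemma nat_ceiling_bounds:
  fixes x :: real
  assumes "0 \<le> x"
  shows "x \<le> nat \<lceil>x\<rceil>" "nat \<lceil>x\<rceil> \<le> x + 1"
  using assms by linarith+

text \<open>The assumptions \<open>E1\<close> to \<open>E5\<close> are inequalities in
  \<open>n\<close> alone. They are uniform in \<gamma> between 1 and 8, so a single threshold for
  \<open>n\<close> covers all bodies.\<close>

lemma parameters_for_tiling:
  fixes n :: nat and \<gamma> :: real
  assumes n: "n \<ge> 2" and \<gamma>: "1 \<le> \<gamma>" "\<gamma> \<le> 8" and L: "1 \<le> ln (real n)"
    and E1: "real n * ln (2400 * real n ^ 3 * 3 ^ n) < real n ^ 3"
    and E2: "real n * ln (60 * real n ^ 3 * 3 ^ n) + ln (3 * real n ^ 3) + real n * ln 8 \<le> real n ^ 3"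
    and E3: "ln (32 * real n * ln (real n) + 1) \<le> real n"
    and E4: "(exp (- (real n * ln (1 - 1 / (real n * ln (real n))))) * (1 / (1 - 1 / real n) ^ 2) - 1)
        * (real n * ln (real n) + real n * ln (ln (real n)) + 4 * real n)
      + 3 * (exp (- (real n * ln (1 - 1 / (real n * ln (real n))))) * (1 / (1 - 1 / real n) ^ 2))
      + 1 + 9 * real n ^ 12 * (5 / 6) ^ n \<le> 2 * real n"
    and E5: "real n ^ 4 * (real n ^ 2 + 1) + 1 \<le> 3 * real n ^ 6"
  obtains \<eta> \<tau> :: real and m G t J :: nat where "0 < \<eta>" "\<eta> < 1"
    "(80 * (30 * real n ^ 2 * 3 ^ n) * real n) ^ n < exp ((6 / (5 * (1 + \<gamma>))) ^ n * (1 - 1 / n) * G)"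
    "t \<ge> 1" "0 < \<tau>" "t * \<tau> < 1"
    "(2 * (30 * real n ^ 2 * 3 ^ n) * real n) ^ n * G * (nat \<lfloor>(4 * \<gamma> / \<eta> + 1) ^ n\<rfloor>) ^ t
       < exp (t * (1 - t * \<tau>) * (((1 - \<eta>) / (1 + \<gamma>)) ^ n * (1 - 1 / n)) * m)"
    "nat \<lfloor>(4 * \<gamma> / \<eta> + 1) ^ n\<rfloor> < exp (\<tau> * J)"
    "m + G * (t * J) \<le> (1 + \<gamma>) ^ n *
       (real n * ln (real n) + real n * ln (ln (real n)) + 2 * real n * (1 + ln (2 * \<gamma>)))"
proof -
  \<comment> \<open>This balances two costs: the net contributes
    \<open>n * ln (1 / \<eta>) = n ln n + n ln ln n\<close>, and the extra shrinking contributes a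
    factor of about \<open>1 + 1 / ln n\<close>, that is, about \<open>n\<close> more.\<close>
  define \<eta> where "\<eta> = 1 / (real n * ln (real n))"
  \<comment> \<open>Together with \<open>t = n ^ 3\<close> this gives
    \<open>t * \<tau> = 1 / n\<close>, so the overlaps cost a factor \<open>1 - 1 / n\<close>
    only.\<close>
  define \<tau> where "\<tau> = 1 / real n ^ 4"
  define B where "B = 4 * \<gamma> * (real n * ln (real n)) + 1"
  define \<theta> where "\<theta> = 6 / (5 * (1 + \<gamma>))"
  define p where "p = 1 - 1 / real n"
  define c where "c = (1 - \<eta>) ^ n"
  \<comment> \<open>All multiplicative losses: \<open>c\<close> from the extra shrinking, one factor
    \<open>p\<close> from cutting off at the box and one from the overlaps.\<close>
  define Q where "Q = 1 / (c * p ^ 2)"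
  \<comment> \<open>\<open>n * ln B\<close> is the logarithm of the net of a unit ball. One of the
    two units absorbs, divided by \<open>t\<close>, the logarithm of the number of coarse cells and
    families; the other one makes the inequality strict.\<close>
  define Y where "Y = Q * (n * ln B + 2)"
  define W where "W = real n * ln (real n) + real n * ln (ln (real n))"
  define t where "t = n ^ 3"
  \<comment> \<open>\<open>(1 / \<theta>) ^ n\<close> is the inverse density of the shrunk tiles,
    the factor 2 compensates \<open>p \<ge> 1 / 2\<close>, and by \<open>E1\<close> the factor
    \<open>n ^ 3\<close> exceeds the logarithm of the size of the net of the box.\<close>
  define G where "G = nat \<lceil>2 * real n ^ 3 * (1 / \<theta>) ^ n\<rceil>"
  \<comment> \<open>\<open>n ^ 4\<close> is \<open>1 / \<tau>\<close>, the expected waiting time for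
    a strongly correlated point; the summand 1 provides strictness.\<close>
  define J where "J = nat \<lceil>real n ^ 4 * (n * ln B + 1)\<rceil>"
  define m where "m = nat \<lceil>(1 + \<gamma>) ^ n * Y\<rceil>"
  define b where "b = nat \<lfloor>B ^ n\<rfloor>"
  have n0: "real n \<ge> 2" using n by simp
  have nL: "real n * ln (real n) \<ge> 2"
    using mult_mono[of 2 "real n" 1 "ln (real n)"] n0 L by simp
  have \<eta>: "0 < \<eta>" "\<eta> \<le> 1 / 2" using nL by (auto simp: \<eta>_def divide_simps)
  have B_eq: "4 * \<gamma> / \<eta> + 1 = B" using nL by (simp add: \<eta>_def B_def)
  have gnL: "4 * \<gamma> * (real n * ln (real n)) \<ge> 1"
    using mult_mono[of 4 "4 * \<gamma>" 2 "real n * ln (real n)"] \<gamma> nL by simp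
  have B1: "B \<ge> 1" using gnL by (simp add: B_def)
  have lnB0: "ln B \<ge> 0" using B1 by simp
  have lnBn: "ln B \<le> n"
  proof -
    have "4 * \<gamma> * (real n * ln (real n)) \<le> 32 * (real n * ln (real n))"
      using \<gamma> nL by (intro mult_right_mono) auto
    then have "ln B \<le> ln (32 * real n * ln (real n) + 1)" using B1 by (simp add: B_def)
    then show ?thesis using E3 by linarith
  qed
  have Bexp: "B ^ n = exp (n * ln B)" using B1 by (simp add: exp_of_nat_mult)
  have b: "b \<le> exp (n * ln B)"
  proof -
    have "b \<le> B ^ n" using B1 unfolding b_def by (simp add: of_nat_floor)
    then show ?thesis by (simp add: Bexp)
  qed
  have \<theta>: "0 < \<theta>" "1 / \<theta> = 5 / 6 * (1 + \<gamma>)" "1 \<le> 1 / \<theta>" "1 / \<theta> \<le> 8"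
    using \<gamma> by (auto simp: \<theta>_def)
  have p: "1 / 2 \<le> p" "p < 1" using n0 by (auto simp: p_def field_simps)
  have c: "0 < c" "c \<le> 1" using \<eta> by (auto simp: c_def intro: power_le_one)
  have n3: "real n ^ 3 \<ge> 1" using n0 by (intro one_le_power) simp

  have pow: "x ^ n = exp (n * ln x)" if "x > 0" for x :: real
    using that by (simp add: exp_of_nat_mult)
  have \<theta>n: "\<theta> ^ n * (1 / \<theta>) ^ n = 1" using \<theta>(1) by (simp add: power_mult_distrib[symmetric])
  have \<theta>1: "1 \<le> (1 / \<theta>) ^ n" using \<theta>(3) by (rule one_le_power)
  have G0: "0 \<le> 2 * real n ^ 3 * (1 / \<theta>) ^ n" using \<theta>(1) by simp
  have G_ge: "2 * real n ^ 3 * (1 / \<theta>) ^ n \<le> G" unfolding G_def by (rule nat_ceiling_bounds(1)[OF G0])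
  have "G \<le> 2 * real n ^ 3 * (1 / \<theta>) ^ n + 1" unfolding G_def by (rule nat_ceiling_bounds(2)[OF G0])
  moreover have "1 * 1 \<le> real n ^ 3 * (1 / \<theta>) ^ n" using n3 \<theta>1 by (intro mult_mono) auto
  ultimately have G_le: "G \<le> 3 * real n ^ 3 * (1 / \<theta>) ^ n" by linarith
  have condG: "(80 * (30 * real n ^ 2 * 3 ^ n) * n) ^ n < exp (\<theta> ^ n * p * G)"
  proof -
    have eq: "80 * (30 * real n ^ 2 * 3 ^ n) * n = 2400 * real n ^ 3 * 3 ^ n"
      by (simp add: power2_eq_square power3_eq_cube)
    have "(80 * (30 * real n ^ 2 * 3 ^ n) * n) ^ n = exp (n * ln (2400 * real n ^ 3 * 3 ^ n))"
      unfolding eq using n0 by (intro pow) simp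
    also have "\<dots> < exp (real n ^ 3)" using E1 by simp
    also have "real n ^ 3 \<le> \<theta> ^ n * p * G"
    proof -
      have "1 / 2 * (2 * real n ^ 3) \<le> p * (2 * real n ^ 3)" using p by (intro mult_right_mono) auto
      also have "\<dots> = p * (2 * real n ^ 3 * (\<theta> ^ n * (1 / \<theta>) ^ n))" by (simp only: \<theta>n mult_1_right)
      also have "\<dots> = \<theta> ^ n * p * (2 * real n ^ 3 * (1 / \<theta>) ^ n)" by (simp only: mult_ac)
      also have "\<dots> \<le> \<theta> ^ n * p * G" using G_ge \<theta>(1) p by (intro mult_left_mono) auto
      finally show ?thesis by simp
    qed
    finally show ?thesis by simp
  qed
  have t: "t \<ge> 1" "real t = real n ^ 3" using n by (auto simp: t_def)
  have \<tau>0: "0 < \<tau>" using n0 by (simp add: \<tau>_def)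
  have t\<tau>: "t * \<tau> = 1 / n"
    using n0 by (simp add: t \<tau>_def power_eq_if field_simps)
  have J0: "0 \<le> real n ^ 4 * (n * ln B + 1)" using lnB0 by simp
  have J_ge: "real n ^ 4 * (n * ln B + 1) \<le> J" unfolding J_def by (rule nat_ceiling_bounds(1)[OF J0])
  have condJ: "b < exp (\<tau> * J)"
  proof -
    have "n * ln B + 1 = \<tau> * (real n ^ 4 * (n * ln B + 1))" using n0 by (simp add: \<tau>_def)
    also have "\<dots> \<le> \<tau> * J" using J_ge \<tau>0 by (intro mult_left_mono) auto
    finally have "n * ln B < \<tau> * J" by simp
    then have "exp (n * ln B) < exp (\<tau> * J)" by simp
    with b show ?thesis by linarith
  qed
  have J_le: "J \<le> 3 * real n ^ 6"
  proof -
    have "J \<le> real n ^ 4 * (n * ln B + 1) + 1" unfolding J_def by (rule nat_ceiling_bounds(2)[OF J0])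
    also have "\<dots> \<le> real n ^ 4 * (real n ^ 2 + 1) + 1"
      using lnBn mult_left_mono[OF lnBn, of n] by (intro add_right_mono mult_left_mono) (auto simp: power2_eq_square)
    finally show ?thesis using E5 by linarith
  qed
  have Q0: "Q > 0" using c p by (simp add: Q_def)
  have Y0: "Y \<ge> 0" using Q0 lnB0 by (simp add: Y_def)
  have m0: "0 \<le> (1 + \<gamma>) ^ n * Y" using Y0 \<gamma> by simp
  have m_ge: "(1 + \<gamma>) ^ n * Y \<le> m" unfolding m_def by (rule nat_ceiling_bounds(1)[OF m0])
  have m_le: "m \<le> (1 + \<gamma>) ^ n * Y + 1" unfolding m_def by (rule nat_ceiling_bounds(2)[OF m0])
  have condm: "(2 * (30 * real n ^ 2 * 3 ^ n) * n) ^ n * G * b ^ t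
      < exp (t * (1 - t * \<tau>) * (((1 - \<eta>) / (1 + \<gamma>)) ^ n * p) * m)"
  proof -
    have eq: "2 * (30 * real n ^ 2 * 3 ^ n) * n = 60 * real n ^ 3 * 3 ^ n"
      by (simp add: power2_eq_square power3_eq_cube)
    have 1: "(2 * (30 * real n ^ 2 * 3 ^ n) * n) ^ n = exp (n * ln (60 * real n ^ 3 * 3 ^ n))"
      unfolding eq using n0 by (intro pow) simp
    have "(1 / \<theta>) ^ n \<le> 8 ^ n" using \<theta>(1,4) by (intro power_mono) auto
    then have "3 * real n ^ 3 * (1 / \<theta>) ^ n \<le> 3 * real n ^ 3 * 8 ^ n" by (intro mult_left_mono) auto
    also have "\<dots> = exp (ln (3 * real n ^ 3)) * exp (n * ln 8)" using n0 by (simp add: exp_of_nat_mult)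
    finally have 2: "G \<le> exp (ln (3 * real n ^ 3) + n * ln 8)" using G_le by (simp add: exp_add)
    have 3: "real (b ^ t) \<le> exp (t * (n * ln B))"
      using power_mono[OF b, of t] by (simp add: exp_of_nat_mult)
    have "(2 * (30 * real n ^ 2 * 3 ^ n) * n) ^ n * G * real (b ^ t)
        \<le> exp (n * ln (60 * real n ^ 3 * 3 ^ n)) * exp (ln (3 * real n ^ 3) + n * ln 8) * exp (t * (n * ln B))"
      unfolding 1 using 2 3 by (intro mult_mono) auto
    also have "\<dots> = exp (n * ln (60 * real n ^ 3 * 3 ^ n) + ln (3 * real n ^ 3) + n * ln 8 + t * (n * ln B))"
      by (simp only: exp_add mult_ac)
    also have "\<dots> \<le> exp (t * (n * ln B + 1))"
      using E2 by (simp add: t algebra_simps)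
    also have "\<dots> < exp (t * (n * ln B + 2))"
    proof -
      have "real t > 0" using t(1) by simp
      then show ?thesis unfolding exp_less_cancel_iff by (intro mult_strict_left_mono) auto
    qed
    also have "t * (n * ln B + 2) \<le> t * (1 - t * \<tau>) * (((1 - \<eta>) / (1 + \<gamma>)) ^ n * p) * m"
    proof -
      have g: "(1 + \<gamma>) ^ n > 0" using \<gamma> by simp
      have "n * ln B + 2 = p * (c / (1 + \<gamma>) ^ n * p) * ((1 + \<gamma>) ^ n * Y)"
        using g c p \<gamma>(1) by (simp add: Y_def Q_def power2_eq_square)
      also have "\<dots> \<le> p * (c / (1 + \<gamma>) ^ n * p) * m"
        using m_ge g c p by (intro mult_left_mono) auto
      finally have "t * (n * ln B + 2) \<le> t * (p * (c / (1 + \<gamma>) ^ n * p) * m)"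
        by (intro mult_left_mono) auto
      moreover have "1 - t * \<tau> = p" by (simp add: t\<tau> p_def)
      moreover have "((1 - \<eta>) / (1 + \<gamma>)) ^ n = c / (1 + \<gamma>) ^ n" by (simp add: c_def power_divide)
      ultimately show ?thesis by (simp add: mult.assoc)
    qed
    finally show ?thesis by simp
  qed
  have final: "m + G * (t * J) \<le> (1 + \<gamma>) ^ n *
       (real n * ln (real n) + real n * ln (ln (real n)) + 2 * real n * (1 + ln (2 * \<gamma>)))"
  proof -
    have g1: "(1 + \<gamma>) ^ n \<ge> 1" using \<gamma> by (intro one_le_power) simp
    \<comment> \<open>The residual colours are polynomially many per family, and the factor
      \<open>5 / 6\<close> in \<open>1 / \<theta>\<close> beats this polynomial
      exponentially.\<close>
    have "G * (real t * J) \<le> (3 * real n ^ 3 * (1 / \<theta>) ^ n) * (real n ^ 3 * (3 * real n ^ 6))"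
      using G_le J_le \<theta>(1) by (intro mult_mono) (auto simp: t)
    also have "\<dots> = 9 * real n ^ 12 * (1 / \<theta>) ^ n"
      by (simp add: power_add[symmetric] mult_ac)
    also have "(1 / \<theta>) ^ n = (5 / 6) ^ n * (1 + \<gamma>) ^ n" unfolding \<theta>(2) by (rule power_mult_distrib)
    finally have GJ: "G * (real t * J) \<le> (1 + \<gamma>) ^ n * (9 * real n ^ 12 * (5 / 6) ^ n)" by (simp only: mult_ac)
    have Qeq: "Q = exp (- (real n * ln (1 - 1 / (real n * ln (real n))))) * (1 / (1 - 1 / real n) ^ 2)"
    proof -
      have "c = exp (n * ln (1 - \<eta>))" unfolding c_def using \<eta> by (intro pow) simp
      then show ?thesis by (simp add: Q_def p_def \<eta>_def exp_minus field_simps)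
    qed
    have Q1: "Q \<ge> 1"
    proof -
      have "c * p ^ 2 \<le> 1 * 1" using c p by (intro mult_mono) (auto intro: power_le_one)
      then show ?thesis using c p by (simp add: Q_def)
    qed
    have nB: "n * ln B \<le> W + n * ln (4 * \<gamma>) + 1"
    proof -
      define x where "x = 4 * \<gamma> * (real n * ln (real n))"
      have x0: "x > 0" using gnL by (simp add: x_def)
      have "B = x * (1 + 1 / x)" using x0 by (simp add: B_def x_def[symmetric] distrib_left)
      then have "ln B = ln x + ln (1 + 1 / x)" using x0 by (simp add: ln_mult_pos add_pos_pos)
      also have "\<dots> \<le> ln x + 1 / x" using x0 ln_add_one_self_le_self[of "1 / x"] by simp
      also have "ln x = ln (4 * \<gamma>) + (ln (real n) + ln (ln (real n)))"
        using \<gamma> n0 L by (simp add: x_def ln_mult_pos)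
      finally have "n * ln B \<le> n * (ln (4 * \<gamma>) + (ln (real n) + ln (ln (real n))) + 1 / x)"
        by (intro mult_left_mono) auto
      moreover have "n * (1 / x) \<le> 1"
      proof -
        have "real n * 1 \<le> 4 * \<gamma> * (real n * ln (real n))"
          using mult_mono[of 1 "4 * \<gamma>" "real n * 1" "real n * ln (real n)"] \<gamma> L n0 by simp
        then show ?thesis using x0 by (simp add: divide_le_eq x_def[symmetric])
      qed
      ultimately show ?thesis by (simp add: W_def distrib_left)
    qed
    \<comment> \<open>The error estimate \<open>E4\<close> has to be free of \<gamma>, so the
      logarithm is bounded through \<open>4 * \<gamma> \<le> 2 ^ 5\<close>.\<close>
    have ln4: "0 \<le> ln (4 * \<gamma>)" "ln (4 * \<gamma>) \<le> 4"
    proof -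
      have "ln (4 * \<gamma>) \<le> ln (2 ^ 5)" using \<gamma> by (simp add: ln_le_cancel_iff)
      also have "\<dots> = 5 * ln 2" by (simp only: ln_realpow)
      also have "\<dots> \<le> 4" using ln2_le_25_over_36 by simp
      finally show "ln (4 * \<gamma>) \<le> 4" .
      show "0 \<le> ln (4 * \<gamma>)" using \<gamma> by simp
    qed
    have "Y \<le> Q * (W + n * ln (4 * \<gamma>) + 3)"
      unfolding Y_def using nB Q0 by (intro mult_left_mono) auto
    also have "\<dots> = (W + n * ln (4 * \<gamma>)) + (Q - 1) * (W + n * ln (4 * \<gamma>)) + 3 * Q"
      by (simp add: algebra_simps)
    also have "(Q - 1) * (W + n * ln (4 * \<gamma>)) \<le> (Q - 1) * (W + 4 * real n)"
      using Q1 ln4 mult_left_mono[OF ln4(2), of n] by (intro mult_left_mono) auto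
    finally have "Y + 1 + 9 * real n ^ 12 * (5 / 6) ^ n
        \<le> W + n * ln (4 * \<gamma>) + ((Q - 1) * (W + 4 * real n) + 3 * Q + 1 + 9 * real n ^ 12 * (5 / 6) ^ n)"
      by linarith
    \<comment> \<open>\<open>Q - 1\<close> is about \<open>1 / ln n\<close>, so its product with
      \<open>W + 4 * n\<close> is about \<open>n\<close>; the allowance of \<open>2 * n\<close>
      leaves room for the lower order terms.\<close>
    also have "\<dots> \<le> W + n * ln (4 * \<gamma>) + 2 * real n"
      using E4 unfolding Qeq[symmetric] W_def by linarith
    \<comment> \<open>The net yields \<open>n * ln (4 * \<gamma>)\<close>; since
      \<open>\<gamma> \<ge> 1\<close>, the additional \<open>ln 2\<close> is at most
      \<open>ln (2 * \<gamma>)\<close>.\<close>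
    also have "n * ln (4 * \<gamma>) \<le> n * (2 * ln (2 * \<gamma>))"
    proof (rule mult_left_mono)
      have "ln (4 * \<gamma>) = ln (2 * (2 * \<gamma>))" by simp
      also have "\<dots> = ln 2 + ln (2 * \<gamma>)" using \<gamma> by (simp only: ln_mult_pos)
      also have "\<dots> \<le> 2 * ln (2 * \<gamma>)" using \<gamma> by simp
      finally show "ln (4 * \<gamma>) \<le> 2 * ln (2 * \<gamma>)" .
    qed simp
    finally have tot: "Y + 1 + 9 * real n ^ 12 * (5 / 6) ^ n \<le> W + 2 * real n * (1 + ln (2 * \<gamma>))"
      by (simp add: algebra_simps)
    have "m + G * (real t * J) \<le> (1 + \<gamma>) ^ n * Y + 1 + (1 + \<gamma>) ^ n * (9 * real n ^ 12 * (5 / 6) ^ n)"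
      using m_le GJ by linarith
    also have "\<dots> \<le> (1 + \<gamma>) ^ n * (Y + 1 + 9 * real n ^ 12 * (5 / 6) ^ n)"
      using g1 by (simp add: distrib_left)
    also have "\<dots> \<le> (1 + \<gamma>) ^ n * (W + 2 * real n * (1 + ln (2 * \<gamma>)))"
      using tot g1 by (intro mult_left_mono) auto
    finally show ?thesis by (simp add: W_def)
  qed
  show ?thesis
  proof (rule that[of \<eta> G t \<tau> m J])
    show "0 < \<eta>" "\<eta> < 1" using \<eta> by auto
    show "t * \<tau> < 1" using t\<tau> n0 by simp
  qed (use condG condm condJ final t \<tau>0 in \<open>simp_all add: B_eq \<theta>_def p_def b_def\<close>)
qed

lemma parameters_trivial:
  fixes n :: nat
  assumes n: "n \<ge> 2" and E: "real n * ln (1200 * real n ^ 3 * 3 ^ n) < real n ^ 3"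
    and E': "2 * real n ^ 3 * 5 ^ n + 1 \<le> 9 ^ n"
  obtains m :: nat where "(40 * (30 * real n ^ 2 * 3 ^ n) * real n) ^ n < exp ((1 / 5) ^ n * (1 - 1 / n) * m)" "m \<le> (9::real) ^ n"
proof
  define m where "m = nat \<lceil>2 * real n ^ 3 * 5 ^ n\<rceil>"
  have m: "2 * real n ^ 3 * 5 ^ n \<le> m" "m \<le> 2 * real n ^ 3 * 5 ^ n + 1"
    unfolding m_def using nat_ceiling_bounds[of "2 * real n ^ 3 * 5 ^ n"] by auto
  show "m \<le> (9::real) ^ n" using m E' by linarith
  have n0: "real n \<ge> 2" using n by simp
  have p: "1 / 2 \<le> 1 - 1 / real n" using n0 by (simp add: field_simps)
  have eq: "40 * (30 * real n ^ 2 * 3 ^ n) * n = 1200 * real n ^ 3 * 3 ^ n"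
    by (simp add: power2_eq_square power3_eq_cube)
  have "(40 * (30 * real n ^ 2 * 3 ^ n) * n) ^ n = exp (n * ln (1200 * real n ^ 3 * 3 ^ n))"
    unfolding eq using n0 by (simp add: exp_of_nat_mult)
  also have "\<dots> < exp (real n ^ 3)" using E by simp
  also have "real n ^ 3 \<le> (1 / 5) ^ n * (1 - 1 / n) * m"
  proof -
    have "real n ^ 3 = (1 / 5) ^ n * (1 / 2) * (2 * real n ^ 3 * 5 ^ n)"
      by (simp add: power_divide)
    also have "\<dots> \<le> (1 / 5) ^ n * (1 - 1 / n) * m"
      using p m by (intro mult_mono) auto
    finally show ?thesis .
  qed
  finally show "(40 * (30 * real n ^ 2 * 3 ^ n) * real n) ^ n < exp ((1 / 5) ^ n * (1 - 1 / n) * m)" by simp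
qed

section \<open>The bounds for the chromatic number\<close>

text \<open>A function of a real ratio, because the bound is established for admissible ratios and
  then carried to their infimum by continuity.\<close>

definition chromatic_bound :: "nat \<Rightarrow> real \<Rightarrow> real" where
  "chromatic_bound n \<gamma> = (1 + \<gamma>) ^ n *
     (real n * ln (real n) + real n * ln (ln (real n)) + 2 * real n * (1 + ln (2 * \<gamma>)))"

text \<open>The infimum need not be attained. The chromatic number does not change with the ratio,
  so the bounds for ratios tending to the infimum pass to the limit.\<close>

lemma (in sym_body) chromatic_number_finite_le_tiling_gamma:
  assumes k: "k \<ge> 1" and \<gamma>8: "tiling_gamma n K k < 8"
    and bound: "\<And>\<gamma>. admissible_ratio n K k \<gamma> \<Longrightarrow> \<gamma> \<le> 8 \<Longrightarrow>
      \<exists>M::nat. chromatic_number n K \<le> enat M \<and> M \<le> chromatic_bound n \<gamma>"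
  shows "ereal_of_enat (chromatic_number n K) \<le> ereal (chromatic_bound n (tiling_gamma n K k))"
proof -
  let ?g = "tiling_gamma n K k"
  have g1: "1 \<le> ?g" by (rule tiling_gamma_approx(1)[OF k])
  \<comment> \<open>The factor \<open>8 - ?g\<close> keeps all approximating ratios below 8, where
    the hypothesis \<open>bound\<close> applies.\<close>
  have "\<exists>\<gamma>. ?g \<le> \<gamma> \<and> \<gamma> < ?g + (8 - ?g) / real (Suc j) \<and> admissible_ratio n K k \<gamma>" for j
    using \<gamma>8 by (intro tiling_gamma_approx(2)[OF k]) simp
  then obtain \<gamma> where \<gamma>: "\<And>j. ?g \<le> \<gamma> j" "\<And>j. \<gamma> j < ?g + (8 - ?g) / real (Suc j)"
      "\<And>j. admissible_ratio n K k (\<gamma> j)"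
    by metis
  have \<gamma>le: "\<gamma> j \<le> 8" for j
  proof -
    have "(8 - ?g) / real (Suc j) \<le> (8 - ?g) / 1" using \<gamma>8 by (intro divide_left_mono) auto
    then show ?thesis using \<gamma>(2)[of j] by simp
  qed
  obtain M where M: "chromatic_number n K = enat M"
    using bound[OF \<gamma>(3) \<gamma>le, of 0] by (cases "chromatic_number n K") auto
  have le: "M \<le> chromatic_bound n (\<gamma> j)" for j
    using bound[OF \<gamma>(3) \<gamma>le, of j] by (auto simp: M)
  have "(\<lambda>j. (8 - ?g) / real (Suc j)) \<longlonglongrightarrow> 0"
    by (intro real_tendsto_divide_at_top[OF tendsto_const]) (rule filterlim_compose[OF filterlim_real_sequentially filterlim_Suc])
  then have "(\<lambda>j. ?g + (8 - ?g) / real (Suc j)) \<longlonglongrightarrow> ?g + 0"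
    by (intro tendsto_intros)
  then have "(\<lambda>j. ?g + (8 - ?g) / real (Suc j)) \<longlonglongrightarrow> ?g" by simp
  from tendsto_sandwich[OF _ _ tendsto_const this, of \<gamma>] have lim: "\<gamma> \<longlonglongrightarrow> ?g"
    using \<gamma>(1) less_imp_le[OF \<gamma>(2)] by (simp add: always_eventually)
  have "(\<lambda>j. chromatic_bound n (\<gamma> j)) \<longlonglongrightarrow> chromatic_bound n ?g"
    unfolding chromatic_bound_def using g1 by (intro tendsto_intros lim) auto
  then have "M \<le> chromatic_bound n ?g"
    by (rule LIMSEQ_le_const) (use le in blast)
  then show ?thesis by (simp add: M)
qed

text \<open>One threshold has to serve all \<open>K\<close> and \<open>k\<close>, hence the order of
  the quantifiers. For ratios from 8 on, \<open>9 ^ n\<close> is at most the first factor of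
  \<open>chromatic_bound\<close> and the second factor is at least 1. The bound \<open>9 ^ n\<close>
  is also recorded separately, for sequences with large ratios.\<close>

lemma chromatic_number_eventually:
  "eventually (\<lambda>n. \<forall>K k. symmetric_convex_body n K \<and> k \<ge> 1 \<longrightarrow>
      ereal_of_enat (chromatic_number n K) \<le> ereal (9 ^ n) \<and>
      ereal_of_enat (chromatic_number n K) \<le> ereal (chromatic_bound n (tiling_gamma n K k))) at_top"
proof -
  have "eventually (\<lambda>n::nat. real n * ln (2400 * real n ^ 3 * 3 ^ n) < real n ^ 3) at_top"
    "eventually (\<lambda>n::nat. real n * ln (60 * real n ^ 3 * 3 ^ n) + ln (3 * real n ^ 3) + real n * ln 8 \<le> real n ^ 3) at_top"
    "eventually (\<lambda>n::nat. ln (32 * real n * ln (real n) + 1) \<le> real n) at_top"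
    "eventually (\<lambda>n::nat. (exp (- (real n * ln (1 - 1 / (real n * ln (real n))))) * (1 / (1 - 1 / real n) ^ 2) - 1)
        * (real n * ln (real n) + real n * ln (ln (real n)) + 4 * real n)
      + 3 * (exp (- (real n * ln (1 - 1 / (real n * ln (real n))))) * (1 / (1 - 1 / real n) ^ 2))
      + 1 + 9 * real n ^ 12 * (5 / 6) ^ n \<le> 2 * real n) at_top"
    "eventually (\<lambda>n::nat. real n ^ 4 * (real n ^ 2 + 1) + 1 \<le> 3 * real n ^ 6) at_top"
    "eventually (\<lambda>n::nat. 1 \<le> ln (real n)) at_top"
    "eventually (\<lambda>n::nat. real n * ln (1200 * real n ^ 3 * 3 ^ n) < real n ^ 3) at_top"
    "eventually (\<lambda>n::nat. 2 * real n ^ 3 * 5 ^ n + 1 \<le> 9 ^ n) at_top"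
    "eventually (\<lambda>n::nat. n \<ge> 2) at_top"
    by (real_asymp | rule eventually_ge_at_top)+
  then show ?thesis
  proof eventually_elim
    case (elim n)
    note E = elim
    show ?case
    proof (intro allI impI)
      fix K :: "rvec set" and k :: nat
      assume asm: "symmetric_convex_body n K \<and> k \<ge> 1"
      interpret sym_body n K using asm E(9) by unfold_locales auto
      obtain M :: nat where M: "(40 * (30 * real n ^ 2 * 3 ^ n) * real n) ^ n < exp ((1 / 5) ^ n * (1 - 1 / n) * M)"
          "M \<le> (9::real) ^ n"
        using parameters_trivial[OF E(9,7,8)] by blast
      have "chromatic_number n K \<le> enat M"
        using chromatic_number_le_trivial[OF E(9) refl M(1)] .
      then have "ereal_of_enat (chromatic_number n K) \<le> ereal_of_enat (enat M)"
        by (simp only: ereal_of_enat_le_iff)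
      also have "\<dots> \<le> ereal (9 ^ n)" using M(2) by simp
      finally have triv: "ereal_of_enat (chromatic_number n K) \<le> ereal (9 ^ n)" .
      have "ereal_of_enat (chromatic_number n K) \<le> ereal (chromatic_bound n (tiling_gamma n K k))"
      proof (cases "tiling_gamma n K k < 8")
        case True
        have k: "k \<ge> 1" using asm by blast
        show ?thesis
        proof (rule chromatic_number_finite_le_tiling_gamma[OF k True])
          fix \<gamma> assume adm: "admissible_ratio n K k \<gamma>" and \<gamma>: "\<gamma> \<le> 8"
          show "\<exists>M::nat. chromatic_number n K \<le> enat M \<and> M \<le> chromatic_bound n \<gamma>"
          proof (rule parameters_for_tiling[OF E(9) admissible_ratio_ge_1[OF adm] \<gamma> E(6,1,2,3,4,5)])
            fix \<eta> \<tau> :: real and m G t J :: nat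
            assume p: "0 < \<eta>" "\<eta> < 1"
              "(80 * (30 * real n ^ 2 * 3 ^ n) * real n) ^ n < exp ((6 / (5 * (1 + \<gamma>))) ^ n * (1 - 1 / n) * G)"
              "t \<ge> 1" "0 < \<tau>" "t * \<tau> < 1"
              "(2 * (30 * real n ^ 2 * 3 ^ n) * real n) ^ n * G * (nat \<lfloor>(4 * \<gamma> / \<eta> + 1) ^ n\<rfloor>) ^ t
                 < exp (t * (1 - t * \<tau>) * (((1 - \<eta>) / (1 + \<gamma>)) ^ n * (1 - 1 / n)) * m)"
              "nat \<lfloor>(4 * \<gamma> / \<eta> + 1) ^ n\<rfloor> < exp (\<tau> * J)"
              "m + G * (t * J) \<le> (1 + \<gamma>) ^ n *
                 (real n * ln (real n) + real n * ln (ln (real n)) + 2 * real n * (1 + ln (2 * \<gamma>)))"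
            have "chromatic_number n K \<le> enat (m + G * (t * J))"
              by (rule chromatic_number_le_tiling[OF adm \<gamma> E(9) p(1,2) refl refl p(3-8)])
            then show ?thesis using p(9) by (auto simp: chromatic_bound_def)
          qed
        qed
      next
        case False
        let ?g = "tiling_gamma n K k"
        have g: "8 \<le> ?g" using False by simp
        have "(9::real) ^ n * 1 \<le> (1 + ?g) ^ n *
            (real n * ln (real n) + real n * ln (ln (real n)) + 2 * real n * (1 + ln (2 * ?g)))"
        proof (rule mult_mono)
          show "(9::real) ^ n \<le> (1 + ?g) ^ n" using g by (intro power_mono) auto
          have "0 \<le> real n * ln (real n)" "0 \<le> real n * ln (ln (real n))" using E(6) by auto
          moreover have "1 \<le> 2 * real n * 1" using E(9) by simp
          moreover have "2 * real n * 1 \<le> 2 * real n * (1 + ln (2 * ?g))" using g by (intro mult_left_mono) auto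
          ultimately show "1 \<le> real n * ln (real n) + real n * ln (ln (real n)) + 2 * real n * (1 + ln (2 * ?g))"
            by linarith
        qed (use g in auto)
        then have "ereal (9 ^ n) \<le> ereal (chromatic_bound n ?g)" by (simp add: chromatic_bound_def)
        with triv show ?thesis by (rule order_trans)
      qed
      with triv show "ereal_of_enat (chromatic_number n K) \<le> ereal (9 ^ n) \<and>
        ereal_of_enat (chromatic_number n K) \<le> ereal (chromatic_bound n (tiling_gamma n K k))" ..
    qed
  qed
qed

theorem theorem1:
  shows "(\<exists>N::nat. \<forall>n\<ge>N. \<forall>(K::rvec set) (k::nat).
            symmetric_convex_body n K \<and> k \<ge> 1 \<longrightarrow>
            ereal_of_enat (chromatic_number n K) \<le>
              ereal ((1 + tiling_gamma n K k) ^ n *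
                (real n * ln (real n) + real n * ln (ln (real n)) + 2 * ln (real k)
                  + 2 * real n * (1 + ln (2 * tiling_gamma n K k)))))
       \<and> (\<forall>(K :: nat \<Rightarrow> rvec set) (k :: nat \<Rightarrow> nat) (c::real).
            (\<forall>n\<ge>1. symmetric_convex_body n (K n) \<and> k n \<ge> 1 \<and>
                    real (k n) \<le> real n powr (c * real n)) \<longrightarrow>
            (\<exists>\<epsilon> :: nat \<Rightarrow> real. \<epsilon> \<longlonglongrightarrow> 0 \<and>
               (\<forall>\<^sub>F n in sequentially.
                  ereal_of_enat (chromatic_number n (K n)) \<le>
                    ereal ((1 + tiling_gamma n (K n) (k n) + \<epsilon> n) ^ n))))"
proof (rule conjI)
  obtain N0 where N0: "\<And>n K k. n \<ge> N0 \<Longrightarrow> symmetric_convex_body n K \<and> k \<ge> 1 \<Longrightarrow>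
      ereal_of_enat (chromatic_number n K) \<le> ereal (chromatic_bound n (tiling_gamma n K k))"
    using chromatic_number_eventually unfolding eventually_sequentially by blast
  show "\<exists>N::nat. \<forall>n\<ge>N. \<forall>(K::rvec set) (k::nat).
            symmetric_convex_body n K \<and> k \<ge> 1 \<longrightarrow>
            ereal_of_enat (chromatic_number n K) \<le>
              ereal ((1 + tiling_gamma n K k) ^ n *
                (real n * ln (real n) + real n * ln (ln (real n)) + 2 * ln (real k)
                  + 2 * real n * (1 + ln (2 * tiling_gamma n K k))))"
  proof (intro exI[of _ "max N0 1"] allI impI)
    fix n :: nat and K :: "rvec set" and k :: nat
    assume n: "max N0 1 \<le> n" and asm: "symmetric_convex_body n K \<and> k \<ge> 1"
    interpret sym_body n K using n asm by unfold_locales auto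
    have k: "k \<ge> 1" using asm by blast
    let ?g = "tiling_gamma n K k"
    have "ereal_of_enat (chromatic_number n K) \<le> ereal (chromatic_bound n ?g)"
      using n asm by (intro N0) auto
    also have "chromatic_bound n ?g \<le> (1 + ?g) ^ n *
        (real n * ln (real n) + real n * ln (ln (real n)) + 2 * ln (real k) + 2 * real n * (1 + ln (2 * ?g)))"
      \<comment> \<open>The summand \<open>2 * ln k\<close> is nonnegative because
        \<open>k \<ge> 1\<close>.\<close>
      unfolding chromatic_bound_def using tiling_gamma_approx(1)[OF k] k by (intro mult_left_mono) auto
    finally show "ereal_of_enat (chromatic_number n K) \<le> ereal ((1 + ?g) ^ n *
        (real n * ln (real n) + real n * ln (ln (real n)) + 2 * ln (real k) + 2 * real n * (1 + ln (2 * ?g))))"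
      by simp
  qed
next
  show "\<forall>(K :: nat \<Rightarrow> rvec set) (k :: nat \<Rightarrow> nat) (c::real).
            (\<forall>n\<ge>1. symmetric_convex_body n (K n) \<and> k n \<ge> 1 \<and>
                    real (k n) \<le> real n powr (c * real n)) \<longrightarrow>
            (\<exists>\<epsilon> :: nat \<Rightarrow> real. \<epsilon> \<longlonglongrightarrow> 0 \<and>
               (\<forall>\<^sub>F n in sequentially.
                  ereal_of_enat (chromatic_number n (K n)) \<le>
                    ereal ((1 + tiling_gamma n (K n) (k n) + \<epsilon> n) ^ n)))"
  proof (intro allI impI)
    fix K :: "nat \<Rightarrow> rvec set" and k :: "nat \<Rightarrow> nat" and c :: real
    assume asm: "\<forall>n\<ge>1. symmetric_convex_body n (K n) \<and> k n \<ge> 1 \<and> real (k n) \<le> real n powr (c * real n)"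
    \<comment> \<open>For ratios up to 8 and large \<open>n\<close> the second factor of the bound
      is at most \<open>n ^ 2\<close>, whose \<open>n\<close>-th root is
      \<open>n powr (2 / n)\<close>. Multiplying its excess over 1 by
      \<open>1 + \<gamma> \<le> 9\<close> turns this factor into an additive error.\<close>
    define \<epsilon> where "\<epsilon> = (\<lambda>n::nat. 9 * (real n powr (2 / real n) - 1))"
    have "\<epsilon> \<longlonglongrightarrow> 0" unfolding \<epsilon>_def by real_asymp
    moreover have "\<forall>\<^sub>F n in sequentially. ereal_of_enat (chromatic_number n (K n)) \<le>
                    ereal ((1 + tiling_gamma n (K n) (k n) + \<epsilon> n) ^ n)"
    proof -
      have "eventually (\<lambda>n::nat. real n * ln (real n) + real n * ln (ln (real n)) + 2 * real n * (1 + ln 16) \<le> real n ^ 2) at_top"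
        by real_asymp
      with chromatic_number_eventually eventually_ge_at_top[of 1] show ?thesis
      proof eventually_elim
        case (elim n)
        have body: "symmetric_convex_body n (K n)" and k: "k n \<ge> 1" using asm elim(2) by auto
        interpret sym_body n "K n" using body elim(2) by unfold_locales auto
        let ?g = "tiling_gamma n (K n) (k n)"
        have g: "1 \<le> ?g" by (rule tiling_gamma_approx(1)[OF k])
        have n0: "real n \<ge> 1" using elim(2) by simp
        have \<epsilon>0: "0 \<le> \<epsilon> n" using n0 by (simp add: \<epsilon>_def ge_one_powr_ge_zero)
        have both: "ereal_of_enat (chromatic_number n (K n)) \<le> ereal (9 ^ n)"
            "ereal_of_enat (chromatic_number n (K n)) \<le> ereal (chromatic_bound n ?g)"
          using elim(1) body k by auto
        show ?case
        \<comment> \<open>The ratios may be unbounded along the sequence, and then a factor tending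
          to 1 is no additive error tending to 0; above 8 the bound \<open>9 ^ n\<close> takes
          over.\<close>
        proof (cases "?g \<le> 8")
          case False
          then have "(9::real) ^ n \<le> (1 + ?g + \<epsilon> n) ^ n" using \<epsilon>0 by (intro power_mono) auto
          then show ?thesis using both(1) by (meson ereal_less_eq(3) order_trans)
        next
          case True
          define r where "r = real n powr (2 / real n)"
          have r: "r \<ge> 1" "r ^ n = real n ^ 2"
          proof -
            show "r \<ge> 1" using n0 by (simp add: r_def ge_one_powr_ge_zero)
            have "r ^ n = r powr real n" using n0 by (simp add: r_def powr_realpow)
            also have "\<dots> = real n powr 2" using n0 by (simp add: r_def powr_powr)
            finally show "r ^ n = real n ^ 2" using n0 by (simp add: powr_numeral)
          qed
          have "ln (2 * ?g) \<le> ln 16" using g True by simp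
          then have "2 * real n * (1 + ln (2 * ?g)) \<le> 2 * real n * (1 + ln 16)" by (intro mult_left_mono) auto
          then have "chromatic_bound n ?g \<le> (1 + ?g) ^ n * real n ^ 2"
            unfolding chromatic_bound_def using elim(3) g by (intro mult_left_mono) auto
          also have "\<dots> = ((1 + ?g) * r) ^ n" by (simp add: r power_mult_distrib)
          also have "\<dots> \<le> (1 + ?g + \<epsilon> n) ^ n"
          proof (rule power_mono)
            have "(1 + ?g) * (r - 1) \<le> 9 * (r - 1)" using r True by (intro mult_right_mono) auto
            then show "(1 + ?g) * r \<le> 1 + ?g + \<epsilon> n" by (simp add: \<epsilon>_def r_def algebra_simps)
          qed (use g r in auto)
          finally show ?thesis using both(2) by (meson ereal_less_eq(3) order_trans)
        qed
      qed
    qed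
    ultimately show "\<exists>\<epsilon> :: nat \<Rightarrow> real. \<epsilon> \<longlonglongrightarrow> 0 \<and>
               (\<forall>\<^sub>F n in sequentially.
                  ereal_of_enat (chromatic_number n (K n)) \<le>
                    ereal ((1 + tiling_gamma n (K n) (k n) + \<epsilon> n) ^ n))" by blast
  qed
qed

end
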